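(* Let $g:\mathbb{R}\to\mathbb{R}$ be a continuous function for which there exist $a_1,a_2>0$ and $q\in[1,2^* )$ such that $$|g(t)|\leq a_1+a_2|t|^{q-1}\quad\text{for all } t\in\mathbb{R},$$ and satisfying $$\liminf_{t\to0^+}\frac{\int_0^t g(\tau)\,d\tau}{t^2}=+\infty.$$ Let $h:[0,+\infty)\to\mathbb{R}$ be the function defined by $$h(t):=\frac{t-c_{2^*_s}^{2^*}\,t^{2^*-1}}{a_1c_{2^*_s}|\Omega|^{\frac{2^*-1}{2^*}}+a_2c_{2^*_s}^{q}|\Omega|^{\frac{2^*-q}{2^*}}t^{q-1}}\quad\text{for all } t\geq0.$$ Then there exists a nonempty open interval $\Lambda\subseteq\left(0,\max_{[0,+\infty)}h\right)$ such that, for every $\lambda\in\Lambda$, the problem $$\begin{cases}(-\Delta)^su=|u|^{2^*-2}u+\lambda g(u)&\text{in }\Omega\\ u=0&\text{in }\mathbb{R}^n\setminus\Omega\end{cases}$$ admits a non-trivial (i.e. not identically zero) weak solution in $X_{0,s}$.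
   Context: Standing assumptions: $s\in(0,1)$, $n$ is a positive integer with $n>2s$, $\Omega\subset\mathbb{R}^n$ is (nonempty) open, bounded, with Lipschitz boundary, $|\Omega|$ is its Lebesgue measure, and $2^*:=\frac{2n}{n-2s}$. The fractional Laplacian is $(-\Delta)^su(x):=-\int_{\mathbb{R}^n}\frac{u(x+y)+u(x-y)-2u(x)}{|y|^{n+2s}}\,dy$ (no further normalization constant). $X_{0,s}:=\{u\in H^s(\mathbb{R}^n): u=0\text{ a.e. in }\mathbb{R}^n\setminus\Omega\}$, where $H^s(\mathbb{R}^n)$ is the usual fractional Sobolev space (real-valued functions), with norm $$\|u\|_{X_{0,s}}:=\left(\int_{\mathbb{R}^{2n}}\frac{|u(x)-u(y)|^2}{|x-y|^{n+2s}}\,dx\,dy\right)^{1/2}$$ and $$c_{2^*_s}:=\sup_{u\in X_{0,s}\setminus\{0\}}\frac{\|u\|_{L^{2^*}(\mathbb{R}^n)}}{\|u\|_{X_{0,s}}},$$ which is finite by the continuous embedding $X_{0,s}\hookrightarrow L^{2^*}(\mathbb{R}^n)$. A weak solution of the problem is a function $u\in X_{0,s}$ such that for every $v\in X_{0,s}$ $$\int_{\mathbb{R}^{2n}}\frac{(u(x)-u(y))(v(x)-v(y))}{|x-y|^{n+2s}}\,dx\,dy=\int_\Omega|u|^{2^*-2}uv\,dx+\lambda\int_\Omega g(u)v\,dx.$$ Convention: $t^0=1$ for all $t\ge 0$. *)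

theory Defs
  imports "HOL-Analysis.Analysis"
begin

definition crit_exp :: "nat \<Rightarrow> real \<Rightarrow> real" where
  "crit_exp n s = 2 * real n / (real n - 2 * s)"

text \<open>Real powers of a non-negative base with the convention \<open>t^0 = 1\<close> also at \<open>t = 0\<close>;
  the library has \<open>0 powr 0 = 0\<close>.\<close>

definition rpow :: "real \<Rightarrow> real \<Rightarrow> real" where
  "rpow t p = (if p = 0 then 1 else t powr p)"

text \<open>Near each boundary point the set is, in coordinates given by some unit vector \<open>e\<close>
  (height) and its orthogonal hyperplane, the strict epigraph of a Lipschitz function.
  In dimension one the hyperplane is \<open>{0}\<close>.\<close>

definition lipschitz_boundary :: "(real ^ 'n) set \<Rightarrow> bool" where
  "lipschitz_boundary \<Omega> \<longleftrightarrow>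
     (\<forall>x \<in> frontier \<Omega>. \<exists>r > 0. \<exists>e. norm e = 1 \<and>
        (\<exists>L \<gamma>. L-lipschitz_on {z. z \<bullet> e = 0} \<gamma> \<and>
           \<Omega> \<inter> ball x r = {y \<in> ball x r. y \<bullet> e > (\<gamma> (y - (y \<bullet> e) *\<^sub>R e) :: real)}))"

definition gagliardo_integrand ::
  "real \<Rightarrow> (real ^ 'n \<Rightarrow> real) \<Rightarrow> (real ^ 'n \<Rightarrow> real) \<Rightarrow> (real ^ 'n) \<times> (real ^ 'n) \<Rightarrow> real" where
  "gagliardo_integrand s u v =
     (\<lambda>(x, y). (u x - u y) * (v x - v y) / norm (x - y) powr (real CARD('n) + 2 * s))"

definition gagliardo_form ::
  "real \<Rightarrow> (real ^ 'n \<Rightarrow> real) \<Rightarrow> (real ^ 'n \<Rightarrow> real) \<Rightarrow> real" where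
  "gagliardo_form s u v =
     integral\<^sup>L (lborel \<Otimes>\<^sub>M lborel) (gagliardo_integrand s u v)"

text \<open>Elements are functions rather than almost-everywhere classes, so that \<open>u = 0\<close> in the
  space has to be read as \<open>u = 0\<close> almost everywhere. Every class of Lebesgue measurable
  functions has a Borel representative, so Borel measurability is no restriction.\<close>

definition frac_sobolev :: "real \<Rightarrow> (real ^ 'n \<Rightarrow> real) set" where
  "frac_sobolev s =
     {u. u \<in> borel_measurable lborel \<and>
         integrable lborel (\<lambda>x. (u x)\<^sup>2) \<and>
         integrable (lborel \<Otimes>\<^sub>M lborel) (gagliardo_integrand s u u)}"

definition X0 :: "(real ^ 'n) set \<Rightarrow> real \<Rightarrow> (real ^ 'n \<Rightarrow> real) set" where
  "X0 \<Omega> s = {u \<in> frac_sobolev s. AE x in lborel. x \<notin> \<Omega> \<longrightarrow> u x = 0}"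

definition X0_norm :: "real \<Rightarrow> (real ^ 'n \<Rightarrow> real) \<Rightarrow> real" where
  "X0_norm s u = sqrt (gagliardo_form s u u)"

definition Lp_norm :: "real \<Rightarrow> (real ^ 'n \<Rightarrow> real) \<Rightarrow> real" where
  "Lp_norm p u = (\<integral>x. \<bar>u x\<bar> powr p \<partial>lborel) powr (1 / p)"

text \<open>The supremum is taken in the reals: for \<open>0 < s < 1\<close>, \<open>n > 2 s\<close> and bounded open \<open>\<Omega>\<close>,
  the continuous embedding into the critical Lebesgue space makes all the norms finite
  and the set bounded above.\<close>

definition embedding_const :: "(real ^ 'n) set \<Rightarrow> real \<Rightarrow> real" where
  "embedding_const \<Omega> s =
     (SUP u \<in> {u \<in> X0 \<Omega> s. \<not> (AE x in lborel. u x = 0)}.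
        Lp_norm (crit_exp CARD('n) s) u / X0_norm s u)"

text \<open>Weak solutions of \<open>(-\<Delta>)^s u = |u|^(2^* - 2) u + \<lambda> g(u)\<close> in \<open>\<Omega>\<close>, \<open>u = 0\<close> outside \<open>\<Omega>\<close>, for
  \<open>(-\<Delta>)^s u(x) = - \<integral> (u(x + y) + u(x - y) - 2 u(x)) / |y|^(n + 2 s) dy\<close> without further
  normalization. Existence of the integrals on the right-hand side is required explicitly,
  because the library integral of a non-integrable function is \<open>0\<close>; it is automatic
  when \<open>g\<close> is continuous with subcritical growth and \<open>\<Omega>\<close> is bounded.\<close>

definition weak_solution ::
  "(real ^ 'n) set \<Rightarrow> real \<Rightarrow> (real \<Rightarrow> real) \<Rightarrow> real \<Rightarrow> (real ^ 'n \<Rightarrow> real) \<Rightarrow> bool" where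
  "weak_solution \<Omega> s g \<mu> u \<longleftrightarrow>
     u \<in> X0 \<Omega> s \<and>
     (\<forall>v \<in> X0 \<Omega> s.
        set_integrable lborel \<Omega> (\<lambda>x. \<bar>u x\<bar> powr (crit_exp CARD('n) s - 2) * u x * v x) \<and>
        set_integrable lborel \<Omega> (\<lambda>x. g (u x) * v x) \<and>
        gagliardo_form s u v =
          (LINT x:\<Omega>|lborel. \<bar>u x\<bar> powr (crit_exp CARD('n) s - 2) * u x * v x)
          + \<mu> * (LINT x:\<Omega>|lborel. g (u x) * v x))"

end

theory Submission imports Defs "HOL-Complex_Analysis.Great_Picard" begin

text \<open>Write \<open>[u]\<^sup>2\<close> for the Gagliardo form of \<open>u\<close> with itself, \<open>p\<close> for the critical exponent and
\<open>G\<close> for the primitive of \<open>g\<close> that vanishes at \<open>0\<close>. Weak solutions are critical points of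
\<open>E(u) = [u]\<^sup>2 / 2 - \<integral>\<^bsub>\<Omega>\<^esub> (|u|^p / p + \<mu> G(u))\<close>. The solution found here is a minimizer of \<open>E\<close> on a
ball \<open>[u] \<le> \<rho>\<close> of small radius. Since only some open interval of parameters is asked for, \<open>\<rho>\<close> can
be fixed first and \<open>\<mu>\<close> taken small afterwards.

The Sobolev inequality \<open>\<integral> |u|^p \<le> S [u]^p\<close> (\<open>fractional_sobolev\<close>) makes
\<open>E\<^sub>0(w) = [w]\<^sup>2 / 2 - \<integral>\<^bsub>\<Omega>\<^esub> |w|^p / p\<close> nonnegative for \<open>[w] \<le> 2 \<rho>\<close> if \<open>\<rho>\<close> is small, although \<open>p\<close> is critical and
the embedding into \<open>L^p\<close> is not compact. Below the critical exponent there is compactness: a minimizing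
sequence \<open>u k\<close> has a subsequence that converges almost everywhere to some \<open>u\<close>
(\<open>X0_bounded_imp_AE_convergent_subseq\<close>), and then \<open>\<integral> G(u k) \<rightarrow> \<integral> G(u)\<close> (\<open>tendsto_integral_subcritical\<close>).
The Brezis-Lieb lemma (\<open>brezis_lieb\<close>), applied both to the difference quotients with exponent \<open>2\<close> and
to the functions with exponent \<open>p\<close>, splits the rest of the energy, so that
\<open>E(u k) = E(u) + E\<^sub>0(u k - u) + o(1)\<close>. Because \<open>[u k - u] \<le> 2 \<rho>\<close>, the middle term is nonnegative and
\<open>u\<close> is a minimizer (\<open>energy_minimizer_exists\<close>).

The hypothesis on \<open>g\<close> at \<open>0+\<close> says that \<open>G\<close> beats every multiple of \<open>t\<^sup>2\<close>, so that \<open>E\<close> is negative at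
a small multiple of a bump (\<open>energy_negative_somewhere\<close>). The minimum is therefore negative and the
minimizer is not zero. On the sphere \<open>[u] = \<rho>\<close> the energy is at least \<open>(1/2 - 1/p) \<rho>\<^sup>2\<close> minus a
multiple of \<open>\<mu>\<close>, which is positive for small \<open>\<mu>\<close>. So the minimizer lies inside the ball and solves the
Euler-Lagrange equation (\<open>minimizer_one_sided\<close>).

It remains to see that \<open>h\<close> has a positive maximum (\<open>h_attains_positive_max\<close>), for which the
embedding constant must be positive. The Sobolev inequality enters here too: it is what makes the
supremum that defines the constant a genuine one (\<open>embedding_const_pos\<close>).\<close>

section \<open>Powers and convergence of integrals\<close>

lemma powr_diff_le_mvt:
  fixes x y p :: real
  assumes "0 \<le> x" "x \<le> y" "1 \<le> p"
  shows "y powr p - x powr p \<le> p * y powr (p - 1) * (y - x)"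
proof (cases "x = y")
  case False
  then have xy: "x < y" using assms by simp
  obtain z where z: "x < z" "z < y" "y powr p - x powr p = p * z powr (p - 1) * (y - x)"
  proof (rule mvt[OF xy, of "\<lambda>t. t powr p" "\<lambda>t d. p * t powr (p - 1) * d"])
    show "continuous_on {x..y} (\<lambda>t. t powr p)"
      using assms by (intro continuous_on_powr') (auto intro: continuous_intros)
    show "((\<lambda>t. t powr p) has_derivative (\<lambda>d. p * t powr (p - 1) * d)) (at t)"
      if "x < t" "t < y" for t
    proof -
      have "((\<lambda>t. t powr p) has_real_derivative p * t powr (p - 1)) (at t)"
        using that assms by (auto intro!: derivative_eq_intros simp: powr_diff field_simps)
      then show ?thesis by (simp add: has_field_derivative_def)
    qed
  qed auto
  have "z powr (p - 1) \<le> y powr (p - 1)" using z assms by (intro powr_mono2) auto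
  then show ?thesis using z assms xy by (simp add: mult_left_mono mult_right_mono)
qed auto

lemma powr_add_le:
  fixes x y p :: real
  assumes "0 \<le> x" "0 \<le> y" "0 \<le> p"
  shows "(x + y) powr p \<le> 2 powr p * (x powr p + y powr p)"
proof -
  have "(x + y) powr p \<le> (2 * max x y) powr p" using assms by (intro powr_mono2) auto
  also have "\<dots> = 2 powr p * (max x y) powr p" using assms by (simp add: powr_mult)
  also have "(max x y) powr p \<le> x powr p + y powr p" by (auto simp: max_def)
  finally show ?thesis by simp
qed

lemma powr_abs_add_le:
  fixes x y p :: real
  assumes "0 \<le> p"
  shows "\<bar>x + y\<bar> powr p \<le> 2 powr p * (\<bar>x\<bar> powr p + \<bar>y\<bar> powr p)"
  by (rule order_trans[OF powr_mono2 powr_add_le]) (use assms in auto)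

lemma le_one_plus_powr:
  fixes x r p :: real
  assumes "0 \<le> x" "0 \<le> r" "r \<le> p"
  shows "x powr r \<le> 1 + x powr p"
proof (cases "x \<le> 1")
  case True
  have "x powr r \<le> 1 powr r" using assms True by (intro powr_mono2) auto
  then show ?thesis by (simp add: add_increasing2)
next
  case False
  then have "x powr r \<le> x powr p" using assms by (intro powr_mono) auto
  then show ?thesis by simp
qed

text \<open>The pointwise inequality behind the Brezis-Lieb lemma: where \<open>b\<close> is small compared to \<open>a\<close>, the mean
value theorem produces a small multiple of \<open>|a|^p\<close>, and elsewhere both powers are controlled by \<open>|b|^p\<close>.\<close>

lemma powr_perturbation:
  fixes p \<epsilon> :: real
  assumes p: "1 \<le> p" and \<epsilon>: "0 < \<epsilon>"
  shows "\<exists>C\<ge>0. \<forall>a b. \<bar>\<bar>a + b\<bar> powr p - \<bar>a\<bar> powr p\<bar> \<le> \<epsilon> * \<bar>a\<bar> powr p + C * \<bar>b\<bar> powr p"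
proof -
  define X where "X = p * 2 powr (p - 1)"
  \<comment> \<open>\<open>|b| \<le> \<delta> |a|\<close> is the regime in which the mean value theorem is used\<close>
  define \<delta> where "\<delta> = min 1 (\<epsilon> / X)"
  have X: "0 < X" using p by (simp add: X_def)
  have \<delta>: "0 < \<delta>" "\<delta> \<le> 1" using X \<epsilon> by (auto simp: \<delta>_def)
  have "X * \<delta> \<le> X * (\<epsilon> / X)" using X by (intro mult_left_mono) (auto simp: \<delta>_def)
  then have X\<delta>: "X * \<delta> \<le> \<epsilon>" using X by simp
  define C where "C = (1 + 1 / \<delta>) powr p"
  have "\<bar>\<bar>a + b\<bar> powr p - \<bar>a\<bar> powr p\<bar> \<le> \<epsilon> * \<bar>a\<bar> powr p + C * \<bar>b\<bar> powr p" for a b :: real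
  proof (cases "\<bar>b\<bar> \<le> \<delta> * \<bar>a\<bar>")
    case True
    define M where "M = max \<bar>a + b\<bar> \<bar>a\<bar>"
    have "\<delta> * \<bar>a\<bar> \<le> 1 * \<bar>a\<bar>" using \<delta> by (intro mult_right_mono) auto
    then have M: "0 \<le> M" "M \<le> 2 * \<bar>a\<bar>" unfolding M_def using True by auto
    have M1: "M powr (p - 1) \<le> (2 * \<bar>a\<bar>) powr (p - 1)" using M p by (intro powr_mono2) auto
    have "\<bar>\<bar>a + b\<bar> powr p - \<bar>a\<bar> powr p\<bar> \<le> p * M powr (p - 1) * \<bar>\<bar>a + b\<bar> - \<bar>a\<bar>\<bar>"
    proof (cases "\<bar>a + b\<bar> \<le> \<bar>a\<bar>")
      case True
      then have "\<bar>a + b\<bar> powr p \<le> \<bar>a\<bar> powr p" using p by (intro powr_mono2) auto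
      with powr_diff_le_mvt[of "\<bar>a + b\<bar>" "\<bar>a\<bar>" p] True p show ?thesis
        by (simp add: M_def abs_minus_commute)
    next
      case False
      then have "\<bar>a\<bar> powr p \<le> \<bar>a + b\<bar> powr p" using p by (intro powr_mono2) auto
      with powr_diff_le_mvt[of "\<bar>a\<bar>" "\<bar>a + b\<bar>" p] False p show ?thesis
        by (simp add: M_def)
    qed
    also have "\<dots> \<le> p * (2 * \<bar>a\<bar>) powr (p - 1) * (\<delta> * \<bar>a\<bar>)"
      using M1 p True by (intro mult_mono) auto
    also have "\<dots> = (X * \<delta>) * \<bar>a\<bar> powr p"
      by (cases "a = 0") (auto simp: X_def powr_mult powr_diff)
    also have "\<dots> \<le> \<epsilon> * \<bar>a\<bar> powr p" using X\<delta> by (intro mult_right_mono) auto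
    finally show ?thesis by (simp add: C_def add_increasing2)
  next
    case False
    then have a: "\<bar>a\<bar> \<le> (1 / \<delta>) * \<bar>b\<bar>" using \<delta> by (simp add: field_simps)
    have "\<bar>a + b\<bar> powr p \<le> ((1 + 1 / \<delta>) * \<bar>b\<bar>) powr p"
      using a p by (intro powr_mono2) (auto simp: algebra_simps)
    moreover have "\<bar>a\<bar> powr p \<le> ((1 + 1 / \<delta>) * \<bar>b\<bar>) powr p"
      using a p by (intro powr_mono2) (auto simp: algebra_simps)
    moreover have "((1 + 1 / \<delta>) * \<bar>b\<bar>) powr p = C * \<bar>b\<bar> powr p"
      using \<delta> by (simp add: C_def powr_mult)
    moreover have "0 \<le> \<bar>a + b\<bar> powr p" "0 \<le> \<bar>a\<bar> powr p" "0 \<le> \<epsilon> * \<bar>a\<bar> powr p"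
      using \<epsilon> by auto
    ultimately show ?thesis by linarith
  qed
  moreover have "0 \<le> C" by (simp add: C_def)
  ultimately show ?thesis by blast
qed

lemma integral_fatou:
  fixes h :: "nat \<Rightarrow> 'a \<Rightarrow> real"
  assumes [measurable]: "\<And>k. integrable M (h k)" "h' \<in> borel_measurable M"
    and nonneg: "\<And>k x. 0 \<le> h k x" 
    and bound: "\<And>k. (\<integral>x. h k x \<partial>M) \<le> B"
    and conv: "AE x in M. (\<lambda>k. h k x) \<longlonglongrightarrow> h' x"
  shows "integrable M h'" "(\<integral>x. h' x \<partial>M) \<le> B"
proof -
  have ae: "AE x in M. 0 \<le> h' x"
    using conv by eventually_elim (rule LIMSEQ_le_const, auto simp: nonneg)
  have B: "0 \<le> B"
    by (rule order_trans[OF integral_nonneg_AE bound[of 0]]) (simp add: nonneg)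
  have "(\<integral>\<^sup>+x. ennreal (h' x) \<partial>M) = (\<integral>\<^sup>+x. liminf (\<lambda>k. ennreal (h k x)) \<partial>M)"
  proof (rule nn_integral_cong_AE)
    show "AE x in M. ennreal (h' x) = liminf (\<lambda>k. ennreal (h k x))"
      using conv
    proof eventually_elim
      case (elim x)
      then have "(\<lambda>k. ennreal (h k x)) \<longlonglongrightarrow> ennreal (h' x)" by (intro tendsto_ennrealI)
      then show ?case by (simp add: lim_imp_Liminf)
    qed
  qed
  also have "\<dots> \<le> liminf (\<lambda>k. \<integral>\<^sup>+x. ennreal (h k x) \<partial>M)"
    by (rule nn_integral_liminf) simp
  also have "\<dots> \<le> liminf (\<lambda>k::nat. ennreal B)"
  proof (rule Liminf_mono, rule always_eventually, rule allI)
    fix k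
    have "(\<integral>\<^sup>+x. ennreal (h k x) \<partial>M) = ennreal (\<integral>x. h k x \<partial>M)"
      using assms(1) nonneg by (intro nn_integral_eq_integral) auto
    then show "(\<integral>\<^sup>+x. ennreal (h k x) \<partial>M) \<le> ennreal B" using bound by (simp add: ennreal_leI)
  qed
  also have "\<dots> = ennreal B" by (simp add: Liminf_const)
  finally have *: "(\<integral>\<^sup>+x. ennreal (h' x) \<partial>M) \<le> ennreal B" .
  show int: "integrable M h'"
  proof (rule integrableI_nonneg)
    show "(\<integral>\<^sup>+x. ennreal (h' x) \<partial>M) < \<infinity>" using * by (simp add: order_le_less_trans)
  qed (use ae in auto)
  have "ennreal (\<integral>x. h' x \<partial>M) \<le> ennreal B"
    using * nn_integral_eq_integral[OF int ae] by simp
  then show "(\<integral>x. h' x \<partial>M) \<le> B" using B by (simp add: ennreal_le_iff)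
qed

text \<open>Dominated convergence up to an error that is small in the mean. The part of \<open>R k\<close> above \<open>\<epsilon> * S k\<close> is
dominated by a fixed integrable function, and the part below has integral at most \<open>\<epsilon> * B\<close>. Both the
Brezis-Lieb lemma and the continuity of subcritical functionals are instances.\<close>

lemma tendsto_integral_zero_split:
  fixes R S :: "nat \<Rightarrow> 'a \<Rightarrow> real"
  assumes R: "\<And>k. integrable M (R k)" "\<And>k x. 0 \<le> R k x" "AE x in M. (\<lambda>k. R k x) \<longlonglongrightarrow> 0"
    and S: "\<And>k. integrable M (S k)" "\<And>k x. 0 \<le> S k x" "\<And>k. (\<integral>x. S k x \<partial>M) \<le> B"
    and dom: "\<And>\<epsilon>. 0 < \<epsilon> \<Longrightarrow> \<exists>D. integrable M D \<and> (\<forall>k x. R k x \<le> \<epsilon> * S k x + D x)"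
  shows "(\<lambda>k. \<integral>x. R k x \<partial>M) \<longlonglongrightarrow> 0"
proof (rule LIMSEQ_I)
  fix e :: real assume e: "0 < e"
  have B: "0 \<le> B"
    by (rule order_trans[OF integral_nonneg_AE S(3)[of 0]]) (simp add: S(2))
  define \<epsilon> where "\<epsilon> = e / (2 * (B + 1))"
  have \<epsilon>: "0 < \<epsilon>" using e B by (simp add: \<epsilon>_def)
  have "\<epsilon> * B \<le> \<epsilon> * (B + 1)" using \<epsilon> by simp
  also have "\<dots> = e / 2" using B by (simp add: \<epsilon>_def field_simps)
  finally have \<epsilon>B: "\<epsilon> * B \<le> e / 2" .
  obtain D where D: "integrable M D" "\<And>k x. R k x \<le> \<epsilon> * S k x + D x" using dom[OF \<epsilon>] by blast
  have [measurable]: "R k \<in> borel_measurable M" "S k \<in> borel_measurable M"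
    "D \<in> borel_measurable M" for k using R S D by auto
  \<comment> \<open>the excess over the error term: it tends to \<open>0\<close> and is dominated by \<open>D\<close>\<close>
  define H where "H k x = max 0 (R k x - \<epsilon> * S k x)" for k x
  have Hint: "integrable M (H k)" for k
    unfolding H_def[abs_def] using R S by auto
  have "(\<lambda>k. \<integral>x. H k x \<partial>M) \<longlonglongrightarrow> (\<integral>x. 0 \<partial>M)"
  proof (rule integral_dominated_convergence[where w="\<lambda>x. \<bar>D x\<bar>"])
    show "AE x in M. (\<lambda>k. H k x) \<longlonglongrightarrow> 0" using R(3)
    proof eventually_elim
      case (elim x)
      show ?case
      proof (rule tendsto_sandwich[OF _ _ tendsto_const elim])
        show "\<forall>\<^sub>F k in sequentially. 0 \<le> H k x" by (simp add: H_def)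
        show "\<forall>\<^sub>F k in sequentially. H k x \<le> R k x"
          using R(2) S(2) \<epsilon> by (simp add: H_def)
      qed
    qed
    show "AE x in M. norm (H k x) \<le> \<bar>D x\<bar>" for k
    proof (rule AE_I2)
      fix x show "norm (H k x) \<le> \<bar>D x\<bar>" using D(2)[of k x] by (auto simp: H_def)
    qed
  qed (use D in \<open>auto simp: H_def\<close>)
  then have "(\<lambda>k. \<integral>x. H k x \<partial>M) \<longlonglongrightarrow> 0" by simp
  from LIMSEQ_D[OF this, of "e/2"] e obtain K where K: "\<And>k. k \<ge> K \<Longrightarrow> \<bar>\<integral>x. H k x \<partial>M\<bar> < e / 2"
    by auto
  show "\<exists>K. \<forall>k\<ge>K. norm ((\<integral>x. R k x \<partial>M) - 0) < e"
  proof (intro exI allI impI)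
    fix k assume k: "k \<ge> K"
    have "(\<integral>x. R k x \<partial>M) \<le> (\<integral>x. H k x + \<epsilon> * S k x \<partial>M)"
      using R S Hint by (intro integral_mono) (auto simp: H_def)
    also have "\<dots> = (\<integral>x. H k x \<partial>M) + \<epsilon> * (\<integral>x. S k x \<partial>M)" using Hint S by simp
    also have "\<dots> \<le> (\<integral>x. H k x \<partial>M) + \<epsilon> * B" using S(3) \<epsilon> by simp
    also have "\<dots> < e" using K[OF k] \<epsilon>B by linarith
    finally have "(\<integral>x. R k x \<partial>M) < e" .
    moreover have "0 \<le> (\<integral>x. R k x \<partial>M)" using R by (intro integral_nonneg_AE) auto
    ultimately show "norm ((\<integral>x. R k x \<partial>M) - 0) < e" by simp
  qed
qed

lemma integrable_powr_add:
  fixes f g :: "'a \<Rightarrow> real"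
  assumes [measurable]: "f \<in> borel_measurable M" "g \<in> borel_measurable M" and p: "0 \<le> p"
    and "integrable M (\<lambda>x. \<bar>f x\<bar> powr p)" "integrable M (\<lambda>x. \<bar>g x\<bar> powr p)"
  shows "integrable M (\<lambda>x. \<bar>f x + g x\<bar> powr p)"
proof (rule Bochner_Integration.integrable_bound)
  show "integrable M (\<lambda>x. 2 powr p * (\<bar>f x\<bar> powr p + \<bar>g x\<bar> powr p))" using assms by simp
  show "AE x in M. norm (\<bar>f x + g x\<bar> powr p) \<le> norm (2 powr p * (\<bar>f x\<bar> powr p + \<bar>g x\<bar> powr p))"
    using powr_abs_add_le[OF p] by auto
qed simp

text \<open>The Brezis-Lieb lemma: almost everywhere convergence of a sequence bounded in \<open>L^p\<close> does not give
convergence of the integrals of the \<open>p\<close>-th powers, but the defect is exactly that of the difference \<open>w k = f k - g\<close>. By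
\<open>powr_perturbation\<close> the error term is at most \<open>\<epsilon> |w k|^p\<close> plus a fixed multiple of \<open>|g|^p\<close>.\<close>

lemma brezis_lieb:
  fixes f :: "nat \<Rightarrow> 'a \<Rightarrow> real"
  assumes p: "1 \<le> p"
    and [measurable]: "\<And>k. f k \<in> borel_measurable M" "g \<in> borel_measurable M"
    and f: "\<And>k. integrable M (\<lambda>x. \<bar>f k x\<bar> powr p)" "\<And>k. (\<integral>x. \<bar>f k x\<bar> powr p \<partial>M) \<le> B"
    and conv: "AE x in M. (\<lambda>k. f k x) \<longlonglongrightarrow> g x"
  shows "integrable M (\<lambda>x. \<bar>g x\<bar> powr p)" "(\<integral>x. \<bar>g x\<bar> powr p \<partial>M) \<le> B"
    "(\<lambda>k. (\<integral>x. \<bar>f k x\<bar> powr p \<partial>M) - (\<integral>x. \<bar>f k x - g x\<bar> powr p \<partial>M))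
       \<longlonglongrightarrow> (\<integral>x. \<bar>g x\<bar> powr p \<partial>M)"
proof -
  have conv_p: "AE x in M. (\<lambda>k. \<bar>f k x\<bar> powr p) \<longlonglongrightarrow> \<bar>g x\<bar> powr p"
    using conv by eventually_elim (intro tendsto_powr' tendsto_intros, use p in auto)
  show g: "integrable M (\<lambda>x. \<bar>g x\<bar> powr p)" and gB: "(\<integral>x. \<bar>g x\<bar> powr p \<partial>M) \<le> B"
    by (rule integral_fatou[OF f(1) _ _ f(2) conv_p]; simp)+
  define w where "w k x = f k x - g x" for k x
  have [measurable]: "w k \<in> borel_measurable M" for k unfolding w_def[abs_def] by measurable
  have w_bound: "\<bar>w k x\<bar> powr p \<le> 2 powr p * (\<bar>f k x\<bar> powr p + \<bar>g x\<bar> powr p)" for k x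
    using powr_abs_add_le[of p "f k x" "- g x"] p by (simp add: w_def)
  have w: "integrable M (\<lambda>x. \<bar>w k x\<bar> powr p)" for k
    using integrable_powr_add[of "f k" M "\<lambda>x. - g x" p] f(1) g p by (simp add: w_def)
  have wB: "(\<integral>x. \<bar>w k x\<bar> powr p \<partial>M) \<le> 2 powr p * (B + B)" for k
  proof -
    have "(\<integral>x. \<bar>w k x\<bar> powr p \<partial>M) \<le> (\<integral>x. 2 powr p * (\<bar>f k x\<bar> powr p + \<bar>g x\<bar> powr p) \<partial>M)"
      using w f(1) g w_bound by (intro integral_mono) auto
    also have "\<dots> = 2 powr p * ((\<integral>x. \<bar>f k x\<bar> powr p \<partial>M) + (\<integral>x. \<bar>g x\<bar> powr p \<partial>M))"
      using f(1) g by simp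
    also have "\<dots> \<le> 2 powr p * (B + B)" using f(2) gB by (intro mult_left_mono add_mono) auto
    finally show ?thesis .
  qed
  define R where "R k x = \<bar>\<bar>f k x\<bar> powr p - \<bar>w k x\<bar> powr p - \<bar>g x\<bar> powr p\<bar>" for k x
  have R_int: "integrable M (R k)" for k unfolding R_def[abs_def] using f(1) w g by auto
  have "(\<lambda>k. \<integral>x. R k x \<partial>M) \<longlonglongrightarrow> 0"
  proof (rule tendsto_integral_zero_split[OF R_int _ _ w _ wB])
    show "AE x in M. (\<lambda>k. R k x) \<longlonglongrightarrow> 0" using conv
    proof eventually_elim
      case (elim x)
      have "(\<lambda>k. \<bar>\<bar>f k x\<bar> powr p - \<bar>w k x\<bar> powr p - \<bar>g x\<bar> powr p\<bar>) \<longlonglongrightarrow>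
          \<bar>\<bar>g x\<bar> powr p - \<bar>g x - g x\<bar> powr p - \<bar>g x\<bar> powr p\<bar>"
        unfolding w_def by (intro tendsto_intros tendsto_powr' elim) (use p in auto)
      then show ?case using p by (simp add: R_def)
    qed
    fix \<epsilon> :: real assume "0 < \<epsilon>"
    from powr_perturbation[OF p this] obtain C where C: "C \<ge> 0"
      "\<And>a b. \<bar>\<bar>a + b\<bar> powr p - \<bar>a\<bar> powr p\<bar> \<le> \<epsilon> * \<bar>a\<bar> powr p + C * \<bar>b\<bar> powr p" by blast
    show "\<exists>D. integrable M D \<and> (\<forall>k x. R k x \<le> \<epsilon> * \<bar>w k x\<bar> powr p + D x)"
    proof (intro exI conjI allI)
      show "integrable M (\<lambda>x. (C + 1) * \<bar>g x\<bar> powr p)" using g by simp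
      show "R k x \<le> \<epsilon> * \<bar>w k x\<bar> powr p + (C + 1) * \<bar>g x\<bar> powr p" for k x
      proof -
        have "\<bar>\<bar>f k x\<bar> powr p - \<bar>w k x\<bar> powr p\<bar> \<le> \<epsilon> * \<bar>w k x\<bar> powr p + C * \<bar>g x\<bar> powr p"
          using C(2)[of "w k x" "g x"] by (simp add: w_def)
        moreover have "0 \<le> \<bar>g x\<bar> powr p" by simp
        ultimately show ?thesis unfolding R_def distrib_right by linarith
      qed
    qed
  qed (auto simp: R_def)
  moreover have "\<bar>((\<integral>x. \<bar>f k x\<bar> powr p \<partial>M) - (\<integral>x. \<bar>w k x\<bar> powr p \<partial>M)) - (\<integral>x. \<bar>g x\<bar> powr p \<partial>M)\<bar>
      \<le> (\<integral>x. R k x \<partial>M)" for k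
  proof -
    have "((\<integral>x. \<bar>f k x\<bar> powr p \<partial>M) - (\<integral>x. \<bar>w k x\<bar> powr p \<partial>M)) - (\<integral>x. \<bar>g x\<bar> powr p \<partial>M)
      = (\<integral>x. \<bar>f k x\<bar> powr p - \<bar>w k x\<bar> powr p - \<bar>g x\<bar> powr p \<partial>M)"
      using f(1) w g by simp
    then show ?thesis unfolding R_def by (simp only: integral_abs_bound)
  qed
  ultimately show "(\<lambda>k. (\<integral>x. \<bar>f k x\<bar> powr p \<partial>M) - (\<integral>x. \<bar>f k x - g x\<bar> powr p \<partial>M))
       \<longlonglongrightarrow> (\<integral>x. \<bar>g x\<bar> powr p \<partial>M)"
    unfolding w_def[symmetric]
    by (subst LIM_zero_iff[symmetric]) (rule Lim_null_comparison[OF always_eventually], auto)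
qed

text \<open>A nonlinearity of growth strictly below \<open>|t|^p\<close> is continuous along almost everywhere convergent
sequences that are bounded in \<open>L^p\<close>: large values of the functions contribute only a small multiple
of the bounded \<open>p\<close>-th powers, which is what the hypothesis \<open>small\<close> expresses.\<close>

lemma tendsto_integral_subcritical:
  fixes G :: "real \<Rightarrow> real"
  assumes M: "finite_measure M" and p: "1 \<le> p"
    and G: "continuous_on UNIV G"
    and small: "\<And>\<epsilon>. 0 < \<epsilon> \<Longrightarrow> \<exists>C. \<forall>t. \<bar>G t\<bar> \<le> \<epsilon> * \<bar>t\<bar> powr p + C"
    and [measurable]: "\<And>k. f k \<in> borel_measurable M" "g \<in> borel_measurable M"
    and f: "\<And>k. integrable M (\<lambda>x. \<bar>f k x\<bar> powr p)" "\<And>k. (\<integral>x. \<bar>f k x\<bar> powr p \<partial>M) \<le> B"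
    and conv: "AE x in M. (\<lambda>k. f k x) \<longlonglongrightarrow> g x"
  shows "(\<lambda>k. \<integral>x. G (f k x) \<partial>M) \<longlonglongrightarrow> (\<integral>x. G (g x) \<partial>M)"
proof -
  interpret finite_measure M by (rule M)
  have [measurable]: "G \<in> borel_measurable borel" using G by (rule borel_measurable_continuous_onI)
  have g: "integrable M (\<lambda>x. \<bar>g x\<bar> powr p)" by (rule brezis_lieb(1)[OF p _ _ f conv]) auto
  have G_int: "integrable M (\<lambda>x. G (h x))"
    if [measurable]: "h \<in> borel_measurable M" and h: "integrable M (\<lambda>x. \<bar>h x\<bar> powr p)" for h
  proof -
    obtain C where C: "\<And>t. \<bar>G t\<bar> \<le> 1 * \<bar>t\<bar> powr p + C" using small[of 1] by auto
    show ?thesis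
    proof (rule Bochner_Integration.integrable_bound)
      show "integrable M (\<lambda>x. 1 * \<bar>h x\<bar> powr p + C)" using h by simp
      show "AE x in M. norm (G (h x)) \<le> norm (1 * \<bar>h x\<bar> powr p + C)"
      proof (rule AE_I2)
        fix x show "norm (G (h x)) \<le> norm (1 * \<bar>h x\<bar> powr p + C)" using C[of "h x"] by auto
      qed
    qed simp
  qed
  have Gf: "integrable M (\<lambda>x. G (f k x))" for k using f by (intro G_int) auto
  have Gg: "integrable M (\<lambda>x. G (g x))" using g by (intro G_int) auto
  define R where "R k x = \<bar>G (f k x) - G (g x)\<bar>" for k x
  have R_int: "integrable M (R k)" for k unfolding R_def[abs_def] using Gf Gg by auto
  have "(\<lambda>k. \<integral>x. R k x \<partial>M) \<longlonglongrightarrow> 0"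
  proof (rule tendsto_integral_zero_split[OF R_int _ _ f(1) _ f(2)])
    show "AE x in M. (\<lambda>k. R k x) \<longlonglongrightarrow> 0" using conv
    proof eventually_elim
      case (elim x)
      have "isCont G (g x)" using G by (simp add: continuous_on_eq_continuous_at)
      then have "(\<lambda>k. G (f k x)) \<longlonglongrightarrow> G (g x)" by (rule isCont_tendsto_compose) (rule elim)
      then have "(\<lambda>k. \<bar>G (f k x) - G (g x)\<bar>) \<longlonglongrightarrow> \<bar>G (g x) - G (g x)\<bar>" by (intro tendsto_intros)
      then show ?case by (simp add: R_def)
    qed
    fix \<epsilon> :: real assume "0 < \<epsilon>"
    from small[OF this] obtain C where C: "\<And>t. \<bar>G t\<bar> \<le> \<epsilon> * \<bar>t\<bar> powr p + C" by blast
    show "\<exists>D. integrable M D \<and> (\<forall>k x. R k x \<le> \<epsilon> * \<bar>f k x\<bar> powr p + D x)"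
    proof (intro exI conjI allI)
      show "integrable M (\<lambda>x. C + \<bar>G (g x)\<bar>)" using Gg by simp
      show "R k x \<le> \<epsilon> * \<bar>f k x\<bar> powr p + (C + \<bar>G (g x)\<bar>)" for k x
        using C[of "f k x"] unfolding R_def by linarith
    qed
  qed (auto simp: R_def)
  moreover have "\<bar>(\<integral>x. G (f k x) \<partial>M) - (\<integral>x. G (g x) \<partial>M)\<bar> \<le> (\<integral>x. R k x \<partial>M)" for k
  proof -
    have "(\<integral>x. G (f k x) \<partial>M) - (\<integral>x. G (g x) \<partial>M) = (\<integral>x. G (f k x) - G (g x) \<partial>M)"
      using Gf Gg by simp
    then show ?thesis unfolding R_def by (simp only: integral_abs_bound)
  qed
  ultimately show ?thesis
    by (subst LIM_zero_iff[symmetric]) (rule Lim_null_comparison[OF always_eventually], auto)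
qed

lemma integrable_abs_of_powr:
  fixes v :: "'a \<Rightarrow> real"
  assumes M: "finite_measure M" and p: "1 \<le> p"
    and [measurable]: "v \<in> borel_measurable M"
    and v: "integrable M (\<lambda>x. \<bar>v x\<bar> powr p)"
  shows "integrable M (\<lambda>x. \<bar>v x\<bar>)"
proof -
  interpret finite_measure M by (rule M)
  show ?thesis
  proof (rule Bochner_Integration.integrable_bound)
    show "integrable M (\<lambda>x. 1 + \<bar>v x\<bar> powr p)" using v by simp
    show "AE x in M. norm \<bar>v x\<bar> \<le> norm (1 + \<bar>v x\<bar> powr p)"
    proof (rule AE_I2)
      fix x show "norm \<bar>v x\<bar> \<le> norm (1 + \<bar>v x\<bar> powr p)"
        using le_one_plus_powr[of "\<bar>v x\<bar>" 1 p] p by simp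
    qed
  qed simp
qed

lemma primitive_increment_le:
  fixes F f :: "real \<Rightarrow> real"
  assumes p: "1 \<le> p" and K: "0 \<le> K"
    and F: "\<And>t. (F has_real_derivative f t) (at t)"
    and f: "\<And>t. \<bar>f t\<bar> \<le> K * (1 + \<bar>t\<bar> powr (p - 1))"
  shows "\<bar>F (a + h) - F a\<bar> \<le> K * (\<bar>h\<bar> + (\<bar>a\<bar> + \<bar>h\<bar>) powr (p - 1) * \<bar>h\<bar>)"
proof -
  define L where "L = \<bar>a\<bar> + \<bar>h\<bar>"
  have "norm (F (a + h) - F a) \<le> (K * (1 + L powr (p - 1))) * norm (a + h - a)"
  proof (rule field_differentiable_bound[of "{- L..L}" F f])
    show "norm (f z) \<le> K * (1 + L powr (p - 1))" if "z \<in> {- L..L}" for z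
    proof -
      have "\<bar>z\<bar> powr (p - 1) \<le> L powr (p - 1)" using that p by (intro powr_mono2) auto
      then have "K * (1 + \<bar>z\<bar> powr (p - 1)) \<le> K * (1 + L powr (p - 1))"
        using K by (intro mult_left_mono) auto
      then show ?thesis using f[of z] by simp
    qed
    show "(F has_field_derivative f z) (at z within {- L..L})" for z
      using F by (rule has_field_derivative_at_within)
  qed (auto simp: L_def)
  then show ?thesis by (simp add: L_def algebra_simps)
qed

lemma powr_minus_one_mult_le:
  fixes a b p :: real
  assumes "0 \<le> a" "a \<le> c" "0 \<le> b" "b \<le> c" "1 \<le> p"
  shows "a powr (p - 1) * b \<le> c powr p"
proof -
  have "a powr (p - 1) * b \<le> c powr (p - 1) * c"
    using assms by (intro mult_mono powr_mono2) auto
  also have "\<dots> = c powr p" using assms by (cases "c = 0") (auto simp: powr_diff)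
  finally show ?thesis .
qed

text \<open>The functional \<open>u \<mapsto> \<integral> F(u)\<close> has the directional derivative \<open>\<integral> f(u) v\<close> if \<open>f = F'\<close> grows at most like
\<open>|t|^(p - 1)\<close>. By the mean value theorem all difference quotients are dominated by a multiple of
\<open>|v| + (|u| + |v|)^p\<close>. The sequence of step sizes \<open>1 / (n + 1)\<close> suffices for a first-order condition.\<close>

lemma
  fixes F f :: "real \<Rightarrow> real" and u v :: "'a \<Rightarrow> real"
  assumes M: "finite_measure M" and p: "1 \<le> p" and K: "0 \<le> K"
    and F: "\<And>t. (F has_real_derivative f t) (at t)" "F 0 = 0"
    and cont: "continuous_on UNIV f"
    and f: "\<And>t. \<bar>f t\<bar> \<le> K * (1 + \<bar>t\<bar> powr (p - 1))"
    and [measurable]: "u \<in> borel_measurable M" "v \<in> borel_measurable M"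
    and u: "integrable M (\<lambda>x. \<bar>u x\<bar> powr p)" and v: "integrable M (\<lambda>x. \<bar>v x\<bar> powr p)"
  shows integrable_primitive: "integrable M (\<lambda>x. F (u x))"
    and integrable_growth_mult: "integrable M (\<lambda>x. f (u x) * v x)"
    and tendsto_difference_quotient:
      "(\<lambda>n. ((\<integral>x. F (u x + v x / Suc n) \<partial>M) - (\<integral>x. F (u x) \<partial>M)) * Suc n)
         \<longlonglongrightarrow> (\<integral>x. f (u x) * v x \<partial>M)"
proof -
  interpret finite_measure M by (rule M)
  have [measurable]: "f \<in> borel_measurable borel"
    using cont by (rule borel_measurable_continuous_onI)
  have "continuous_on UNIV F" using F(1) by (meson DERIV_continuous_on has_field_derivative_at_within)
  then have [measurable]: "F \<in> borel_measurable borel" by (rule borel_measurable_continuous_onI)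
  note incr = primitive_increment_le[OF p K F(1) f]
  have F_int: "integrable M (\<lambda>x. F (w x))"
    if [measurable]: "w \<in> borel_measurable M" and w: "integrable M (\<lambda>x. \<bar>w x\<bar> powr p)" for w
  proof (rule Bochner_Integration.integrable_bound)
    show "integrable M (\<lambda>x. K * (\<bar>w x\<bar> + \<bar>w x\<bar> powr p))"
      using w integrable_abs_of_powr[OF M p _ w] by simp
    show "AE x in M. norm (F (w x)) \<le> norm (K * (\<bar>w x\<bar> + \<bar>w x\<bar> powr p))"
    proof (rule AE_I2)
      fix x
      have "\<bar>F (w x)\<bar> \<le> K * (\<bar>w x\<bar> + \<bar>w x\<bar> powr (p - 1) * \<bar>w x\<bar>)"
        using incr[of 0 "w x"] F(2) by simp
      also have "\<bar>w x\<bar> powr (p - 1) * \<bar>w x\<bar> = \<bar>w x\<bar> powr p"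
        by (cases "w x = 0") (auto simp: powr_diff)
      finally show "norm (F (w x)) \<le> norm (K * (\<bar>w x\<bar> + \<bar>w x\<bar> powr p))" using K by simp
    qed
  qed simp
  show Fu: "integrable M (\<lambda>x. F (u x))" using u by (intro F_int) auto
  define D where "D x = K * (\<bar>v x\<bar> + (\<bar>u x\<bar> + \<bar>v x\<bar>) powr p)" for x
  have D: "integrable M D"
  proof -
    \<comment> \<open>the outer absolute value only matches the form of \<open>integrable_powr_add\<close>\<close>
    have "integrable M (\<lambda>x. \<bar>\<bar>u x\<bar> + \<bar>v x\<bar>\<bar> powr p)"
      using p u v by (intro integrable_powr_add) auto
    then show ?thesis unfolding D_def[abs_def] using integrable_abs_of_powr[OF M p _ v] by simp
  qed
  show "integrable M (\<lambda>x. f (u x) * v x)"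
  proof (rule Bochner_Integration.integrable_bound[OF D])
    show "AE x in M. norm (f (u x) * v x) \<le> norm (D x)"
    proof (rule AE_I2)
      fix x
      have "\<bar>f (u x) * v x\<bar> \<le> K * (1 + \<bar>u x\<bar> powr (p - 1)) * \<bar>v x\<bar>"
        unfolding abs_mult by (intro mult_right_mono f) auto
      also have "\<dots> = K * (\<bar>v x\<bar> + \<bar>u x\<bar> powr (p - 1) * \<bar>v x\<bar>)" by (simp add: algebra_simps)
      also have "\<dots> \<le> D x" unfolding D_def
        using K p by (intro mult_left_mono add_left_mono powr_minus_one_mult_le) auto
      finally show "norm (f (u x) * v x) \<le> norm (D x)" by simp
    qed
  qed simp
  have Fuv: "integrable M (\<lambda>x. F (u x + v x / Suc n))" for n
  proof (rule F_int)
    have "integrable M (\<lambda>x. \<bar>v x / Suc n\<bar> powr p)"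
      using v by (simp add: powr_divide)
    then show "integrable M (\<lambda>x. \<bar>u x + v x / Suc n\<bar> powr p)"
      using u p by (intro integrable_powr_add) auto
  qed simp
  have "(\<lambda>n. \<integral>x. (F (u x + v x / Suc n) - F (u x)) * Suc n \<partial>M) \<longlonglongrightarrow> (\<integral>x. f (u x) * v x \<partial>M)"
  proof (rule integral_dominated_convergence[OF _ _ D])
    show "AE x in M. (\<lambda>n. (F (u x + v x / Suc n) - F (u x)) * Suc n) \<longlonglongrightarrow> f (u x) * v x"
    proof (rule AE_I2)
      fix x
      have "((\<lambda>r. F (u x + r * v x)) has_real_derivative f (u x) * v x) (at 0)"
        by (rule DERIV_chain'[of "\<lambda>r. u x + r * v x" "v x" 0 UNIV F])
           (auto intro!: derivative_eq_intros F(1))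
      then have "(\<lambda>r. (F (u x + r * v x) - F (u x)) / r) \<midarrow>0\<rightarrow> f (u x) * v x"
        by (simp add: DERIV_def)
      moreover have "filterlim (\<lambda>n. inverse (real (Suc n))) (at 0) sequentially"
        unfolding filterlim_at using LIMSEQ_inverse_real_of_nat by auto
      ultimately have "(\<lambda>n. (F (u x + inverse (real (Suc n)) * v x) - F (u x)) / inverse (real (Suc n)))
          \<longlonglongrightarrow> f (u x) * v x"
        by (rule filterlim_compose)
      then show "(\<lambda>n. (F (u x + v x / Suc n) - F (u x)) * Suc n) \<longlonglongrightarrow> f (u x) * v x"
        by (simp add: field_simps)
    qed
    show "AE x in M. norm ((F (u x + v x / Suc n) - F (u x)) * Suc n) \<le> D x" for n
    proof (rule AE_I2)
      fix x
      define h where "h = v x / Suc n"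
      have h: "\<bar>h\<bar> * Suc n = \<bar>v x\<bar>" "\<bar>h\<bar> \<le> \<bar>v x\<bar>"
        by (simp_all add: h_def divide_le_eq mult_le_cancel_left1 abs_divide)
      have "\<bar>(F (u x + h) - F (u x)) * Suc n\<bar> = \<bar>F (u x + h) - F (u x)\<bar> * Suc n"
        by (simp add: abs_mult)
      also have "\<dots> \<le> K * (\<bar>h\<bar> + (\<bar>u x\<bar> + \<bar>h\<bar>) powr (p - 1) * \<bar>h\<bar>) * Suc n"
        by (intro mult_right_mono incr) auto
      also have "\<dots> = K * (\<bar>h\<bar> * Suc n + (\<bar>u x\<bar> + \<bar>h\<bar>) powr (p - 1) * (\<bar>h\<bar> * Suc n))"
        by (simp only: algebra_simps)
      also have "\<dots> = K * (\<bar>v x\<bar> + (\<bar>u x\<bar> + \<bar>h\<bar>) powr (p - 1) * \<bar>v x\<bar>)" by (simp only: h)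
      also have "\<dots> \<le> D x" unfolding D_def
        using K p h by (intro mult_left_mono add_left_mono powr_minus_one_mult_le) auto
      finally show "norm ((F (u x + v x / Suc n) - F (u x)) * Suc n) \<le> D x" by (simp add: h_def)
    qed
  qed auto
  then show "(\<lambda>n. ((\<integral>x. F (u x + v x / Suc n) \<partial>M) - (\<integral>x. F (u x) \<partial>M)) * Suc n)
         \<longlonglongrightarrow> (\<integral>x. f (u x) * v x \<partial>M)"
    using Fuv Fu by simp
qed

section \<open>The Gagliardo form as an integral of squares\<close>

definition diff_quot :: "real \<Rightarrow> (real ^ 'n \<Rightarrow> real) \<Rightarrow> (real ^ 'n) \<times> (real ^ 'n) \<Rightarrow> real" where
  "diff_quot s u = (\<lambda>(x, y). (u x - u y) / norm (x - y) powr ((real CARD('n) + 2 * s) / 2))"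

text \<open>The kernel is split evenly between the two factors, so that the Gagliardo form becomes the \<open>L\<^sup>2\<close> inner
product of difference quotients on the product space, and \<open>u \<mapsto> diff_quot s u\<close> is linear.\<close>

lemma gagliardo_integrand_eq: "gagliardo_integrand s u v z = diff_quot s u z * diff_quot s v z"
  by (simp add: gagliardo_integrand_def diff_quot_def case_prod_beta powr_add[symmetric])

lemma gagliardo_form_eq:
  "gagliardo_form s u v = (\<integral>z. diff_quot s u z * diff_quot s v z \<partial>(lborel \<Otimes>\<^sub>M lborel))"
  unfolding gagliardo_form_def by (simp add: gagliardo_integrand_eq[abs_def])

lemma gagliardo_form_same:
  "gagliardo_form s u u = (\<integral>z. (diff_quot s u z)\<^sup>2 \<partial>(lborel \<Otimes>\<^sub>M lborel))"
  by (simp add: gagliardo_form_eq power2_eq_square)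

lemma gagliardo_form_nonneg: "0 \<le> gagliardo_form s u u"
  by (simp add: gagliardo_form_same)

lemma measurable_diff_quot [measurable]:
  fixes u :: "real ^ 'n \<Rightarrow> real"
  assumes [measurable]: "u \<in> borel_measurable lborel"
  shows "diff_quot s u \<in> borel_measurable (lborel \<Otimes>\<^sub>M lborel)"
  unfolding diff_quot_def by measurable

lemma diff_quot_linear:
  "diff_quot s (\<lambda>x. u x + t * v x) z = diff_quot s u z + t * diff_quot s v z"
  by (simp add: diff_quot_def case_prod_beta add_divide_distrib[symmetric] diff_divide_distrib algebra_simps)

lemma frac_sobolev_iff:
  "u \<in> frac_sobolev s \<longleftrightarrow> u \<in> borel_measurable lborel \<and> integrable lborel (\<lambda>x. (u x)\<^sup>2) \<and>
     integrable (lborel \<Otimes>\<^sub>M lborel) (\<lambda>z. (diff_quot s u z)\<^sup>2)"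
  by (simp add: frac_sobolev_def gagliardo_integrand_eq[abs_def] power2_eq_square)

lemma integrable_mult_of_squares:
  fixes f g :: "'a \<Rightarrow> real"
  assumes [measurable]: "f \<in> borel_measurable M" "g \<in> borel_measurable M"
    and "integrable M (\<lambda>x. (f x)\<^sup>2)" "integrable M (\<lambda>x. (g x)\<^sup>2)"
  shows "integrable M (\<lambda>x. f x * g x)"
proof (rule Bochner_Integration.integrable_bound)
  show "integrable M (\<lambda>x. (f x)\<^sup>2 + (g x)\<^sup>2)" using assms by simp
  show "AE x in M. norm (f x * g x) \<le> norm ((f x)\<^sup>2 + (g x)\<^sup>2)"
  proof (rule AE_I2)
    fix x
    have "2 * (\<bar>f x\<bar> * \<bar>g x\<bar>) \<le> (f x)\<^sup>2 + (g x)\<^sup>2"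
      using sum_squares_bound[of "\<bar>f x\<bar>" "\<bar>g x\<bar>"] by simp
    moreover have "0 \<le> \<bar>f x\<bar> * \<bar>g x\<bar>" by simp
    ultimately show "norm (f x * g x) \<le> norm ((f x)\<^sup>2 + (g x)\<^sup>2)"
      unfolding real_norm_def abs_mult by linarith
  qed
qed simp

lemma integrable_square_linear:
  fixes f g :: "'a \<Rightarrow> real"
  assumes "f \<in> borel_measurable M" "g \<in> borel_measurable M"
    and "integrable M (\<lambda>x. (f x)\<^sup>2)" "integrable M (\<lambda>x. (g x)\<^sup>2)"
  shows "integrable M (\<lambda>x. (f x + t * g x)\<^sup>2)"
proof -
  have eq: "(\<lambda>x. (f x + t * g x)\<^sup>2) = (\<lambda>x. (f x)\<^sup>2 + (2 * t * (f x * g x) + t\<^sup>2 * (g x)\<^sup>2))"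
    by (simp add: fun_eq_iff power2_eq_square algebra_simps)
  show ?thesis unfolding eq using assms integrable_mult_of_squares[OF assms] by simp
qed

text \<open>Combinations of the form \<open>u + t v\<close> are the only vector space operation used below; differences
appear as \<open>t = - 1\<close> and multiples as \<open>u = v\<close>.\<close>

lemma X0_linear:
  assumes "u \<in> X0 \<Omega> s" "v \<in> X0 \<Omega> s"
  shows "(\<lambda>x. u x + t * v x) \<in> X0 \<Omega> s"
proof -
  have [measurable]: "u \<in> borel_measurable lborel" "v \<in> borel_measurable lborel"
    using assms by (auto simp: X0_def frac_sobolev_iff)
  have "integrable lborel (\<lambda>x. (u x + t * v x)\<^sup>2)"
    using assms by (intro integrable_square_linear) (auto simp: X0_def frac_sobolev_iff)
  moreover have "integrable (lborel \<Otimes>\<^sub>M lborel) (\<lambda>z. (diff_quot s (\<lambda>x. u x + t * v x) z)\<^sup>2)"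
    unfolding diff_quot_linear
    using assms by (intro integrable_square_linear) (auto simp: X0_def frac_sobolev_iff)
  moreover have "AE x in lborel. x \<notin> \<Omega> \<longrightarrow> u x + t * v x = 0"
  proof -
    have "AE x in lborel. x \<notin> \<Omega> \<longrightarrow> u x = 0" "AE x in lborel. x \<notin> \<Omega> \<longrightarrow> v x = 0"
      using assms by (auto simp: X0_def)
    then show ?thesis by eventually_elim auto
  qed
  ultimately show ?thesis by (simp add: X0_def frac_sobolev_iff)
qed

lemma gagliardo_form_expand:
  assumes "u \<in> X0 \<Omega> s" "v \<in> X0 \<Omega> s"
  shows "gagliardo_form s (\<lambda>x. u x + t * v x) (\<lambda>x. u x + t * v x) =
    gagliardo_form s u u + 2 * t * gagliardo_form s u v + t\<^sup>2 * gagliardo_form s v v"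
proof -
  have [measurable]: "u \<in> borel_measurable lborel" "v \<in> borel_measurable lborel"
    using assms by (auto simp: X0_def frac_sobolev_iff)
  have i: "integrable (lborel \<Otimes>\<^sub>M lborel) (\<lambda>z. (diff_quot s u z)\<^sup>2)"
    "integrable (lborel \<Otimes>\<^sub>M lborel) (\<lambda>z. (diff_quot s v z)\<^sup>2)"
    using assms by (auto simp: X0_def frac_sobolev_iff)
  have i3: "integrable (lborel \<Otimes>\<^sub>M lborel) (\<lambda>z. diff_quot s u z * diff_quot s v z)"
    using i by (intro integrable_mult_of_squares) auto
  have eq: "(\<lambda>z. (diff_quot s u z + t * diff_quot s v z)\<^sup>2) = (\<lambda>z. (diff_quot s u z)\<^sup>2 +
      (2 * t * (diff_quot s u z * diff_quot s v z) + t\<^sup>2 * (diff_quot s v z)\<^sup>2))"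
    by (simp add: fun_eq_iff power2_eq_square algebra_simps)
  show ?thesis
    unfolding gagliardo_form_same diff_quot_linear eq gagliardo_form_eq[of s u v]
    using i i3 by simp
qed

section \<open>The fractional Sobolev inequality\<close>

lemma crit_exp_gt_2:
  assumes "0 < s" "real n > 2 * s"
  shows "2 < crit_exp n s"
  using assms by (simp add: crit_exp_def field_simps)

text \<open>A pointwise form of the inequality. Let \<open>a = |u x| > 0\<close>. By Markov's inequality the set \<open>A\<close> where
\<open>|u| \<ge> a / 2\<close> has measure at most \<open>\<beta> = W / (a / 2)^p\<close>. Choose the radius \<open>r\<close> such that the ball around \<open>x\<close> has
measure \<open>2 \<beta>\<close>: at least half of it lies outside \<open>A\<close>, and there \<open>|u x - u y| \<ge> a / 2\<close>. This bounds the
integral of the squared difference quotient in \<open>y\<close> from below, and since \<open>2 + p \<sigma> = p\<close> the bound is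
\<open>a^p\<close> times a constant and a negative power of \<open>W\<close>.\<close>

lemma sobolev_pointwise:
  fixes u :: "real ^ 'n \<Rightarrow> real" and x :: "real ^ 'n"
  assumes s: "0 < s" and n: "real CARD('n) > 2 * s" and p: "p = crit_exp CARD('n) s"
    and \<sigma>: "\<sigma> = 2 * s / real CARD('n)" and \<omega>: "\<omega> = unit_ball_vol (real CARD('n))"
    and [measurable]: "u \<in> borel_measurable lborel"
    and u: "integrable lborel (\<lambda>x. \<bar>u x\<bar> powr p)"
    and W: "W = (\<integral>x. \<bar>u x\<bar> powr p \<partial>lborel)" "0 < W"
  shows "ennreal (\<bar>u x\<bar> powr p) \<le> ennreal ((8 / \<omega>) * (2 powr (p + 1) / \<omega>) powr \<sigma> * W powr \<sigma>) *
     (\<integral>\<^sup>+y. ennreal ((diff_quot s u (x, y))\<^sup>2) \<partial>lborel)"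
proof (cases "u x = 0")
  case False
  define N where "N = real CARD('n)"
  have N: "0 < N" "2 * s < N" using n s by (auto simp: N_def)
  have \<omega>0: "0 < \<omega>" by (simp add: \<omega>)
  have p2: "2 < p" unfolding p using s n by (rule crit_exp_gt_2)
  define a where "a = \<bar>u x\<bar>"
  have a: "0 < a" using False by (simp add: a_def)
  define \<beta> where "\<beta> = W / (a / 2) powr p"
  have \<beta>: "0 < \<beta>" using W a by (simp add: \<beta>_def)
  define r where "r = (2 * \<beta> / \<omega>) powr (1 / N)"
  have r: "0 < r" using \<beta> \<omega>0 by (simp add: r_def)
  have rN: "\<omega> * r powr N = 2 * \<beta>" using N \<beta> \<omega>0 by (simp add: r_def powr_powr)
  define A where "A = {y \<in> space lborel. \<bar>u y\<bar> powr p \<ge> (a / 2) powr p}"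
  have [measurable]: "A \<in> sets borel"
    unfolding A_def by measurable
  have "emeasure lborel A \<le> (1 / (a / 2) powr p) * (\<integral>x. \<bar>u x\<bar> powr p \<partial>lborel)"
    unfolding A_def by (rule integral_Markov_inequality) (use u a in auto)
  then have A: "emeasure lborel A \<le> ennreal \<beta>" by (simp add: \<beta>_def W)
  have "ennreal (2 * \<beta>) = emeasure lborel (ball x r)"
    using rN r by (simp add: emeasure_ball \<omega> N_def powr_realpow)
  also have "\<dots> \<le> emeasure lborel ((ball x r - A) \<union> A)" by (intro emeasure_mono) auto
  also have "\<dots> \<le> emeasure lborel (ball x r - A) + emeasure lborel A"
    by (intro emeasure_subadditive) auto
  also have "\<dots> \<le> emeasure lborel (ball x r - A) + ennreal \<beta>" using A by (intro add_left_mono)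
  finally have "ennreal (2 * \<beta>) \<le> emeasure lborel (ball x r - A) + ennreal \<beta>" .
  then have B: "ennreal \<beta> \<le> emeasure lborel (ball x r - A)"
    using \<beta> by (cases "emeasure lborel (ball x r - A)")
      (auto simp: ennreal_plus[symmetric] ennreal_le_iff simp del: ennreal_plus)
  define c where "c = (a / 2)\<^sup>2 / r powr (N + 2 * s)"
  have c: "0 \<le> c" by (simp add: c_def)
  have "ennreal (c * \<beta>) \<le> ennreal c * emeasure lborel (ball x r - A)"
    using B c \<beta> by (simp add: ennreal_mult mult_left_mono)
  also have "\<dots> = (\<integral>\<^sup>+y. ennreal c * indicator (ball x r - A) y \<partial>lborel)"
    by (subst nn_integral_cmult_indicator) auto
  also have "\<dots> \<le> (\<integral>\<^sup>+y. ennreal ((diff_quot s u (x, y))\<^sup>2) \<partial>lborel)"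
  proof (rule nn_integral_mono)
    fix y
    show "ennreal c * indicator (ball x r - A) y \<le> ennreal ((diff_quot s u (x, y))\<^sup>2)"
    proof (cases "y \<in> ball x r - A")
      case True
      then have "\<bar>u y\<bar> powr p < (a / 2) powr p" by (auto simp: A_def)
      then have uy: "\<bar>u y\<bar> < a / 2" using p2 powr_mono2[of p "a / 2" "\<bar>u y\<bar>"] a by fastforce
      then have xy: "x \<noteq> y" using a by (auto simp: a_def)
      have "a / 2 \<le> \<bar>u x - u y\<bar>" using uy unfolding a_def by linarith
      then have 1: "(a / 2)\<^sup>2 \<le> (u x - u y)\<^sup>2" using a by (simp add: abs_le_square_iff[symmetric])
      have "norm (x - y) powr (N + 2 * s) \<le> r powr (N + 2 * s)"
        using True N s by (intro powr_mono2) (auto simp: dist_norm)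
      then have "c \<le> (u x - u y)\<^sup>2 / norm (x - y) powr (N + 2 * s)"
        unfolding c_def using 1 xy by (intro frac_le) auto
      also have "\<dots> = (diff_quot s u (x, y))\<^sup>2"
        by (simp add: diff_quot_def power_divide N_def power2_eq_square powr_add[symmetric])
      finally show ?thesis using True by (simp add: ennreal_leI)
    qed simp
  qed
  finally have main: "ennreal (c * \<beta>) \<le> (\<integral>\<^sup>+y. ennreal ((diff_quot s u (x, y))\<^sup>2) \<partial>lborel)" .
  define Y where "Y = 2 powr (p + 1) / \<omega>"
  have Y: "0 < Y" using \<omega>0 by (simp add: Y_def)
  have "2 * \<beta> / \<omega> = Y * W / a powr p"
    using a by (simp add: \<beta>_def Y_def powr_divide powr_add mult_ac)
  then have r2s: "r powr (2 * s) = (Y powr \<sigma> * W powr \<sigma>) / a powr (p * \<sigma>)"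
    using Y W a by (simp add: r_def powr_powr \<sigma> N_def powr_divide powr_mult)
  have "c * \<beta> = (a\<^sup>2 / 4) * (\<omega> * r powr N / 2) / r powr (N + 2 * s)"
    by (simp add: c_def rN power2_eq_square)
  also have "\<dots> = a\<^sup>2 * \<omega> / (8 * r powr (2 * s))"
    using r by (simp add: powr_add)
  finally have cb: "c * \<beta> = a\<^sup>2 * \<omega> / (8 * r powr (2 * s))" .
  \<comment> \<open>the identity of exponents that makes the critical exponent appear\<close>
  have p\<sigma>: "2 + p * \<sigma> = p"
    using N unfolding p crit_exp_def \<sigma> N_def by (simp add: field_simps)
  have "(8 / \<omega>) * Y powr \<sigma> * W powr \<sigma> * (c * \<beta>) = a powr 2 * a powr (p * \<sigma>)"
    unfolding cb r2s using \<omega>0 Y W a by (simp add: field_simps powr_numeral)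
  also have "\<dots> = a powr p" using p\<sigma> by (simp add: powr_add[symmetric])
  finally have eq: "a powr p = (8 / \<omega>) * Y powr \<sigma> * W powr \<sigma> * (c * \<beta>)" by simp
  have "ennreal (a powr p) = ennreal ((8 / \<omega>) * Y powr \<sigma> * W powr \<sigma>) * ennreal (c * \<beta>)"
    unfolding eq using \<omega>0 c \<beta> by (intro ennreal_mult) auto
  also have "\<dots> \<le> ennreal ((8 / \<omega>) * Y powr \<sigma> * W powr \<sigma>) *
      (\<integral>\<^sup>+y. ennreal ((diff_quot s u (x, y))\<^sup>2) \<partial>lborel)"
    using main by (rule mult_left_mono) auto
  finally show ?thesis by (simp add: a_def Y_def)
qed simp

text \<open>Integrating the pointwise bound gives \<open>W \<le> C W^\<sigma> [u]\<^sup>2\<close>. A finite \<open>W\<close> can be absorbed on the left,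
and \<open>1 - \<sigma> = 2 / p\<close>.\<close>

lemma sobolev_a_priori:
  fixes u :: "real ^ 'n \<Rightarrow> real"
  assumes s: "0 < s" and n: "real CARD('n) > 2 * s" and p: "p = crit_exp CARD('n) s"
    and \<sigma>: "\<sigma> = 2 * s / real CARD('n)" and \<omega>: "\<omega> = unit_ball_vol (real CARD('n))"
    and [measurable]: "u \<in> borel_measurable lborel"
    and u: "integrable lborel (\<lambda>x. \<bar>u x\<bar> powr p)"
    and Du: "integrable (lborel \<Otimes>\<^sub>M lborel) (\<lambda>z. (diff_quot s u z)\<^sup>2)"
  shows "(\<integral>x. \<bar>u x\<bar> powr p \<partial>lborel) \<le>
    ((8 / \<omega>) * (2 powr (p + 1) / \<omega>) powr \<sigma> * gagliardo_form s u u) powr (p / 2)"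
proof -
  define W where "W = (\<integral>x. \<bar>u x\<bar> powr p \<partial>lborel)"
  define C where "C = (8 / \<omega>) * (2 powr (p + 1) / \<omega>) powr \<sigma>"
  define A where "A = gagliardo_form s u u"
  have A0: "0 \<le> A" by (simp add: A_def gagliardo_form_nonneg)
  have \<omega>0: "0 < \<omega>" by (simp add: \<omega>)
  then have C0: "0 \<le> C" by (simp add: C_def)
  have p2: "2 < p" unfolding p using s n by (rule crit_exp_gt_2)
  have "0 \<le> W" by (simp add: W_def)
  show ?thesis
  proof (cases "W = 0")
    case True
    then show ?thesis by (simp add: W_def)
  next
    case False
    with \<open>0 \<le> W\<close> have W: "0 < W" by simp
    have "ennreal W = (\<integral>\<^sup>+x. ennreal (\<bar>u x\<bar> powr p) \<partial>lborel)"
      unfolding W_def using u by (intro nn_integral_eq_integral[symmetric]) auto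
    also have "\<dots> \<le> (\<integral>\<^sup>+x. ennreal (C * W powr \<sigma>) *
        (\<integral>\<^sup>+y. ennreal ((diff_quot s u (x, y))\<^sup>2) \<partial>lborel) \<partial>lborel)"
      unfolding C_def by (intro nn_integral_mono sobolev_pointwise s n p \<sigma> \<omega> u W_def W) auto
    also have "\<dots> = ennreal (C * W powr \<sigma>) *
        (\<integral>\<^sup>+x. (\<integral>\<^sup>+y. ennreal ((diff_quot s u (x, y))\<^sup>2) \<partial>lborel) \<partial>lborel)"
      by (rule nn_integral_cmult) measurable
    also have "(\<integral>\<^sup>+x. (\<integral>\<^sup>+y. ennreal ((diff_quot s u (x, y))\<^sup>2) \<partial>lborel) \<partial>lborel)
        = (\<integral>\<^sup>+z. ennreal ((diff_quot s u z)\<^sup>2) \<partial>(lborel \<Otimes>\<^sub>M lborel))"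
      by (rule lborel.nn_integral_fst) measurable
    also have "\<dots> = ennreal A"
      unfolding A_def gagliardo_form_same using Du by (intro nn_integral_eq_integral) auto
    also have "ennreal (C * W powr \<sigma>) * ennreal A = ennreal (C * W powr \<sigma> * A)"
      using C0 A0 by (intro ennreal_mult[symmetric]) auto
    finally have "W \<le> C * W powr \<sigma> * A" using C0 A0 by (subst (asm) ennreal_le_iff) auto
    then have "W / W powr \<sigma> \<le> C * A" using W by (simp add: field_simps)
    then have "W powr (1 - \<sigma>) \<le> C * A" using W by (simp add: powr_diff)
    then have "(W powr (1 - \<sigma>)) powr (p / 2) \<le> (C * A) powr (p / 2)"
      using p2 by (intro powr_mono2) auto
    moreover have "(1 - \<sigma>) * (p / 2) = 1"
      using n s unfolding \<sigma> p crit_exp_def by (simp add: field_simps)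
    ultimately show ?thesis using W unfolding powr_powr by (simp add: W_def C_def A_def)
  qed
qed

text \<open>Finiteness of \<open>\<integral> |u|^p\<close> is not known in advance. The truncations of a function in \<open>L\<^sup>2\<close> are bounded,
hence in \<open>L^p\<close>, and they do not increase the difference quotients; the bound passes to the limit
by Fatou's lemma.\<close>

lemma fractional_sobolev:
  assumes s: "0 < s" and n: "real CARD('n) > 2 * s" and p: "p = crit_exp CARD('n) s"
  obtains S where "0 < S"
    "\<And>u :: real ^ 'n \<Rightarrow> real. u \<in> frac_sobolev s \<Longrightarrow> integrable lborel (\<lambda>x. \<bar>u x\<bar> powr p)"
    "\<And>u :: real ^ 'n \<Rightarrow> real. u \<in> frac_sobolev s \<Longrightarrow>
       (\<integral>x. \<bar>u x\<bar> powr p \<partial>lborel) \<le> S * gagliardo_form s u u powr (p / 2)"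
proof -
  define \<sigma> where "\<sigma> = 2 * s / real CARD('n)"
  define \<omega> where "\<omega> = unit_ball_vol (real CARD('n))"
  define C where "C = (8 / \<omega>) * (2 powr (p + 1) / \<omega>) powr \<sigma>"
  have "0 < \<omega>" by (simp add: \<omega>_def)
  then have C0: "0 < C" by (simp add: C_def)
  have p2: "2 < p" unfolding p using s n by (rule crit_exp_gt_2)
  have *: "integrable lborel (\<lambda>x. \<bar>u x\<bar> powr p) \<and>
      (\<integral>x. \<bar>u x\<bar> powr p \<partial>lborel) \<le> C powr (p / 2) * gagliardo_form s u u powr (p / 2)"
    if u: "u \<in> frac_sobolev s" for u :: "real ^ 'n \<Rightarrow> real"
  proof -
    have [measurable]: "u \<in> borel_measurable lborel"
      and u2: "integrable lborel (\<lambda>x. (u x)\<^sup>2)"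
      and Du: "integrable (lborel \<Otimes>\<^sub>M lborel) (\<lambda>z. (diff_quot s u z)\<^sup>2)"
      using u by (auto simp: frac_sobolev_iff)
    define T where "T k x = max (- real k) (min (real k) (u x))" for k :: nat and x
    have [measurable]: "T k \<in> borel_measurable lborel" for k
      unfolding T_def[abs_def] by measurable
    have Tp: "integrable lborel (\<lambda>x. \<bar>T k x\<bar> powr p)" for k
    proof (rule Bochner_Integration.integrable_bound)
      show "integrable lborel (\<lambda>x. real k powr (p - 2) * (u x)\<^sup>2)" using u2 by simp
      show "AE x in lborel. norm (\<bar>T k x\<bar> powr p) \<le> norm (real k powr (p - 2) * (u x)\<^sup>2)"
      proof (rule AE_I2)
        fix x
        have "\<bar>T k x\<bar> powr p = \<bar>T k x\<bar> powr (p - 2) * \<bar>T k x\<bar> powr 2"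
          unfolding powr_add[symmetric] by simp
        also have "\<dots> \<le> real k powr (p - 2) * \<bar>u x\<bar> powr 2"
          using p2 by (intro mult_mono powr_mono2) (auto simp: T_def)
        also have "\<dots> = real k powr (p - 2) * (u x)\<^sup>2"
          by (cases "u x = 0") (auto simp: powr_numeral)
        finally show "norm (\<bar>T k x\<bar> powr p) \<le> norm (real k powr (p - 2) * (u x)\<^sup>2)" by simp
      qed
    qed simp
    have dq: "(diff_quot s (T k) z)\<^sup>2 \<le> (diff_quot s u z)\<^sup>2" for k z
    proof -
      have "\<bar>T k (fst z) - T k (snd z)\<bar> \<le> \<bar>u (fst z) - u (snd z)\<bar>"
        unfolding T_def by (auto simp: max_def min_def)
      then have "\<bar>diff_quot s (T k) z\<bar> \<le> \<bar>diff_quot s u z\<bar>"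
        by (simp add: diff_quot_def case_prod_beta abs_divide divide_right_mono)
      then show ?thesis by (simp add: abs_le_square_iff)
    qed
    have DT: "integrable (lborel \<Otimes>\<^sub>M lborel) (\<lambda>z. (diff_quot s (T k) z)\<^sup>2)" for k
      by (rule Bochner_Integration.integrable_bound[OF Du]) (use dq in auto)
    have bound: "(\<integral>x. \<bar>T k x\<bar> powr p \<partial>lborel) \<le> C powr (p / 2) * gagliardo_form s u u powr (p / 2)" for k
    proof -
      have "(\<integral>x. \<bar>T k x\<bar> powr p \<partial>lborel) \<le> (C * gagliardo_form s (T k) (T k)) powr (p / 2)"
        unfolding C_def by (rule sobolev_a_priori[OF s n p \<sigma>_def \<omega>_def _ Tp DT]) simp
      also have "\<dots> \<le> (C * gagliardo_form s u u) powr (p / 2)"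
      proof -
        have "gagliardo_form s (T k) (T k) \<le> gagliardo_form s u u"
          unfolding gagliardo_form_same using DT Du dq by (intro integral_mono) auto
        then show ?thesis using C0 p2 by (intro powr_mono2 mult_left_mono) (auto simp: gagliardo_form_nonneg)
      qed
      also have "\<dots> = C powr (p / 2) * gagliardo_form s u u powr (p / 2)"
        by (rule powr_mult)
      finally show ?thesis .
    qed
    have lim: "AE x in lborel. (\<lambda>k. \<bar>T k x\<bar> powr p) \<longlonglongrightarrow> \<bar>u x\<bar> powr p"
    proof (rule AE_I2)
      fix x
      show "(\<lambda>k. \<bar>T k x\<bar> powr p) \<longlonglongrightarrow> \<bar>u x\<bar> powr p"
      proof (rule tendsto_eventually, rule eventually_sequentiallyI)
        fix k assume "nat \<lceil>\<bar>u x\<bar>\<rceil> \<le> k"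
        then have "\<bar>u x\<bar> \<le> real k" by linarith
        then have "T k x = u x" by (auto simp: T_def max_def min_def)
        then show "\<bar>T k x\<bar> powr p = \<bar>u x\<bar> powr p" by simp
      qed
    qed
    have m: "(\<lambda>x. \<bar>u x\<bar> powr p) \<in> borel_measurable lborel" by simp
    show ?thesis
      using integral_fatou[OF Tp m _ bound lim] by auto
  qed
  show ?thesis
    using * C0 by (intro that[of "C powr (p / 2)"]) auto
qed

section \<open>A nonnegative bump in the energy space\<close>

lemma dyadic_shell:
  fixes z :: real
  assumes "0 < z"
  shows "\<exists>j::nat. (1/2) ^ (j + 1) \<le> z \<and> z < (1/2) ^ j \<or> 2 ^ j \<le> z \<and> z < 2 ^ (j + 1)"
proof (cases "z < 1")
  case True
  define k where "k = (LEAST k. (1/2) ^ k \<le> z)"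
  have ex: "\<exists>k. (1/2) ^ k \<le> z" using real_arch_pow_inv[OF assms, of "1/2"] less_imp_le by auto
  have k: "(1/2) ^ k \<le> z" unfolding k_def using LeastI_ex[OF ex] .
  with True have "k \<noteq> 0" by (cases k) auto
  then obtain j where j: "k = j + 1" using not0_implies_Suc by auto
  have "\<not> (1/2) ^ j \<le> z" using not_less_Least[of j "\<lambda>k. (1/2) ^ k \<le> z"] j by (simp add: k_def)
  with k j show ?thesis by auto
next
  case False
  define k where "k = (LEAST k. z < 2 ^ k)"
  have ex: "\<exists>k. z < 2 ^ k" using real_arch_pow[of 2 z] by auto
  have k: "z < 2 ^ k" unfolding k_def using LeastI_ex[OF ex] .
  with False have "k \<noteq> 0" by (cases k) auto
  then obtain j where j: "k = j + 1" using not0_implies_Suc by auto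
  have "\<not> z < 2 ^ j" using not_less_Least[of j "\<lambda>k. z < 2 ^ k"] j by (simp add: k_def)
  with k j have "2 ^ j \<le> z \<and> z < 2 ^ (j + 1)" by simp
  then show ?thesis by blast
qed

text \<open>The kernel that dominates the difference quotients of a bounded Lipschitz function. On the dyadic shells
inside the unit ball the integrals decay like \<open>2^(-j (2 - 2 s))\<close>, on those outside like \<open>2^(-2 s j)\<close>;
both are summable precisely because \<open>0 < s < 1\<close>.\<close>

lemma nn_integral_kernel_finite:
  fixes s :: real
  assumes s: "0 < s" "s < 1"
  shows "(\<integral>\<^sup>+z. ennreal (min 1 ((norm z)\<^sup>2) / norm z powr (real CARD('n) + 2 * s)) \<partial>(lborel :: (real ^ 'n) measure)) < \<infinity>"
proof -
  define N where "N = real CARD('n)"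
  define \<omega> where "\<omega> = unit_ball_vol N"
  have N: "0 < N" by (simp add: N_def)
  have \<omega>: "0 < \<omega>" using N by (simp add: \<omega>_def)
  define K where "K t = min 1 (t\<^sup>2) / t powr (N + 2 * s)" for t :: real
  define b1 where "b1 j = ((1/2) ^ j)\<^sup>2 / ((1/2) ^ (j + 1)) powr (N + 2 * s)" for j :: nat
  define b2 where "b2 j = 1 / (2 ^ j) powr (N + 2 * s)" for j :: nat
  have K: "ennreal (K (norm z)) \<le> (\<Sum>j. ennreal (b1 j) * indicator (ball 0 ((1/2) ^ j)) z)
      + (\<Sum>j. ennreal (b2 j) * indicator (ball 0 (2 ^ (j + 1))) z)" for z :: "real ^ 'n"
  proof (cases "z = 0")
    case False
    then have "0 < norm z" by simp
    from dyadic_shell[OF this] obtain j where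
      "(1/2) ^ (j + 1) \<le> norm z \<and> norm z < (1/2) ^ j \<or> 2 ^ j \<le> norm z \<and> norm z < 2 ^ (j + 1)" by blast
    then show ?thesis
    proof
      assume j: "(1/2) ^ (j + 1) \<le> norm z \<and> norm z < (1/2) ^ j"
      have "K (norm z) \<le> b1 j" unfolding K_def b1_def
      proof (rule frac_le)
        have "(norm z)\<^sup>2 \<le> ((1/2) ^ j)\<^sup>2" using j by (intro power_mono) auto
        then show "min 1 ((norm z)\<^sup>2) \<le> ((1/2) ^ j)\<^sup>2" by (rule min.coboundedI2)
        show "((1/2) ^ (j + 1)) powr (N + 2 * s) \<le> norm z powr (N + 2 * s)"
          using j N s by (intro powr_mono2) auto
      qed auto
      then have "ennreal (K (norm z)) \<le> ennreal (b1 j) * indicator (ball 0 ((1/2) ^ j)) z"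
        using j by (simp add: ennreal_leI)
      also have "\<dots> \<le> (\<Sum>j. ennreal (b1 j) * indicator (ball 0 ((1/2) ^ j)) z)"
        using ennreal_suminf_lessD not_le by blast
      finally show ?thesis by (simp add: add_increasing2)
    next
      assume j: "2 ^ j \<le> norm z \<and> norm z < 2 ^ (j + 1)"
      have "K (norm z) \<le> b2 j" unfolding K_def b2_def
        using j N s by (intro frac_le powr_mono2) auto
      then have "ennreal (K (norm z)) \<le> ennreal (b2 j) * indicator (ball 0 (2 ^ (j + 1))) z"
        using j by (simp add: ennreal_leI)
      also have "\<dots> \<le> (\<Sum>j. ennreal (b2 j) * indicator (ball 0 (2 ^ (j + 1))) z)"
        using ennreal_suminf_lessD not_le by blast
      finally show ?thesis by (simp add: add_increasing)
    qed
  qed (simp add: K_def)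
  have vol: "emeasure lborel (ball (0 :: real ^ 'n) r) = ennreal (\<omega> * r powr N)" if "0 < r" for r
    using that by (simp add: emeasure_ball \<omega>_def N_def powr_realpow)
  define x1 where "x1 = (1/2) powr (2 - 2 * s)"
  define x2 where "x2 = (1/2) powr (2 * s)"
  have x: "0 \<le> x1" "x1 < 1" "0 \<le> x2" "x2 < 1"
    using s powr_less_mono2[of "2 - 2 * s" "1/2" 1] powr_less_mono2[of "2 * s" "1/2" 1]
    by (auto simp: x1_def x2_def)
  have e1: "b1 j * (\<omega> * ((1/2) ^ j) powr N) = \<omega> * 2 powr (N + 2 * s) * x1 ^ j" for j
  proof -
    have h: "(1/2 :: real) ^ j = 2 powr (- real j)" for j
      by (simp add: powr_minus powr_realpow power_one_over inverse_eq_divide)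
    have x1': "x1 ^ j = 2 powr (- real j * (2 - 2 * s))"
    proof -
      have "x1 = 2 powr (- (2 - 2 * s))"
        unfolding x1_def by (subst powr_minus) (simp add: powr_divide inverse_eq_divide)
      then show ?thesis by (simp add: powr_power algebra_simps)
    qed
    show ?thesis unfolding b1_def x1' h power2_eq_square
      by (simp add: powr_powr powr_add[symmetric] powr_diff[symmetric] algebra_simps)
  qed
  have e2: "b2 j * (\<omega> * (2 ^ (j + 1)) powr N) = \<omega> * 2 powr N * x2 ^ j" for j
  proof -
    have h: "(2 :: real) ^ j = 2 powr (real j)" for j by (simp add: powr_realpow)
    have x2': "x2 ^ j = 2 powr (- real j * (2 * s))"
    proof -
      have "x2 = 2 powr (- (2 * s))"
        unfolding x2_def by (subst powr_minus) (simp add: powr_divide inverse_eq_divide)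
      then show ?thesis by (simp add: powr_power algebra_simps)
    qed
    have "b2 j = 2 powr (- real j * (N + 2 * s))"
      by (simp add: b2_def h powr_powr powr_minus inverse_eq_divide)
    then show ?thesis unfolding x2' h
      by (simp add: powr_powr powr_add[symmetric] powr_diff[symmetric] algebra_simps)
  qed
  have "(\<integral>\<^sup>+z. ennreal (K (norm z)) \<partial>(lborel :: (real ^ 'n) measure)) \<le>
    (\<integral>\<^sup>+z. (\<Sum>j. ennreal (b1 j) * indicator (ball 0 ((1/2) ^ j)) z)
      + (\<Sum>j. ennreal (b2 j) * indicator (ball 0 (2 ^ (j + 1))) z) \<partial>(lborel :: (real ^ 'n) measure))"
    by (intro nn_integral_mono K)
  also have "\<dots> = (\<Sum>j. ennreal (b1 j) * ennreal (\<omega> * ((1/2) ^ j) powr N)) +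
      (\<Sum>j. ennreal (b2 j) * ennreal (\<omega> * (2 ^ (j + 1)) powr N))"
  proof -
    have 1: "(\<lambda>z :: real ^ 'n. ennreal (c j) * indicator (ball 0 (R j)) z) \<in> borel_measurable lborel"
      for c R :: "nat \<Rightarrow> real" and j
      by (intro borel_measurable_times_ennreal borel_measurable_const borel_measurable_indicator) simp
    have 2: "(\<integral>\<^sup>+z. (\<Sum>j. ennreal (c j) * indicator (ball 0 (R j)) z) \<partial>(lborel :: (real ^ 'n) measure))
        = (\<Sum>j. ennreal (c j) * ennreal (\<omega> * R j powr N))" if "\<And>j. 0 < R j" for c R :: "nat \<Rightarrow> real"
      by (subst nn_integral_suminf, rule 1) (simp add: nn_integral_cmult_indicator vol that)
    have "(\<integral>\<^sup>+z. (\<Sum>j. ennreal (b1 j) * indicator (ball 0 ((1/2) ^ j)) z)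
      + (\<Sum>j. ennreal (b2 j) * indicator (ball 0 (2 ^ (j + 1))) z) \<partial>(lborel :: (real ^ 'n) measure)) =
      (\<integral>\<^sup>+z. (\<Sum>j. ennreal (b1 j) * indicator (ball 0 ((1/2) ^ j)) z) \<partial>(lborel :: (real ^ 'n) measure))
      + (\<integral>\<^sup>+z. (\<Sum>j. ennreal (b2 j) * indicator (ball 0 (2 ^ (j + 1))) z) \<partial>(lborel :: (real ^ 'n) measure))"
      by (intro nn_integral_add borel_measurable_suminf_order 1)
    then show ?thesis using 2[of "\<lambda>j. (1/2) ^ j" b1] 2[of "\<lambda>j. 2 ^ (j + 1)" b2] by simp
  qed
  also have "\<dots> = (\<Sum>j. ennreal (\<omega> * 2 powr (N + 2 * s) * x1 ^ j)) + (\<Sum>j. ennreal (\<omega> * 2 powr N * x2 ^ j))"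
  proof -
    have "ennreal (b1 j) * ennreal (\<omega> * ((1/2) ^ j) powr N) = ennreal (\<omega> * 2 powr (N + 2 * s) * x1 ^ j)" for j
      unfolding e1[symmetric] using \<omega> by (intro ennreal_mult[symmetric]) (auto simp: b1_def)
    moreover have "ennreal (b2 j) * ennreal (\<omega> * (2 ^ (j + 1)) powr N) = ennreal (\<omega> * 2 powr N * x2 ^ j)" for j
      unfolding e2[symmetric] using \<omega> by (intro ennreal_mult[symmetric]) (auto simp: b2_def)
    ultimately show ?thesis by simp
  qed
  also have "\<dots> < \<infinity>"
  proof -
    have "(\<Sum>j. ennreal (\<omega> * 2 powr (N + 2 * s) * x1 ^ j)) \<noteq> \<infinity>"
      using x \<omega> by (subst suminf_ennreal2) (auto intro!: summable_mult summable_geometric)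
    moreover have "(\<Sum>j. ennreal (\<omega> * 2 powr N * x2 ^ j)) \<noteq> \<infinity>"
      using x \<omega> by (subst suminf_ennreal2) (auto intro!: summable_mult summable_geometric)
    ultimately show ?thesis by (simp add: less_top)
  qed
  finally show ?thesis by (simp add: K_def N_def)
qed

lemma nn_integral_lborel_shift:
  fixes f :: "'a::euclidean_space \<Rightarrow> ennreal"
  assumes [measurable]: "f \<in> borel_measurable borel"
  shows "(\<integral>\<^sup>+y. f (x - y) \<partial>lborel) = (\<integral>\<^sup>+z. f z \<partial>lborel)"
proof -
  have "(\<integral>\<^sup>+z. f z \<partial>(lborel :: 'a measure)) = (\<integral>\<^sup>+z. f z \<partial>density (distr lborel borel (\<lambda>z. x + (- 1) *\<^sub>R z)) (\<lambda>_. ennreal (\<bar>- 1\<bar> ^ DIM('a))))"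
    by (subst lborel_affine[of "- 1" x]) auto
  also have "\<dots> = (\<integral>\<^sup>+y. f (x - y) \<partial>lborel)"
    by (simp add: nn_integral_density nn_integral_distr)
  finally show ?thesis by simp
qed

text \<open>The function \<open>\<phi>(x) = max 0 (r - |x - x0|)\<close> with \<open>r \<le> 1\<close> is supported in a ball \<open>B\<close>, is bounded by
\<open>1\<close> and is Lipschitz with constant \<open>1\<close>. Its squared difference quotient is nonzero only if one of the two points lies in \<open>B\<close>, and it is
at most the kernel above.\<close>

lemma bump_in_X0:
  fixes \<Omega> :: "(real ^ 'n) set"
  assumes s: "0 < s" "s < 1" and \<Omega>: "open \<Omega>" "\<Omega> \<noteq> {}"
  obtains \<phi> where "\<phi> \<in> X0 \<Omega> s" "\<And>x. 0 \<le> \<phi> x" "\<And>x. \<phi> x \<le> 1" "0 < (\<integral>x. (\<phi> x)\<^sup>2 \<partial>lborel)"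
proof -
  obtain x0 where "x0 \<in> \<Omega>" using \<Omega> by blast
  with \<Omega> obtain r0 where r0: "0 < r0" "ball x0 r0 \<subseteq> \<Omega>" by (meson openE)
  define r where "r = min 1 r0"
  have r: "0 < r" "r \<le> 1" "ball x0 r \<subseteq> \<Omega>" using r0 by (auto simp: r_def)
  define B where "B = ball x0 r"
  have [measurable]: "B \<in> sets borel" by (simp add: B_def)
  define \<phi> where "\<phi> x = max 0 (r - dist x0 x)" for x
  have [measurable]: "\<phi> \<in> borel_measurable lborel" unfolding \<phi>_def[abs_def] by measurable
  have \<phi>: "0 \<le> \<phi> x" "\<phi> x \<le> 1" "x \<notin> B \<Longrightarrow> \<phi> x = 0" for x
    using r zero_le_dist[of x0 x] by (auto simp: \<phi>_def B_def simp del: zero_le_dist)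
  have fin: "emeasure lborel B < \<infinity>" unfolding B_def by (rule emeasure_lborel_ball_finite)
  have sq: "integrable lborel (\<lambda>x. (\<phi> x)\<^sup>2)"
  proof (rule Bochner_Integration.integrable_bound)
    show "integrable lborel (indicator B :: _ \<Rightarrow> real)" using fin by simp
    show "AE x in lborel. norm ((\<phi> x)\<^sup>2) \<le> norm (indicator B x :: real)"
      using \<phi> by (auto simp: indicator_def power_le_one)
  qed simp
  define k where "k z = min 1 ((norm z)\<^sup>2) / norm z powr (real CARD('n) + 2 * s)" for z :: "real ^ 'n"
  have [measurable]: "k \<in> borel_measurable borel" unfolding k_def[abs_def] by measurable
  define I where "I = (\<integral>\<^sup>+z. ennreal (k z) \<partial>lborel)"
  have I: "I < \<infinity>" unfolding I_def k_def using s by (rule nn_integral_kernel_finite)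
  \<comment> \<open>translation invariance: the kernel has the same integral around every point\<close>
  have k_shift: "(\<integral>\<^sup>+y. ennreal (k (x - y)) \<partial>lborel) = I" for x
    unfolding I_def by (rule nn_integral_lborel_shift[of "\<lambda>z. ennreal (k z)"]) simp
  have k_shift': "(\<integral>\<^sup>+x. ennreal (k (x - y)) \<partial>lborel) = I" for y
  proof -
    have "(\<lambda>x. ennreal (k (x - y))) = (\<lambda>x. ennreal (k (y - x)))"
      by (simp add: k_def norm_minus_commute)
    then show ?thesis by (simp only: k_shift)
  qed
  have pt: "(diff_quot s \<phi> (x, y))\<^sup>2 \<le> k (x - y) * indicator B x + k (x - y) * indicator B y" for x y
  proof (cases "x \<in> B \<or> y \<in> B")
    case True
    have "dist x0 x \<le> dist x0 y + dist x y" "dist x0 y \<le> dist x0 x + dist x y"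
      by metric+
    then have "\<bar>\<phi> x - \<phi> y\<bar> \<le> norm (x - y)"
      unfolding \<phi>_def by (auto simp: dist_norm)
    then have "(\<phi> x - \<phi> y)\<^sup>2 \<le> (norm (x - y))\<^sup>2" by (simp add: abs_le_square_iff[symmetric])
    moreover have "\<bar>\<phi> x - \<phi> y\<bar> \<le> 1" using \<phi>(1,2)[of x] \<phi>(1,2)[of y] by linarith
    then have "(\<phi> x - \<phi> y)\<^sup>2 \<le> 1" by (simp add: abs_square_le_1)
    ultimately have "(\<phi> x - \<phi> y)\<^sup>2 / norm (x - y) powr (real CARD('n) + 2 * s) \<le> k (x - y)"
      unfolding k_def by (intro divide_right_mono) auto
    then have "(diff_quot s \<phi> (x, y))\<^sup>2 \<le> k (x - y)"
      by (simp add: diff_quot_def power_divide power2_eq_square powr_add[symmetric])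
    moreover have "0 \<le> k (x - y)" by (simp add: k_def)
    ultimately show ?thesis using True by (auto simp: indicator_def)
  next
    case False
    then show ?thesis using \<phi>(3) by (simp add: diff_quot_def)
  qed
  have "(\<integral>\<^sup>+z. ennreal ((diff_quot s \<phi> z)\<^sup>2) \<partial>(lborel \<Otimes>\<^sub>M lborel)) =
      (\<integral>\<^sup>+x. (\<integral>\<^sup>+y. ennreal ((diff_quot s \<phi> (x, y))\<^sup>2) \<partial>lborel) \<partial>lborel)"
    by (rule lborel.nn_integral_fst[symmetric]) measurable
  also have "\<dots> \<le> (\<integral>\<^sup>+x. (\<integral>\<^sup>+y. ennreal (k (x - y)) * indicator B x + ennreal (k (x - y)) * indicator B y \<partial>lborel) \<partial>lborel)"
  proof (intro nn_integral_mono)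
    fix x y
    have k0: "0 \<le> k (x - y)" by (simp add: k_def)
    have "ennreal ((diff_quot s \<phi> (x, y))\<^sup>2) \<le> ennreal (k (x - y) * indicator B x + k (x - y) * indicator B y)"
      by (rule ennreal_leI) (rule pt)
    also have "\<dots> = ennreal (k (x - y)) * indicator B x + ennreal (k (x - y)) * indicator B y"
      using k0 by (auto simp: indicator_def)
    finally show "ennreal ((diff_quot s \<phi> (x, y))\<^sup>2) \<le>
      ennreal (k (x - y)) * indicator B x + ennreal (k (x - y)) * indicator B y" .
  qed
  also have "\<dots> = (\<integral>\<^sup>+x. (\<integral>\<^sup>+y. ennreal (k (x - y)) * indicator B x \<partial>lborel) +
      (\<integral>\<^sup>+y. ennreal (k (x - y)) * indicator B y \<partial>lborel) \<partial>lborel)"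
    by (intro nn_integral_cong nn_integral_add) measurable
  also have "\<dots> = (\<integral>\<^sup>+x. (\<integral>\<^sup>+y. ennreal (k (x - y)) * indicator B x \<partial>lborel) \<partial>lborel) +
      (\<integral>\<^sup>+x. (\<integral>\<^sup>+y. ennreal (k (x - y)) * indicator B y \<partial>lborel) \<partial>lborel)"
    by (intro nn_integral_add) measurable
  also have "(\<integral>\<^sup>+x. (\<integral>\<^sup>+y. ennreal (k (x - y)) * indicator B y \<partial>lborel) \<partial>lborel) =
      (\<integral>\<^sup>+y. (\<integral>\<^sup>+x. ennreal (k (x - y)) * indicator B y \<partial>lborel) \<partial>lborel)"
    by (rule lborel_pair.Fubini'[symmetric]) measurable
  also have "\<dots> = (\<integral>\<^sup>+y. I * indicator B y \<partial>lborel)"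
  proof (rule nn_integral_cong)
    fix y
    have "(\<integral>\<^sup>+x. ennreal (k (x - y)) * indicator B y \<partial>lborel) = (\<integral>\<^sup>+x. ennreal (k (x - y)) \<partial>lborel) * indicator B y"
      by (rule nn_integral_multc) measurable
    then show "(\<integral>\<^sup>+x. ennreal (k (x - y)) * indicator B y \<partial>lborel) = I * indicator B y"
      by (simp only: k_shift')
  qed
  also have "(\<integral>\<^sup>+x. (\<integral>\<^sup>+y. ennreal (k (x - y)) * indicator B x \<partial>lborel) \<partial>lborel) = (\<integral>\<^sup>+y. I * indicator B y \<partial>lborel)"
  proof (rule nn_integral_cong)
    fix x
    have "(\<integral>\<^sup>+y. ennreal (k (x - y)) * indicator B x \<partial>lborel) = (\<integral>\<^sup>+y. ennreal (k (x - y)) \<partial>lborel) * indicator B x"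
      by (rule nn_integral_multc) measurable
    then show "(\<integral>\<^sup>+y. ennreal (k (x - y)) * indicator B x \<partial>lborel) = I * indicator B x"
      by (simp only: k_shift)
  qed
  also have "(\<integral>\<^sup>+y. I * indicator B y \<partial>lborel) + (\<integral>\<^sup>+y. I * indicator B y \<partial>lborel) < \<infinity>"
    using I fin by (simp add: nn_integral_cmult_indicator ennreal_mult_less_top)
  finally have "integrable (lborel \<Otimes>\<^sub>M lborel) (\<lambda>z. (diff_quot s \<phi> z)\<^sup>2)"
    by (intro integrableI_nonneg) auto
  moreover have "AE x in lborel. x \<notin> \<Omega> \<longrightarrow> \<phi> x = 0"
    by (rule AE_I2) (use \<phi>(3) r(3)[folded B_def] in blast)
  ultimately have X0: "\<phi> \<in> X0 \<Omega> s" using sq by (simp add: X0_def frac_sobolev_iff)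
  have "0 < (\<integral>x. (\<phi> x)\<^sup>2 \<partial>lborel)"
  proof -
    define B2 where "B2 = ball x0 (r / 2)"
    have [measurable]: "B2 \<in> sets borel" by (simp add: B2_def)
    have "0 < (r / 2)\<^sup>2 * measure lborel B2"
      using r content_ball_pos[of "r / 2" x0] by (simp add: B2_def)
    also have "\<dots> = (\<integral>x. (r / 2)\<^sup>2 * indicator B2 x \<partial>lborel)" by simp
    also have "\<dots> \<le> (\<integral>x. (\<phi> x)\<^sup>2 \<partial>lborel)"
    proof (rule integral_mono)
      show "integrable lborel (\<lambda>x. (r / 2)\<^sup>2 * indicator B2 x :: real)"
        using emeasure_lborel_ball_finite[of x0 "r / 2"] by (simp add: B2_def)
      show "(r / 2)\<^sup>2 * indicator B2 x \<le> (\<phi> x)\<^sup>2" for x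
      proof (cases "x \<in> B2")
        case True
        then have "r / 2 \<le> \<phi> x" unfolding B2_def \<phi>_def mem_ball by linarith
        then show ?thesis using True r by (simp add: power_mono)
      qed simp
    qed (rule sq)
    finally show ?thesis .
  qed
  then show ?thesis using that X0 \<phi> by blast
qed

section \<open>Compactness below the critical exponent\<close>

lemma L1_Cauchy_imp_AE_convergent_subseq:
  fixes f :: "nat \<Rightarrow> 'a \<Rightarrow> real"
  assumes f: "\<And>k. integrable M (f k)"
    and Cauchy: "\<And>e. 0 < e \<Longrightarrow> \<exists>K. \<forall>k\<ge>K. \<forall>l\<ge>K. (\<integral>x. \<bar>f k x - f l x\<bar> \<partial>M) < e"
  obtains r g where "strict_mono r" "g \<in> borel_measurable M"
    "AE x in M. (\<lambda>k. f (r k) x) \<longlonglongrightarrow> g x"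
proof -
  have [measurable]: "f k \<in> borel_measurable M" for k using f by auto
  have "\<exists>K. \<forall>n. \<forall>k\<ge>K n. \<forall>l\<ge>K n. (\<integral>x. \<bar>f k x - f l x\<bar> \<partial>M) < (1/2) ^ n"
    by (rule choice) (use Cauchy in auto)
  then obtain K where K: "\<And>n k l. k \<ge> K n \<Longrightarrow> l \<ge> K n \<Longrightarrow> (\<integral>x. \<bar>f k x - f l x\<bar> \<partial>M) < (1/2) ^ n"
    by blast
  \<comment> \<open>consecutive members of the subsequence have \<open>L\<^sup>1\<close> distance less than \<open>2^(-n)\<close>\<close>
  define r where "r = rec_nat (K 0) (\<lambda>n rn. max (K (Suc n)) (Suc rn))"
  have r: "r 0 = K 0" "r (Suc n) = max (K (Suc n)) (Suc (r n))" for n by (simp_all add: r_def)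
  have mono: "strict_mono r" by (simp add: strict_mono_Suc_iff r(2) less_max_iff_disj)
  have rK: "r n \<ge> K n" for n by (cases n) (auto simp: r)
  have rS: "r (Suc n) \<ge> K n" for n using rK[of n] r(2)[of n] by linarith
  have int: "integrable M (\<lambda>x. \<bar>f (r (Suc k)) x - f (r k) x\<bar>)" for k using f by simp
  have "(\<integral>\<^sup>+x. (\<Sum>k. ennreal \<bar>f (r (Suc k)) x - f (r k) x\<bar>) \<partial>M) =
      (\<Sum>k. \<integral>\<^sup>+x. ennreal \<bar>f (r (Suc k)) x - f (r k) x\<bar> \<partial>M)"
    by (rule nn_integral_suminf) measurable
  also have "\<dots> \<le> (\<Sum>k. ennreal ((1/2) ^ k))"
  proof (rule suminf_le)
    fix k
    have "(\<integral>\<^sup>+x. ennreal \<bar>f (r (Suc k)) x - f (r k) x\<bar> \<partial>M) = ennreal (\<integral>x. \<bar>f (r (Suc k)) x - f (r k) x\<bar> \<partial>M)"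
      using int by (intro nn_integral_eq_integral) auto
    also have "\<dots> \<le> ennreal ((1/2) ^ k)" using K[OF rS rK, of k] by (intro ennreal_leI) simp
    finally show "(\<integral>\<^sup>+x. ennreal \<bar>f (r (Suc k)) x - f (r k) x\<bar> \<partial>M) \<le> ennreal ((1/2) ^ k)" .
  qed auto
  also have "\<dots> < \<infinity>" by (subst suminf_ennreal2) (auto intro!: summable_geometric)
  finally have "(\<integral>\<^sup>+x. (\<Sum>k. ennreal \<bar>f (r (Suc k)) x - f (r k) x\<bar>) \<partial>M) \<noteq> \<infinity>" by auto
  then have "AE x in M. (\<Sum>k. ennreal \<bar>f (r (Suc k)) x - f (r k) x\<bar>) \<noteq> \<infinity>"
    by (intro nn_integral_noteq_infinite) auto
  then have ae: "AE x in M. (\<lambda>k. f (r k) x) \<longlonglongrightarrow> lim (\<lambda>k. f (r k) x)"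
  proof eventually_elim
    case (elim x)
    then have "summable (\<lambda>k. \<bar>f (r (Suc k)) x - f (r k) x\<bar>)"
      by (intro summable_suminf_not_top) auto
    then have "summable (\<lambda>k. f (r (Suc k)) x - f (r k) x)" by (rule summable_rabs_cancel)
    then have "convergent (\<lambda>n. \<Sum>k<n. f (r (Suc k)) x - f (r k) x)" by (simp add: summable_iff_convergent)
    then have "convergent (\<lambda>n. f (r n) x - f (r 0) x)"
      by (simp add: sum_lessThan_telescope[of "\<lambda>k. f (r k) x"])
    then have "convergent (\<lambda>n. f (r n) x - f (r 0) x + f (r 0) x)" by (intro convergent_add convergent_const)
    then show ?case by (simp add: convergent_LIMSEQ_iff)
  qed
  show ?thesis by (rule that[OF mono _ ae]) measurable
qed

text \<open>The quantitative core of compactness. On a ball of radius \<open>\<epsilon>\<close> a function differs from its mean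
by at most the average of \<open>|w x - w y|\<close>, and \<open>|w x - w y| \<le> t + (w x - w y)\<^sup>2 / t\<close>. As \<open>|x - y| < 2 \<epsilon>\<close> there,
the square is at most \<open>(2 \<epsilon>)^(n + 2 s)\<close> times the squared difference quotient, and division by the
volume of the ball leaves the factor \<open>\<epsilon>^(2 s)\<close>. Hence \<open>w\<close> is small in \<open>L\<^sup>1\<close> if finitely many of its
means are small and the energy is bounded: choose \<open>t\<close> first, then \<open>\<epsilon>\<close>.\<close>

lemma L1_le_ball_means:
  fixes w :: "real ^ 'n \<Rightarrow> real"
  assumes s: "0 < s" and \<Omega>: "\<Omega> \<in> sets borel" "emeasure lborel \<Omega> < \<infinity>"
    and F: "finite F" "\<Omega> \<subseteq> (\<Union>c\<in>F. ball c \<epsilon>)" and \<epsilon>: "0 < \<epsilon>" and t: "0 < t"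
    and w: "integrable lborel w" and Dw: "integrable (lborel \<Otimes>\<^sub>M lborel) (\<lambda>z. (diff_quot s w z)\<^sup>2)"
    and w0: "AE x in lborel. x \<notin> \<Omega> \<longrightarrow> w x = 0"
  shows "(\<integral>x. \<bar>w x\<bar> \<partial>lborel) \<le> (\<Sum>c\<in>F. \<bar>\<integral>x. indicator (ball c \<epsilon>) x * w x \<partial>lborel\<bar>) +
    t * measure lborel \<Omega> +
    2 powr (real CARD('n) + 2 * s) / unit_ball_vol (real CARD('n)) * \<epsilon> powr (2 * s) / t * gagliardo_form s w w"
proof -
  define N where "N = real CARD('n)"
  define \<omega> where "\<omega> = unit_ball_vol N"
  have N: "0 < N" by (simp add: N_def)
  have \<omega>: "0 < \<omega>" using N by (simp add: \<omega>_def)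
  note [measurable] = \<Omega>(1)
  have [measurable]: "w \<in> borel_measurable lborel" using w by auto
  define m where "m c = \<bar>\<integral>x. indicator (ball c \<epsilon>) x * w x \<partial>lborel\<bar>" for c
  define V where "V = \<omega> * \<epsilon> powr N"
  have V: "0 < V" using \<omega> \<epsilon> by (simp add: V_def)
  have vol: "emeasure lborel (ball c \<epsilon>) = ennreal V" for c :: "real ^ 'n"
    using \<epsilon> by (simp add: emeasure_ball V_def \<omega>_def N_def powr_realpow)
  define D where "D = (2 * \<epsilon>) powr (N + 2 * s) / t"
  have D: "0 \<le> D" using t by (simp add: D_def)
  define H where "H x y = ennreal ((diff_quot s w (x, y))\<^sup>2)" for x y
  have [measurable]: "(\<lambda>y. H x y) \<in> borel_measurable lborel" for x unfolding H_def by measurable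
  have [measurable]: "(\<lambda>(x, y). H x y) \<in> borel_measurable (lborel \<Otimes>\<^sub>M lborel)"
    unfolding H_def by measurable
  define R where "R x = (\<Sum>c\<in>F. ennreal (m c / V) * indicator (ball c \<epsilon>) x) + ennreal t * indicator \<Omega> x
      + ennreal (D / V) * (\<integral>\<^sup>+y. H x y \<partial>lborel)" for x
  have key: "ennreal \<bar>w x\<bar> \<le> R x" if x: "x \<in> \<Omega>" for x
  proof -
    from F x obtain c where c: "c \<in> F" "x \<in> ball c \<epsilon>" by blast
    define Q where "Q = ball c \<epsilon>"
    have [measurable]: "Q \<in> sets borel" by (simp add: Q_def)
    have Qi: "integrable lborel (\<lambda>y. indicator Q y :: real)"
      unfolding Q_def using vol[of c] by simp
    have Qm: "measure lborel Q = V" using vol[of c] V by (simp add: Q_def measure_def)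
    have wi: "integrable lborel (\<lambda>y. indicator Q y * w y)"
      using integrable_mult_indicator[of Q lborel w] w by simp
    have "\<bar>w x\<bar> * V = \<bar>\<integral>y. indicator Q y * w x \<partial>lborel\<bar>"
      using V by (simp add: Qm abs_mult)
    also have "(\<integral>y. indicator Q y * w x \<partial>lborel) =
        (\<integral>y. indicator Q y * w y + (indicator Q y * w x - indicator Q y * w y) \<partial>lborel)" by simp
    also have "\<dots> = (\<integral>y. indicator Q y * w y \<partial>lborel) + (\<integral>y. indicator Q y * w x - indicator Q y * w y \<partial>lborel)"
      using wi Qi by (intro Bochner_Integration.integral_add Bochner_Integration.integrable_diff) auto
    also have "\<bar>\<dots>\<bar> \<le> m c + \<bar>\<integral>y. indicator Q y * w x - indicator Q y * w y \<partial>lborel\<bar>"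
      by (simp add: m_def Q_def)
    also have "\<dots> \<le> m c + (\<integral>y. \<bar>indicator Q y * w x - indicator Q y * w y\<bar> \<partial>lborel)"
      by (intro add_left_mono integral_abs_bound)
    finally have 1: "\<bar>w x\<bar> * V \<le> m c + (\<integral>y. \<bar>indicator Q y * w x - indicator Q y * w y\<bar> \<partial>lborel)" .
    have "ennreal (\<integral>y. \<bar>indicator Q y * w x - indicator Q y * w y\<bar> \<partial>lborel) =
        (\<integral>\<^sup>+y. ennreal \<bar>indicator Q y * w x - indicator Q y * w y\<bar> \<partial>lborel)"
      using wi Qi by (intro nn_integral_eq_integral[symmetric] integrable_abs Bochner_Integration.integrable_diff) auto
    also have "\<dots> \<le> (\<integral>\<^sup>+y. ennreal t * indicator Q y + ennreal D * H x y \<partial>lborel)"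
    proof (rule nn_integral_mono)
      fix y
      show "ennreal \<bar>indicator Q y * w x - indicator Q y * w y\<bar> \<le> ennreal t * indicator Q y + ennreal D * H x y"
      proof (cases "y \<in> Q")
        case True
        have "norm (x - y) \<le> 2 * \<epsilon>"
          using True c dist_triangle2[of x y c] by (auto simp: Q_def dist_norm norm_minus_commute)
        then have "norm (x - y) powr (N + 2 * s) \<le> (2 * \<epsilon>) powr (N + 2 * s)"
          using N s by (intro powr_mono2) auto
        then have "(diff_quot s w (x, y))\<^sup>2 * norm (x - y) powr (N + 2 * s) \<le> (diff_quot s w (x, y))\<^sup>2 * (2 * \<epsilon>) powr (N + 2 * s)"
          by (intro mult_left_mono) auto
        moreover have "(diff_quot s w (x, y))\<^sup>2 * norm (x - y) powr (N + 2 * s) = (w x - w y)\<^sup>2"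
          by (cases "x = y") (simp_all add: diff_quot_def power_divide N_def power2_eq_square powr_add[symmetric])
        ultimately have sq: "(w x - w y)\<^sup>2 / t \<le> D * (diff_quot s w (x, y))\<^sup>2"
          using t by (simp add: D_def divide_right_mono mult.commute)
        have "\<bar>w x - w y\<bar> \<le> t + (w x - w y)\<^sup>2 / t"
        proof (cases "\<bar>w x - w y\<bar> \<le> t")
          case False
          then have "\<bar>w x - w y\<bar> * t \<le> \<bar>w x - w y\<bar> * \<bar>w x - w y\<bar>" using t by (intro mult_left_mono) auto
          then have "\<bar>w x - w y\<bar> \<le> (w x - w y)\<^sup>2 / t" using t by (simp add: field_simps power2_eq_square)
          then show ?thesis using t by linarith
        qed (use t in \<open>simp add: add_increasing2\<close>)
        also have "\<dots> \<le> t + D * (diff_quot s w (x, y))\<^sup>2" using sq by simp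
        finally have "ennreal \<bar>w x - w y\<bar> \<le> ennreal (t + D * (diff_quot s w (x, y))\<^sup>2)" by (rule ennreal_leI)
        also have "\<dots> = ennreal t + ennreal D * H x y"
          using t D by (simp add: H_def ennreal_mult)
        finally show ?thesis using True by simp
      qed simp
    qed
    also have "\<dots> = ennreal t * ennreal V + ennreal D * (\<integral>\<^sup>+y. H x y \<partial>lborel)"
    proof -
      have "(\<integral>\<^sup>+y. ennreal t * indicator Q y + ennreal D * H x y \<partial>lborel) =
        (\<integral>\<^sup>+y. ennreal t * indicator Q y \<partial>lborel) + (\<integral>\<^sup>+y. ennreal D * H x y \<partial>lborel)"
        by (rule nn_integral_add) measurable
      then show ?thesis using vol[of c] by (simp add: nn_integral_cmult nn_integral_cmult_indicator Q_def)
    qed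
    finally have 2: "ennreal (\<integral>y. \<bar>indicator Q y * w x - indicator Q y * w y\<bar> \<partial>lborel) \<le>
        ennreal t * ennreal V + ennreal D * (\<integral>\<^sup>+y. H x y \<partial>lborel)" .
    have m0: "0 \<le> m c" for c by (simp add: m_def)
    have "ennreal \<bar>w x\<bar> = ennreal (\<bar>w x\<bar> * V) * ennreal (1 / V)"
      using V by (simp add: ennreal_mult[symmetric])
    also have "\<dots> \<le> (ennreal (m c) + (ennreal t * ennreal V + ennreal D * (\<integral>\<^sup>+y. H x y \<partial>lborel))) * ennreal (1 / V)"
    proof (rule mult_right_mono)
      have "ennreal (\<bar>w x\<bar> * V) \<le> ennreal (m c + (\<integral>y. \<bar>indicator Q y * w x - indicator Q y * w y\<bar> \<partial>lborel))"
        using 1 by (rule ennreal_leI)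
      also have "\<dots> = ennreal (m c) + ennreal (\<integral>y. \<bar>indicator Q y * w x - indicator Q y * w y\<bar> \<partial>lborel)"
        using m0 by (intro ennreal_plus) auto
      also have "\<dots> \<le> ennreal (m c) + (ennreal t * ennreal V + ennreal D * (\<integral>\<^sup>+y. H x y \<partial>lborel))"
        using 2 by (rule add_left_mono)
      finally show "ennreal (\<bar>w x\<bar> * V) \<le> ennreal (m c) + (ennreal t * ennreal V + ennreal D * (\<integral>\<^sup>+y. H x y \<partial>lborel))" .
    qed simp
    also have "\<dots> = ennreal (m c) * ennreal (1 / V) + ennreal t * (ennreal V * ennreal (1 / V)) +
        (ennreal D * ennreal (1 / V)) * (\<integral>\<^sup>+y. H x y \<partial>lborel)"
    proof -
      have "(A + (a * b + d * h)) * z = A * z + a * (b * z) + (d * z) * h" for A a b d h z :: ennreal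
        by (simp add: algebra_simps)
      then show ?thesis .
    qed
    also have "\<dots> = ennreal (m c / V) + ennreal t + ennreal (D / V) * (\<integral>\<^sup>+y. H x y \<partial>lborel)"
      using V D m0 by (simp add: ennreal_mult[symmetric])
    also have "\<dots> \<le> R x"
    proof -
      have "ennreal (m c / V) = (\<Sum>c\<in>{c}. ennreal (m c / V) * indicator (ball c \<epsilon>) x)" using c by simp
      also have "\<dots> \<le> (\<Sum>c\<in>F. ennreal (m c / V) * indicator (ball c \<epsilon>) x)"
        using F c by (intro sum_mono2) auto
      finally show ?thesis unfolding R_def using x by (intro add_mono) auto
    qed
    finally show ?thesis .
  qed
  have "ennreal (\<integral>x. \<bar>w x\<bar> \<partial>lborel) = (\<integral>\<^sup>+x. ennreal \<bar>w x\<bar> \<partial>lborel)"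
    using w by (intro nn_integral_eq_integral[symmetric]) auto
  also have "\<dots> \<le> (\<integral>\<^sup>+x. R x \<partial>lborel)"
  proof (rule nn_integral_mono_AE)
    show "AE x in lborel. ennreal \<bar>w x\<bar> \<le> R x"
      using w0 by eventually_elim (use key in fastforce)
  qed
  also have "\<dots> = (\<integral>\<^sup>+x. (\<Sum>c\<in>F. ennreal (m c / V) * indicator (ball c \<epsilon>) x) \<partial>lborel) +
      (\<integral>\<^sup>+x. ennreal t * indicator \<Omega> x \<partial>lborel) + (\<integral>\<^sup>+x. ennreal (D / V) * (\<integral>\<^sup>+y. H x y \<partial>lborel) \<partial>lborel)"
  proof -
    have 1: "(\<lambda>x. \<Sum>c\<in>F. ennreal (m c / V) * indicator (ball c \<epsilon>) x) \<in> borel_measurable lborel"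
      by (intro borel_measurable_sum borel_measurable_times_ennreal borel_measurable_const borel_measurable_indicator) simp
    have 2: "(\<lambda>x. ennreal t * indicator \<Omega> x) \<in> borel_measurable lborel"
      using \<Omega>(1) by (intro borel_measurable_times_ennreal borel_measurable_const borel_measurable_indicator) simp
    have 3: "(\<lambda>x. ennreal (D / V) * (\<integral>\<^sup>+y. H x y \<partial>lborel)) \<in> borel_measurable lborel"
      unfolding H_def by measurable
    show ?thesis unfolding R_def
      by (simp only: nn_integral_add 1 2 3 borel_measurable_add)
  qed
  also have "(\<integral>\<^sup>+x. (\<Sum>c\<in>F. ennreal (m c / V) * indicator (ball c \<epsilon>) x) \<partial>lborel) =
      (\<Sum>c\<in>F. ennreal (m c / V) * ennreal V)"
  proof (subst nn_integral_sum)
    show "(\<lambda>x. ennreal (m c / V) * indicator (ball c \<epsilon>) x) \<in> borel_measurable lborel" for c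
      by (intro borel_measurable_times_ennreal borel_measurable_const borel_measurable_indicator) simp
  qed (simp add: nn_integral_cmult_indicator vol)
  also have "\<dots> = (\<Sum>c\<in>F. ennreal (m c))"
    using V by (intro sum.cong) (auto simp: m_def ennreal_mult[symmetric])
  also have "\<dots> = ennreal (\<Sum>c\<in>F. m c)" by (rule sum_ennreal) (simp add: m_def)
  also have "(\<integral>\<^sup>+x. ennreal t * indicator \<Omega> x \<partial>lborel) = ennreal (t * measure lborel \<Omega>)"
    using \<Omega> t by (simp add: nn_integral_cmult_indicator emeasure_eq_ennreal_measure ennreal_mult)
  also have "(\<integral>\<^sup>+x. ennreal (D / V) * (\<integral>\<^sup>+y. H x y \<partial>lborel) \<partial>lborel) = ennreal (D / V * gagliardo_form s w w)"
  proof -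
    have "(\<integral>\<^sup>+x. ennreal (D / V) * (\<integral>\<^sup>+y. H x y \<partial>lborel) \<partial>lborel) = ennreal (D / V) * (\<integral>\<^sup>+x. (\<integral>\<^sup>+y. H x y \<partial>lborel) \<partial>lborel)"
      unfolding H_def by (rule nn_integral_cmult) measurable
    also have "(\<integral>\<^sup>+x. (\<integral>\<^sup>+y. H x y \<partial>lborel) \<partial>lborel) = (\<integral>\<^sup>+z. ennreal ((diff_quot s w z)\<^sup>2) \<partial>(lborel \<Otimes>\<^sub>M lborel))"
      unfolding H_def by (rule lborel.nn_integral_fst) measurable
    also have "\<dots> = ennreal (gagliardo_form s w w)"
      unfolding gagliardo_form_same using Dw by (intro nn_integral_eq_integral) auto
    also have "ennreal (D / V) * ennreal (gagliardo_form s w w) = ennreal (D / V * gagliardo_form s w w)"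
      using D V by (intro ennreal_mult[symmetric]) (auto simp: gagliardo_form_nonneg)
    finally show ?thesis .
  qed
  also have "ennreal (\<Sum>c\<in>F. m c) + ennreal (t * measure lborel \<Omega>) + ennreal (D / V * gagliardo_form s w w) =
      ennreal ((\<Sum>c\<in>F. m c) + t * measure lborel \<Omega> + D / V * gagliardo_form s w w)"
    using t D V by (simp add: sum_nonneg m_def gagliardo_form_nonneg)
  finally have "(\<integral>x. \<bar>w x\<bar> \<partial>lborel) \<le> (\<Sum>c\<in>F. m c) + t * measure lborel \<Omega> + D / V * gagliardo_form s w w"
    by (subst (asm) ennreal_le_iff) (use t D V in \<open>auto intro!: add_nonneg_nonneg sum_nonneg simp: m_def gagliardo_form_nonneg\<close>)
  moreover have "D / V = 2 powr (N + 2 * s) / \<omega> * \<epsilon> powr (2 * s) / t"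
    using \<epsilon> \<omega> t by (simp add: D_def V_def powr_mult powr_add mult_ac)
  ultimately show ?thesis by (simp add: m_def \<omega>_def N_def)
qed

text \<open>For every \<open>m\<close> the set \<open>\<Omega>\<close> is covered by finitely many balls of radius \<open>1 / (m + 1)\<close>. A diagonal subsequence makes
the means over all these countably many balls converge. By the previous estimate it is then
Cauchy in \<open>L\<^sup>1\<close>.\<close>

lemma X0_bounded_imp_AE_convergent_subseq:
  fixes u :: "nat \<Rightarrow> real ^ 'n \<Rightarrow> real"
  assumes s: "0 < s" and \<Omega>: "open \<Omega>" "bounded \<Omega>"
    and u: "\<And>k. u k \<in> X0 \<Omega> s" 
    and B: "\<And>k. (\<integral>x. (u k x)\<^sup>2 \<partial>lborel) \<le> B" "\<And>k. gagliardo_form s (u k) (u k) \<le> B"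
  obtains r g where "strict_mono r" "g \<in> borel_measurable lborel"
    "AE x in lborel. (\<lambda>k. u (r k) x) \<longlonglongrightarrow> g x"
proof -
  have [measurable]: "\<Omega> \<in> sets borel" using \<Omega> by simp
  have fin: "emeasure lborel \<Omega> < \<infinity>" using \<Omega> by (intro emeasure_bounded_finite)
  have [measurable]: "u k \<in> borel_measurable lborel" for k
    using u by (auto simp: X0_def frac_sobolev_iff)
  have u2: "integrable lborel (\<lambda>x. (u k x)\<^sup>2)" for k using u by (auto simp: X0_def frac_sobolev_iff)
  have u0: "AE x in lborel. x \<notin> \<Omega> \<longrightarrow> u k x = 0" for k using u by (auto simp: X0_def)
  have dom: "AE x in lborel. \<bar>u k x\<bar> \<le> indicator \<Omega> x + (u k x)\<^sup>2" for k
    using u0[of k]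
  proof eventually_elim
    case (elim x)
    have "0 \<le> (\<bar>u k x\<bar> - 1)\<^sup>2" by simp
    then have "2 * \<bar>u k x\<bar> \<le> 1 + (u k x)\<^sup>2" by (simp add: power2_eq_square algebra_simps)
    then have "\<bar>u k x\<bar> \<le> 1 + (u k x)\<^sup>2" by linarith
    then show ?case using elim by (cases "x \<in> \<Omega>") auto
  qed
  have dom_int: "integrable lborel (\<lambda>x. indicator \<Omega> x + (u k x)\<^sup>2 :: real)" for k
    using fin u2 by simp
  have int: "integrable lborel (u k)" for k
    by (rule Bochner_Integration.integrable_bound[OF dom_int[of k]]) (use dom[of k] in auto)
  define M where "M = measure lborel \<Omega> + B"
  have L1: "(\<integral>x. \<bar>u k x\<bar> \<partial>lborel) \<le> M" for k
  proof -
    have "(\<integral>x. \<bar>u k x\<bar> \<partial>lborel) \<le> (\<integral>x. indicator \<Omega> x + (u k x)\<^sup>2 \<partial>lborel)"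
      using dom[of k] dom_int[of k] int by (intro integral_mono_AE) auto
    also have "\<dots> \<le> M" using fin u2 B(1)[of k] by (simp add: M_def)
    finally show ?thesis .
  qed
  have "\<exists>F. \<forall>m::nat. finite (F m) \<and> \<Omega> \<subseteq> (\<Union>c\<in>F m. ball c (1 / Suc m))"
  proof (rule choice, rule allI)
    fix m :: nat
    have "compact (closure \<Omega>)" using \<Omega> by simp
    then have "\<exists>F. finite F \<and> closure \<Omega> \<subseteq> (\<Union>c\<in>F. ball c (1 / Suc m))"
      unfolding compact_eq_totally_bounded by simp
    then obtain F where "finite F" "closure \<Omega> \<subseteq> (\<Union>c\<in>F. ball c (1 / Suc m))" by blast
    then show "\<exists>F. finite F \<and> \<Omega> \<subseteq> (\<Union>c\<in>F. ball c (1 / Suc m))"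
      using closure_subset by blast
  qed
  then obtain F :: "nat \<Rightarrow> (real ^ 'n) set"
    where F: "\<And>m. finite (F m)" "\<And>m. \<Omega> \<subseteq> (\<Union>c\<in>F m. ball c (1 / Suc m))" by blast
  define a where "a k mc = (\<integral>x. indicator (ball (snd mc) (1 / Suc (fst mc))) x * u k x \<partial>lborel)"
    for k and mc :: "nat \<times> (real ^ 'n)"
  have ball_int: "integrable lborel (\<lambda>x. indicator (ball c e) x * u k x)" for c e k
    using integrable_mult_indicator[of "ball c e" lborel "u k"] int by simp
  have a_bound: "norm (a k mc) \<le> M" for k mc
  proof -
    have "\<bar>a k mc\<bar> \<le> (\<integral>x. \<bar>indicator (ball (snd mc) (1 / Suc (fst mc))) x * u k x\<bar> \<partial>lborel)"
      unfolding a_def by (rule integral_abs_bound)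
    also have "\<dots> \<le> (\<integral>x. \<bar>u k x\<bar> \<partial>lborel)"
      using int ball_int by (intro integral_mono integrable_abs) (auto simp: indicator_def)
    finally show ?thesis using L1[of k] by simp
  qed
  have cS: "countable (SIGMA m:UNIV. F m)" using F(1) by (intro countable_SIGMA) (auto intro: countable_finite)
  obtain r where r: "strict_mono r"
    and conv: "\<And>mc. mc \<in> (SIGMA m:UNIV. F m) \<Longrightarrow> \<exists>l. (\<lambda>k. a (r k) mc) \<longlonglongrightarrow> l"
    by (rule function_convergent_subsequence[where f = a, OF cS a_bound], rule that) blast+
  define L where "L mc = lim (\<lambda>k. a (r k) mc)" for mc
  have L: "(\<lambda>k. a (r k) (m, c)) \<longlonglongrightarrow> L (m, c)" if "c \<in> F m" for m c
  proof -
    have "convergent (\<lambda>k. a (r k) (m, c))" using conv[of "(m, c)"] that by (simp add: convergent_def)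
    then show ?thesis unfolding L_def by (simp only: convergent_LIMSEQ_iff)
  qed
  have Cauchy: "\<exists>K. \<forall>k\<ge>K. \<forall>l\<ge>K. (\<integral>x. \<bar>u (r k) x - u (r l) x\<bar> \<partial>lborel) < e" if e: "0 < e" for e
  proof -
    define V where "V = measure lborel \<Omega>"
    have V: "0 \<le> V" by (simp add: V_def)
    define t where "t = e / (4 * (V + 1))"
    have t: "0 < t" using e V by (simp add: t_def)
    have "t * V \<le> t * (V + 1)" using t by simp
    also have "t * (V + 1) = e / 4" using V by (simp add: t_def field_simps)
    finally have tV: "t * V \<le> e / 4" .
    define C where "C = 2 powr (real CARD('n) + 2 * s) / unit_ball_vol (real CARD('n)) / t * (4 * B)"
    have B0: "0 \<le> B" using B(2)[of 0] gagliardo_form_nonneg[of s "u 0"] by linarith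
    have "(\<lambda>m. 1 / real (Suc m)) \<longlonglongrightarrow> 0"
      using LIMSEQ_inverse_real_of_nat by (simp add: inverse_eq_divide)
    then have "(\<lambda>m. (1 / real (Suc m)) powr (2 * s)) \<longlonglongrightarrow> 0 powr (2 * s)"
      using s by (intro tendsto_powr'[OF _ tendsto_const]) auto
    then have "(\<lambda>m. (1 / real (Suc m)) powr (2 * s) * C) \<longlonglongrightarrow> 0 powr (2 * s) * C"
      by (rule tendsto_mult_right)
    then have C0: "(\<lambda>m. (1 / real (Suc m)) powr (2 * s) * C) \<longlonglongrightarrow> 0" by simp
    have "\<forall>\<^sub>F m in sequentially. (1 / real (Suc m)) powr (2 * s) * C < e / 4"
      by (rule order_tendstoD(2)[OF C0]) (use e in simp)
    then obtain m where m: "(1 / real (Suc m)) powr (2 * s) * C < e / 4"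
      unfolding eventually_sequentially by blast
    have "(\<lambda>k. \<bar>a (r k) (m, c) - L (m, c)\<bar>) \<longlonglongrightarrow> 0" if "c \<in> F m" for c
      using L[OF that] by (simp add: tendsto_rabs_zero_iff LIM_zero_iff)
    then have L0: "(\<lambda>k. \<Sum>c\<in>F m. \<bar>a (r k) (m, c) - L (m, c)\<bar>) \<longlonglongrightarrow> 0"
      by (rule tendsto_null_sum)
    have "\<forall>\<^sub>F k in sequentially. (\<Sum>c\<in>F m. \<bar>a (r k) (m, c) - L (m, c)\<bar>) < e / 4"
      by (rule order_tendstoD(2)[OF L0]) (use e in simp)
    then obtain K where K: "\<And>k. k \<ge> K \<Longrightarrow> (\<Sum>c\<in>F m. \<bar>a (r k) (m, c) - L (m, c)\<bar>) < e / 4"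
      unfolding eventually_sequentially by blast
    have "(\<integral>x. \<bar>u (r k) x - u (r l) x\<bar> \<partial>lborel) < e" if kl: "k \<ge> K" "l \<ge> K" for k l
    proof -
      define w where "w x = u (r k) x + (- 1) * u (r l) x" for x
      have wX: "w \<in> X0 \<Omega> s" unfolding w_def[abs_def] by (intro X0_linear u)
      have wi: "integrable lborel w" unfolding w_def[abs_def] using int by simp
      \<comment> \<open>the parallelogram law: \<open>[a - b]\<^sup>2 + [a + b]\<^sup>2 = 2 [a]\<^sup>2 + 2 [b]\<^sup>2\<close>\<close>
      have "gagliardo_form s w w \<le> 2 * gagliardo_form s (u (r k)) (u (r k)) + 2 * gagliardo_form s (u (r l)) (u (r l))"
      proof -
        have "0 \<le> gagliardo_form s (\<lambda>x. u (r k) x + 1 * u (r l) x) (\<lambda>x. u (r k) x + 1 * u (r l) x)"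
          by (rule gagliardo_form_nonneg)
        then show ?thesis
          unfolding w_def[abs_def] gagliardo_form_expand[OF u[of "r k"] u[of "r l"]] by simp
      qed
      also have "\<dots> \<le> 4 * B" using B(2)[of "r k"] B(2)[of "r l"] by simp
      finally have wB: "gagliardo_form s w w \<le> 4 * B" .
      have "(\<integral>x. \<bar>w x\<bar> \<partial>lborel) \<le> (\<Sum>c\<in>F m. \<bar>\<integral>x. indicator (ball c (1 / Suc m)) x * w x \<partial>lborel\<bar>) +
          t * measure lborel \<Omega> + 2 powr (real CARD('n) + 2 * s) / unit_ball_vol (real CARD('n)) *
            (1 / Suc m) powr (2 * s) / t * gagliardo_form s w w"
        by (rule L1_le_ball_means[OF s _ fin F(1) F(2) _ t wi])
          (use wX in \<open>simp_all add: X0_def frac_sobolev_iff\<close>)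
      also have "(\<Sum>c\<in>F m. \<bar>\<integral>x. indicator (ball c (1 / Suc m)) x * w x \<partial>lborel\<bar>) < e / 2"
      proof -
        have "(\<integral>x. indicator (ball c (1 / Suc m)) x * w x \<partial>lborel) = a (r k) (m, c) - a (r l) (m, c)" for c
          unfolding a_def w_def using ball_int by (simp add: algebra_simps)
        then have "(\<Sum>c\<in>F m. \<bar>\<integral>x. indicator (ball c (1 / Suc m)) x * w x \<partial>lborel\<bar>) =
            (\<Sum>c\<in>F m. \<bar>a (r k) (m, c) - a (r l) (m, c)\<bar>)" by simp
        also have "\<dots> \<le> (\<Sum>c\<in>F m. \<bar>a (r k) (m, c) - L (m, c)\<bar> + \<bar>a (r l) (m, c) - L (m, c)\<bar>)"
          by (intro sum_mono) linarith
        also have "\<dots> < e / 4 + e / 4" unfolding sum.distrib using K[OF kl(1)] K[OF kl(2)] by linarith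
        finally show ?thesis by simp
      qed
      also have "2 powr (real CARD('n) + 2 * s) / unit_ball_vol (real CARD('n)) *
            (1 / Suc m) powr (2 * s) / t * gagliardo_form s w w \<le> (1 / Suc m) powr (2 * s) * C"
      proof -
        have "2 powr (real CARD('n) + 2 * s) / unit_ball_vol (real CARD('n)) *
            (1 / Suc m) powr (2 * s) / t * gagliardo_form s w w \<le>
            2 powr (real CARD('n) + 2 * s) / unit_ball_vol (real CARD('n)) *
            (1 / Suc m) powr (2 * s) / t * (4 * B)"
          using wB t by (intro mult_left_mono) auto
        then show ?thesis by (simp add: C_def mult_ac)
      qed
      also have "(1 / Suc m) powr (2 * s) * C < e / 4" by (rule m)
      finally have "(\<integral>x. \<bar>w x\<bar> \<partial>lborel) < e / 2 + t * V + e / 4" by (simp add: V_def)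
      then show ?thesis using tV by (simp add: w_def)
    qed
    then show ?thesis by blast
  qed
  obtain r' g where r': "strict_mono r'" "g \<in> borel_measurable lborel"
    "AE x in lborel. (\<lambda>k. u (r (r' k)) x) \<longlonglongrightarrow> g x"
    by (rule L1_Cauchy_imp_AE_convergent_subseq[of lborel "\<lambda>k. u (r k)", OF int Cauchy]) auto
  show ?thesis
  proof (rule that)
    show "strict_mono (r \<circ> r')" using r r'(1) by (rule strict_mono_o)
    show "AE x in lborel. (\<lambda>k. u ((r \<circ> r') k) x) \<longlonglongrightarrow> g x" using r'(3) by (simp only: o_apply)
  qed (rule r'(2))
qed

section \<open>Minimization on a small ball\<close>

lemma AE_lborel_pair:
  fixes P :: "'a::euclidean_space \<Rightarrow> bool"
  assumes "AE x in lborel. P x"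
  shows "AE z in lborel \<Otimes>\<^sub>M lborel. P (fst z) \<and> P (snd z)"
proof -
  obtain N where N: "N \<in> null_sets lborel" "{x \<in> space lborel. \<not> P x} \<subseteq> N"
    using assms by (auto simp: eventually_ae_filter)
  have "N \<times> (UNIV :: 'a set) \<in> null_sets (lborel \<Otimes>\<^sub>M lborel)" "(UNIV :: 'a set) \<times> N \<in> null_sets (lborel \<Otimes>\<^sub>M lborel)"
    using N(1) by (auto simp: null_sets_def lborel.emeasure_pair_measure_Times)
  then have "N \<times> UNIV \<union> UNIV \<times> N \<in> null_sets (lborel \<Otimes>\<^sub>M lborel)" by (rule null_sets.Un)
  then show ?thesis by (rule AE_I') (use N(2) in auto)
qed

text \<open>Energy bounds survive almost everywhere convergence, and the Gagliardo form splits into the parts of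
the limit and of the difference. This is the Brezis-Lieb lemma with exponent \<open>2\<close> for the difference quotients.\<close>

lemma X0_AE_limit:
  fixes u :: "nat \<Rightarrow> real ^ 'n \<Rightarrow> real"
  assumes u: "\<And>k. u k \<in> X0 \<Omega> s"
    and B: "\<And>k. (\<integral>x. (u k x)\<^sup>2 \<partial>lborel) \<le> B" "\<And>k. gagliardo_form s (u k) (u k) \<le> A"
    and [measurable]: "g \<in> borel_measurable lborel"
    and conv: "AE x in lborel. (\<lambda>k. u k x) \<longlonglongrightarrow> g x"
  shows "g \<in> X0 \<Omega> s" "gagliardo_form s g g \<le> A"
    "(\<lambda>k. gagliardo_form s (u k) (u k) - gagliardo_form s (\<lambda>x. u k x + (- 1) * g x) (\<lambda>x. u k x + (- 1) * g x))
      \<longlonglongrightarrow> gagliardo_form s g g"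
proof -
  have [measurable]: "u k \<in> borel_measurable lborel" for k using u by (auto simp: X0_def frac_sobolev_iff)
  have sq: "\<bar>x\<bar> powr 2 = x\<^sup>2" for x :: real by (cases "x = 0") (auto simp: powr_numeral)
  have Du: "integrable (lborel \<Otimes>\<^sub>M lborel) (\<lambda>z. \<bar>diff_quot s (u k) z\<bar> powr 2)" for k
    using u[of k] by (auto simp: X0_def frac_sobolev_iff sq)
  have DB: "(\<integral>z. \<bar>diff_quot s (u k) z\<bar> powr 2 \<partial>(lborel \<Otimes>\<^sub>M lborel)) \<le> A" for k
    using B(2)[of k] by (simp add: sq gagliardo_form_same)
  have Dconv: "AE z in lborel \<Otimes>\<^sub>M lborel. (\<lambda>k. diff_quot s (u k) z) \<longlonglongrightarrow> diff_quot s g z"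
    using AE_lborel_pair[OF conv]
  proof eventually_elim
    case (elim z)
    then show ?case unfolding diff_quot_def case_prod_beta divide_inverse by (intro tendsto_intros) auto
  qed
  note bl = brezis_lieb[where p = 2 and f = "\<lambda>k. diff_quot s (u k)" and g = "diff_quot s g" and M = "lborel \<Otimes>\<^sub>M lborel",
      OF _ _ _ Du DB Dconv, unfolded sq]
  have Dg: "integrable (lborel \<Otimes>\<^sub>M lborel) (\<lambda>z. (diff_quot s g z)\<^sup>2)" by (rule bl(1)) auto
  show "gagliardo_form s g g \<le> A" unfolding gagliardo_form_same by (rule bl(2)) auto
  show "(\<lambda>k. gagliardo_form s (u k) (u k) - gagliardo_form s (\<lambda>x. u k x + (- 1) * g x) (\<lambda>x. u k x + (- 1) * g x))
      \<longlonglongrightarrow> gagliardo_form s g g"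
    unfolding gagliardo_form_same diff_quot_linear using bl(3) by simp
  have "integrable lborel (\<lambda>x. (g x)\<^sup>2)"
  proof (rule integral_fatou(1)[OF _ _ _ B(1)])
    show "integrable lborel (\<lambda>x. (u k x)\<^sup>2)" for k using u[of k] by (auto simp: X0_def frac_sobolev_iff)
    show "AE x in lborel. (\<lambda>k. (u k x)\<^sup>2) \<longlonglongrightarrow> (g x)\<^sup>2"
      using conv by eventually_elim (rule tendsto_power)
  qed auto
  moreover have "AE x in lborel. x \<notin> \<Omega> \<longrightarrow> g x = 0"
  proof -
    have "AE x in lborel. \<forall>k. x \<notin> \<Omega> \<longrightarrow> u k x = 0"
      unfolding AE_all_countable using u by (auto simp: X0_def)
    then show ?thesis using conv
    proof eventually_elim
      case (elim x)
      show ?case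
      proof
        assume "x \<notin> \<Omega>"
        then have "(\<lambda>k. u k x) = (\<lambda>k. 0)" using elim by auto
        then show "g x = 0" using elim by (simp add: LIMSEQ_const_iff)
      qed
    qed
  qed
  ultimately show "g \<in> X0 \<Omega> s" using Dg by (simp add: X0_def frac_sobolev_iff)
qed

lemma X0_L2_bound:
  fixes u :: "real ^ 'n \<Rightarrow> real"
  assumes \<Omega>: "\<Omega> \<in> sets borel" "emeasure lborel \<Omega> < \<infinity>" and p: "2 \<le> p"
    and u: "u \<in> X0 \<Omega> s" and up: "integrable lborel (\<lambda>x. \<bar>u x\<bar> powr p)"
  shows "(\<integral>x. (u x)\<^sup>2 \<partial>lborel) \<le> measure lborel \<Omega> + (\<integral>x. \<bar>u x\<bar> powr p \<partial>lborel)"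
proof -
  have "(\<integral>x. (u x)\<^sup>2 \<partial>lborel) \<le> (\<integral>x. indicator \<Omega> x + \<bar>u x\<bar> powr p \<partial>lborel)"
  proof (rule integral_mono_AE)
    show "integrable lborel (\<lambda>x. (u x)\<^sup>2)" using u by (auto simp: X0_def frac_sobolev_iff)
    show "integrable lborel (\<lambda>x. indicator \<Omega> x + \<bar>u x\<bar> powr p)" using \<Omega> up by simp
    have "AE x in lborel. x \<notin> \<Omega> \<longrightarrow> u x = 0" using u by (simp add: X0_def)
    then show "AE x in lborel. (u x)\<^sup>2 \<le> indicator \<Omega> x + \<bar>u x\<bar> powr p"
    proof eventually_elim
      case (elim x)
      have "\<bar>u x\<bar> powr 2 \<le> 1 + \<bar>u x\<bar> powr p" using p by (intro le_one_plus_powr) auto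
      then have "(u x)\<^sup>2 \<le> 1 + \<bar>u x\<bar> powr p" by (cases "u x = 0") (auto simp: powr_numeral)
      then show ?case using elim by (cases "x \<in> \<Omega>") auto
    qed
  qed
  also have "\<dots> = measure lborel \<Omega> + (\<integral>x. \<bar>u x\<bar> powr p \<partial>lborel)" using \<Omega> up by simp
  finally show ?thesis .
qed

text \<open>The energy whose critical points are the weak solutions of the equation with right-hand side
\<open>F'(u)\<close>.\<close>

definition energy :: "(real ^ 'n) set \<Rightarrow> real \<Rightarrow> (real \<Rightarrow> real) \<Rightarrow> (real ^ 'n \<Rightarrow> real) \<Rightarrow> real" where
  "energy \<Omega> s F u = gagliardo_form s u u / 2 - (\<integral>x. F (u x) \<partial>restrict_space lborel \<Omega>)"

lemma restrict_space_powr: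
  fixes u :: "real ^ 'n \<Rightarrow> real"
  assumes \<Omega>: "\<Omega> \<in> sets borel" and u: "integrable lborel (\<lambda>x. \<bar>u x\<bar> powr p)"
  shows "integrable (restrict_space lborel \<Omega>) (\<lambda>x. \<bar>u x\<bar> powr p)"
    "(\<integral>x. \<bar>u x\<bar> powr p \<partial>restrict_space lborel \<Omega>) \<le> (\<integral>x. \<bar>u x\<bar> powr p \<partial>lborel)"
proof -
  have i: "integrable lborel (\<lambda>x. indicator \<Omega> x *\<^sub>R \<bar>u x\<bar> powr p)"
    using \<Omega> u by (intro integrable_mult_indicator) auto
  then show "integrable (restrict_space lborel \<Omega>) (\<lambda>x. \<bar>u x\<bar> powr p)"
    using \<Omega> by (subst integrable_restrict_space) auto
  have "(\<integral>x. \<bar>u x\<bar> powr p \<partial>restrict_space lborel \<Omega>) = (\<integral>x. indicator \<Omega> x *\<^sub>R \<bar>u x\<bar> powr p \<partial>lborel)"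
    using \<Omega> by (subst integral_restrict_space) auto
  also have "\<dots> \<le> (\<integral>x. \<bar>u x\<bar> powr p \<partial>lborel)"
    using i u by (intro integral_mono) (auto simp: indicator_def)
  finally show "(\<integral>x. \<bar>u x\<bar> powr p \<partial>restrict_space lborel \<Omega>) \<le> (\<integral>x. \<bar>u x\<bar> powr p \<partial>lborel)" .
qed

lemma finite_measure_restrict_lborel:
  fixes \<Omega> :: "(real ^ 'n) set"
  assumes "\<Omega> \<in> sets borel" "emeasure lborel \<Omega> < \<infinity>"
  shows "finite_measure (restrict_space lborel \<Omega>)"
  using assms by (intro finite_measureI) (auto simp: emeasure_restrict_space space_restrict_space)

text \<open>On a small ball the Sobolev bound for \<open>\<integral> |u|^p\<close> is at most \<open>[u]\<^sup>2\<close>. In applications \<open>A = [u]\<^sup>2\<close>.\<close>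

lemma sobolev_bound_absorbed_on_small_ball:
  fixes A R S p :: real
  assumes "0 \<le> A" "A \<le> R\<^sup>2" "0 \<le> R" "2 < p" "0 \<le> S" "S * R powr (p - 2) \<le> 1"
  shows "S * A powr (p / 2) \<le> A"
proof (cases "A = 0")
  case False
  then have A: "0 < A" using assms by simp
  have "A powr (p / 2) = A powr (p / 2 - 1) * A"
    using A by (simp add: powr_diff)
  moreover have "A powr (p / 2 - 1) \<le> (R\<^sup>2) powr (p / 2 - 1)" using assms A by (intro powr_mono2) auto
  moreover have "(R\<^sup>2) powr (p / 2 - 1) = R powr (p - 2)"
  proof (cases "R = 0")
    case False
    then have "R\<^sup>2 = R powr 2" using assms by (simp add: powr_numeral)
    then show ?thesis by (simp add: powr_powr algebra_simps)
  qed simp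
  ultimately have "A powr (p / 2) \<le> R powr (p - 2) * A" using A by (simp add: mult_right_mono)
  then have "S * A powr (p / 2) \<le> S * (R powr (p - 2) * A)" using assms by (intro mult_left_mono) auto
  also have "\<dots> = (S * R powr (p - 2)) * A" by simp
  also have "\<dots> \<le> 1 * A" using assms A by (intro mult_right_mono) auto
  finally show ?thesis by simp
qed simp

text \<open>The direct method. Lower semicontinuity along the minimizing sequence does not come from compactness,
which fails for the exponent \<open>p\<close>. It comes from the splitting
\<open>E(u k) = E(g) + E\<^sub>0(u k - g) + o(1)\<close> together with \<open>E\<^sub>0(w) = [w]\<^sup>2 / 2 - \<integral> |w|^p / p \<ge> 0\<close> for \<open>[w] \<le> 2 \<rho>\<close>. The
radius \<open>2 \<rho>\<close> in the smallness condition is there because \<open>u k - g\<close> is a difference of two elements of the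
ball of radius \<open>\<rho>\<close>.\<close>

lemma energy_minimizer_exists:
  fixes \<Omega> :: "(real ^ 'n) set"
  assumes s: "0 < s" and \<Omega>: "open \<Omega>" "bounded \<Omega>" and p: "2 < p" and S: "0 < S"
    and sob_int: "\<And>u :: real ^ 'n \<Rightarrow> real. u \<in> X0 \<Omega> s \<Longrightarrow> integrable lborel (\<lambda>x. \<bar>u x\<bar> powr p)"
    and sob: "\<And>u :: real ^ 'n \<Rightarrow> real. u \<in> X0 \<Omega> s \<Longrightarrow>
       (\<integral>x. \<bar>u x\<bar> powr p \<partial>lborel) \<le> S * gagliardo_form s u u powr (p / 2)"
    and \<rho>: "0 < \<rho>" "S * (2 * \<rho>) powr (p - 2) \<le> 1"
    and G: "continuous_on UNIV G"
    and small: "\<And>\<epsilon>. 0 < \<epsilon> \<Longrightarrow> \<exists>C. \<forall>t. \<bar>G t\<bar> \<le> \<epsilon> * \<bar>t\<bar> powr p + C"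
    and F: "F = (\<lambda>t. \<bar>t\<bar> powr p / p + \<mu> * G t)"
  obtains u where "u \<in> X0 \<Omega> s" "gagliardo_form s u u \<le> \<rho>\<^sup>2"
    "\<And>v. v \<in> X0 \<Omega> s \<Longrightarrow> gagliardo_form s v v \<le> \<rho>\<^sup>2 \<Longrightarrow> energy \<Omega> s F u \<le> energy \<Omega> s F v"
proof -
  define M where "M = restrict_space lborel \<Omega>"
  have \<Omega>b: "\<Omega> \<in> sets borel" using \<Omega> by simp
  have fin: "emeasure lborel \<Omega> < \<infinity>" using \<Omega> by (intro emeasure_bounded_finite)
  have finM: "finite_measure M" unfolding M_def using \<Omega>b fin by (rule finite_measure_restrict_lborel)
  interpret M: finite_measure M by (rule finM)
  have [measurable]: "G \<in> borel_measurable borel" using G by (rule borel_measurable_continuous_onI)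
  define K where "K = {u \<in> X0 \<Omega> s. gagliardo_form s u u \<le> \<rho>\<^sup>2}"
  have meas: "u \<in> borel_measurable lborel" "u \<in> borel_measurable M" if "u \<in> X0 \<Omega> s" for u
  proof -
    show "u \<in> borel_measurable lborel" using that by (auto simp: X0_def frac_sobolev_iff)
    then show "u \<in> borel_measurable M" unfolding M_def by (rule measurable_restrict_space1)
  qed
  have pM: "integrable M (\<lambda>x. \<bar>u x\<bar> powr p)"
    and pMle: "(\<integral>x. \<bar>u x\<bar> powr p \<partial>M) \<le> S * gagliardo_form s u u powr (p / 2)" if "u \<in> X0 \<Omega> s" for u
    using restrict_space_powr[OF \<Omega>b sob_int[OF that]] sob[OF that] by (auto simp: M_def)
  have GM: "integrable M (\<lambda>x. G (u x))" if "u \<in> X0 \<Omega> s" for u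
  proof -
    obtain C where C: "\<And>t. \<bar>G t\<bar> \<le> 1 * \<bar>t\<bar> powr p + C" using small[of 1] by auto
    have [measurable]: "u \<in> borel_measurable M" using meas that by auto
    show ?thesis
    proof (rule Bochner_Integration.integrable_bound)
      show "integrable M (\<lambda>x. 1 * \<bar>u x\<bar> powr p + C)" using pM[OF that] by simp
      show "AE x in M. norm (G (u x)) \<le> norm (1 * \<bar>u x\<bar> powr p + C)"
      proof (rule AE_I2)
        fix x show "norm (G (u x)) \<le> norm (1 * \<bar>u x\<bar> powr p + C)" using C[of "u x"] by auto
      qed
    qed measurable
  qed
  have E_eq: "energy \<Omega> s F u = gagliardo_form s u u / 2 - (\<integral>x. \<bar>u x\<bar> powr p \<partial>M) / p - \<mu> * (\<integral>x. G (u x) \<partial>M)"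
    if "u \<in> X0 \<Omega> s" for u
    unfolding energy_def F M_def[symmetric] using pM[OF that] GM[OF that] by simp
  have K_p: "(\<integral>x. \<bar>u x\<bar> powr p \<partial>lborel) \<le> \<rho>\<^sup>2" "(\<integral>x. \<bar>u x\<bar> powr p \<partial>M) \<le> \<rho>\<^sup>2" if "u \<in> K" for u
  proof -
    have u: "u \<in> X0 \<Omega> s" "gagliardo_form s u u \<le> \<rho>\<^sup>2" using that by (auto simp: K_def)
    have "\<rho>\<^sup>2 \<le> (2 * \<rho>)\<^sup>2" using \<rho> by (intro power_mono) auto
    then have "gagliardo_form s u u \<le> (2 * \<rho>)\<^sup>2" using u(2) by linarith
    then have "S * gagliardo_form s u u powr (p / 2) \<le> gagliardo_form s u u"
      using \<rho> p S by (intro sobolev_bound_absorbed_on_small_ball[of _ "2 * \<rho>"]) (auto simp: gagliardo_form_nonneg)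
    then show "(\<integral>x. \<bar>u x\<bar> powr p \<partial>lborel) \<le> \<rho>\<^sup>2" "(\<integral>x. \<bar>u x\<bar> powr p \<partial>M) \<le> \<rho>\<^sup>2"
      using sob[OF u(1)] pMle[OF u(1)] u(2) by linarith+
  qed
  have bdd: "bdd_below (energy \<Omega> s F ` K)"
  proof -
    obtain C where C: "\<And>t. \<bar>G t\<bar> \<le> 1 * \<bar>t\<bar> powr p + C" using small[of 1] by auto
    define b where "b = - (\<rho>\<^sup>2 / p) - \<bar>\<mu>\<bar> * (\<rho>\<^sup>2 + C * measure M (space M))"
    have "b \<le> energy \<Omega> s F u" if "u \<in> K" for u
    proof -
      have u: "u \<in> X0 \<Omega> s" using that by (auto simp: K_def)
      have "\<bar>\<integral>x. G (u x) \<partial>M\<bar> \<le> (\<integral>x. \<bar>G (u x)\<bar> \<partial>M)" by (rule integral_abs_bound)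
      also have "\<dots> \<le> (\<integral>x. \<bar>u x\<bar> powr p + C \<partial>M)"
        using C GM[OF u] pM[OF u] by (intro integral_mono) auto
      also have "\<dots> = (\<integral>x. \<bar>u x\<bar> powr p \<partial>M) + C * measure M (space M)" using pM[OF u] by simp
      also have "\<dots> \<le> \<rho>\<^sup>2 + C * measure M (space M)" using K_p[OF that] by simp
      finally have "\<bar>\<mu>\<bar> * \<bar>\<integral>x. G (u x) \<partial>M\<bar> \<le> \<bar>\<mu>\<bar> * (\<rho>\<^sup>2 + C * measure M (space M))"
        by (intro mult_left_mono) auto
      then have "\<mu> * (\<integral>x. G (u x) \<partial>M) \<le> \<bar>\<mu>\<bar> * (\<rho>\<^sup>2 + C * measure M (space M))"
        unfolding abs_mult[symmetric] by linarith
      moreover have "(\<integral>x. \<bar>u x\<bar> powr p \<partial>M) / p \<le> \<rho>\<^sup>2 / p" using K_p(2)[OF that] p by (simp add: divide_right_mono)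
      moreover have "0 \<le> gagliardo_form s u u" by (rule gagliardo_form_nonneg)
      ultimately show ?thesis unfolding E_eq[OF u] b_def by linarith
    qed
    then show ?thesis by (auto simp: bdd_below_def)
  qed
  have "(\<lambda>x. 0) \<in> K"
    by (simp add: K_def X0_def frac_sobolev_iff gagliardo_form_same diff_quot_def case_prod_beta)
  then have ne: "energy \<Omega> s F ` K \<noteq> {}" by auto
  define I where "I = Inf (energy \<Omega> s F ` K)"
  have I_le: "I \<le> energy \<Omega> s F v" if "v \<in> K" for v
    unfolding I_def using bdd that by (intro cInf_lower) auto
  have "\<exists>v. v \<in> K \<and> energy \<Omega> s F v < I + 1 / Suc k" for k
    using cInf_lessD[OF ne, of "I + 1 / Suc k"] by (auto simp: I_def)
  then obtain v where v: "\<And>k. v k \<in> K" "\<And>k. energy \<Omega> s F (v k) < I + 1 / Suc k" by metis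
  have E_lim: "(\<lambda>k. energy \<Omega> s F (v k)) \<longlonglongrightarrow> I"
  proof (rule tendsto_sandwich[OF _ _ tendsto_const])
    show "(\<lambda>k. I + 1 / Suc k) \<longlonglongrightarrow> I"
      using tendsto_add[OF tendsto_const[of I] LIMSEQ_inverse_real_of_nat] by (simp add: inverse_eq_divide)
  qed (use v I_le in \<open>auto intro!: always_eventually less_imp_le\<close>)
  have vX: "v k \<in> X0 \<Omega> s" and vA: "gagliardo_form s (v k) (v k) \<le> \<rho>\<^sup>2" for k
    using v(1)[of k] by (auto simp: K_def)
  define B where "B = measure lborel \<Omega> + \<rho>\<^sup>2"
  have vB: "(\<integral>x. (v k x)\<^sup>2 \<partial>lborel) \<le> B" "gagliardo_form s (v k) (v k) \<le> B" for k
  proof -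
    show "(\<integral>x. (v k x)\<^sup>2 \<partial>lborel) \<le> B"
      using X0_L2_bound[OF \<Omega>b fin _ vX sob_int[OF vX], of k] K_p(1)[OF v(1)[of k]] p by (simp add: B_def)
    show "gagliardo_form s (v k) (v k) \<le> B" using vA[of k] by (simp add: B_def add_increasing)
  qed
  obtain r g where r: "strict_mono r" and [measurable]: "g \<in> borel_measurable lborel"
    and conv: "AE x in lborel. (\<lambda>k. v (r k) x) \<longlonglongrightarrow> g x"
    by (rule X0_bounded_imp_AE_convergent_subseq[OF s \<Omega> vX vB])
  define u where "u k = v (r k)" for k
  have uX: "u k \<in> X0 \<Omega> s" and uA: "gagliardo_form s (u k) (u k) \<le> \<rho>\<^sup>2" and uK: "u k \<in> K"
    and uB: "(\<integral>x. (u k x)\<^sup>2 \<partial>lborel) \<le> B" for k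
    using vX vA v(1) vB by (auto simp: u_def)
  have uconv: "AE x in lborel. (\<lambda>k. u k x) \<longlonglongrightarrow> g x" using conv by (simp add: u_def)
  have "g \<in> borel_measurable lborel" by simp
  note lim = X0_AE_limit[OF uX uB uA this uconv]
  have gX: "g \<in> X0 \<Omega> s" and gA: "gagliardo_form s g g \<le> \<rho>\<^sup>2" using lim by auto
  have convM: "AE x in M. (\<lambda>k. u k x) \<longlonglongrightarrow> g x"
  proof -
    have "AE x in lborel. x \<in> \<Omega> \<longrightarrow> (\<lambda>k. u k x) \<longlonglongrightarrow> g x" using uconv by eventually_elim simp
    then show ?thesis unfolding M_def using \<Omega>b by (subst AE_restrict_space_iff) auto
  qed
  define w where "w k = (\<lambda>x. u k x + (- 1) * g x)" for k
  have wX: "w k \<in> X0 \<Omega> s" for k unfolding w_def by (rule X0_linear[OF uX gX])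
  have p1: "1 \<le> p" using p by simp
  have p_lim: "(\<lambda>k. (\<integral>x. \<bar>u k x\<bar> powr p \<partial>M) - (\<integral>x. \<bar>w k x\<bar> powr p \<partial>M)) \<longlonglongrightarrow> (\<integral>x. \<bar>g x\<bar> powr p \<partial>M)"
    using brezis_lieb(3)[OF p1 meas(2)[OF uX] meas(2)[OF gX] pM[OF uX] K_p(2)[OF uK] convM]
    by (simp add: w_def)
  have G_lim: "(\<lambda>k. \<integral>x. G (u k x) \<partial>M) \<longlonglongrightarrow> (\<integral>x. G (g x) \<partial>M)"
    by (rule tendsto_integral_subcritical[OF finM p1 G small meas(2)[OF uX] meas(2)[OF gX] pM[OF uX] K_p(2)[OF uK] convM])
  have d_lim: "(\<lambda>k. gagliardo_form s (u k) (u k) - gagliardo_form s (w k) (w k)) \<longlonglongrightarrow> gagliardo_form s g g"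
    using lim(3) by (simp add: w_def)
  \<comment> \<open>the energy that can be lost in the limit\<close>
  define E0 where "E0 k = gagliardo_form s (w k) (w k) / 2 - (\<integral>x. \<bar>w k x\<bar> powr p \<partial>M) / p" for k
  have "(\<lambda>k. (gagliardo_form s (u k) (u k) - gagliardo_form s (w k) (w k)) / 2 -
      ((\<integral>x. \<bar>u k x\<bar> powr p \<partial>M) - (\<integral>x. \<bar>w k x\<bar> powr p \<partial>M)) / p - \<mu> * (\<integral>x. G (u k x) \<partial>M))
      \<longlonglongrightarrow> gagliardo_form s g g / 2 - (\<integral>x. \<bar>g x\<bar> powr p \<partial>M) / p - \<mu> * (\<integral>x. G (g x) \<partial>M)"
    by (intro tendsto_intros p_lim G_lim d_lim) (use p in auto)
  then have E_split: "(\<lambda>k. energy \<Omega> s F (u k) - E0 k) \<longlonglongrightarrow> energy \<Omega> s F g"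
    unfolding E_eq[OF uX] E_eq[OF gX] E0_def by (simp add: diff_divide_distrib algebra_simps)
  have E0: "0 \<le> E0 k" for k
  proof -
    have "gagliardo_form s (w k) (w k) \<le> 2 * gagliardo_form s (u k) (u k) + 2 * gagliardo_form s g g"
    proof -
      have "0 \<le> gagliardo_form s (\<lambda>x. u k x + 1 * g x) (\<lambda>x. u k x + 1 * g x)"
        by (rule gagliardo_form_nonneg)
      then show ?thesis
        unfolding w_def gagliardo_form_expand[OF uX[of k] gX] by simp
    qed
    also have "\<dots> \<le> (2 * \<rho>)\<^sup>2" using uA[of k] gA by (simp add: power2_eq_square)
    finally have "S * gagliardo_form s (w k) (w k) powr (p / 2) \<le> gagliardo_form s (w k) (w k)"
      using \<rho> p S by (intro sobolev_bound_absorbed_on_small_ball[of _ "2 * \<rho>"]) (auto simp: gagliardo_form_nonneg)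
    then have 1: "(\<integral>x. \<bar>w k x\<bar> powr p \<partial>M) \<le> gagliardo_form s (w k) (w k)"
      using pMle[OF wX[of k]] by linarith
    have "(\<integral>x. \<bar>w k x\<bar> powr p \<partial>M) / p \<le> (\<integral>x. \<bar>w k x\<bar> powr p \<partial>M) / 2"
      using p by (intro divide_left_mono) auto
    with 1 show ?thesis unfolding E0_def by linarith
  qed
  have "(\<lambda>k. energy \<Omega> s F (u k)) \<longlonglongrightarrow> I"
    using LIMSEQ_subseq_LIMSEQ[OF E_lim r] by (simp add: u_def o_def)
  then have "energy \<Omega> s F g \<le> I"
    by (rule LIMSEQ_le[OF E_split]) (use E0 in auto)
  then show ?thesis
    using that[OF gX gA] I_le by (force simp: K_def)
qed

section \<open>Growth conditions and the Euler-Lagrange equation\<close>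

lemma subcritical_imp_small:
  fixes G :: "real \<Rightarrow> real"
  assumes K: "0 \<le> K" and q: "1 \<le> q" "q < p"
    and G: "\<And>t. \<bar>G t\<bar> \<le> K * (\<bar>t\<bar> + \<bar>t\<bar> powr q)" and \<epsilon>: "0 < \<epsilon>"
  shows "\<exists>C. \<forall>t. \<bar>G t\<bar> \<le> \<epsilon> * \<bar>t\<bar> powr p + C"
proof -
  define \<delta> where "\<delta> = \<epsilon> / (2 * K + 1)"
  have \<delta>: "0 < \<delta>" using \<epsilon> K by (simp add: \<delta>_def)
  have "2 * K * \<delta> \<le> (2 * K + 1) * \<delta>" using \<delta> by (simp add: algebra_simps)
  also have "\<dots> = \<epsilon>" using K by (simp add: \<delta>_def)
  finally have K\<delta>: "2 * K * \<delta> \<le> \<epsilon>" .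
  \<comment> \<open>for \<open>|t| \<ge> T\<close> one has \<open>|t|^q \<le> \<delta> |t|^p\<close>\<close>
  define T where "T = \<delta> powr (1 / (q - p))"
  have T: "0 < T" using \<delta> by (simp add: T_def)
  have T\<delta>: "T powr (q - p) = \<delta>" using \<delta> q by (simp add: T_def powr_powr)
  have tq: "\<bar>t\<bar> powr q \<le> \<delta> * \<bar>t\<bar> powr p + T powr q" for t :: real
  proof (cases "\<bar>t\<bar> \<le> T")
    case True
    then have "\<bar>t\<bar> powr q \<le> T powr q" using q by (intro powr_mono2) auto
    then show ?thesis using \<delta> by (simp add: add_increasing)
  next
    case False
    then have t: "T \<le> \<bar>t\<bar>" "t \<noteq> 0" using T by auto
    have "\<bar>t\<bar> powr (q - p) \<le> \<delta>"
      unfolding T\<delta>[symmetric] using q T t by (intro powr_mono2') auto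
    then have "\<bar>t\<bar> powr (q - p) * \<bar>t\<bar> powr p \<le> \<delta> * \<bar>t\<bar> powr p" by (intro mult_right_mono) auto
    then have "\<bar>t\<bar> powr q \<le> \<delta> * \<bar>t\<bar> powr p" using t by (simp add: powr_add[symmetric])
    then show ?thesis by (simp add: add_increasing2)
  qed
  have "\<bar>G t\<bar> \<le> \<epsilon> * \<bar>t\<bar> powr p + K * (1 + 2 * T powr q)" for t
  proof -
    have "\<bar>t\<bar> powr 1 \<le> 1 + \<bar>t\<bar> powr q" using q by (intro le_one_plus_powr) auto
    then have "\<bar>t\<bar> + \<bar>t\<bar> powr q \<le> 1 + 2 * (\<delta> * \<bar>t\<bar> powr p + T powr q)" using tq[of t] by simp
    then have "K * (\<bar>t\<bar> + \<bar>t\<bar> powr q) \<le> K * (1 + 2 * (\<delta> * \<bar>t\<bar> powr p + T powr q))"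
      using K by (intro mult_left_mono) auto
    also have "\<dots> = 2 * K * \<delta> * \<bar>t\<bar> powr p + K * (1 + 2 * T powr q)" by (simp add: algebra_simps)
    also have "\<dots> \<le> \<epsilon> * \<bar>t\<bar> powr p + K * (1 + 2 * T powr q)"
      using K\<delta> by (intro add_right_mono mult_right_mono) auto
    finally show ?thesis using G[of t] by linarith
  qed
  then show ?thesis by blast
qed

lemma has_real_derivative_abs_powr:
  fixes p t :: real
  assumes p: "1 < p"
  shows "((\<lambda>t. \<bar>t\<bar> powr p / p) has_real_derivative \<bar>t\<bar> powr (p - 2) * t) (at t)"
proof -
  consider "0 < t" | "t < 0" | "t = 0" by linarith
  then show ?thesis
  proof cases
    case 1
    have "((\<lambda>t. t powr p / p) has_real_derivative \<bar>t\<bar> powr (p - 2) * t) (at t)"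
      using 1 p by (auto intro!: derivative_eq_intros simp: powr_diff field_simps power2_eq_square)
    then show ?thesis
      by (rule has_field_derivative_transform_within_open[where S = "{0<..}"]) (use 1 in auto)
  next
    case 2
    have "((\<lambda>t. (- t) powr p / p) has_real_derivative \<bar>t\<bar> powr (p - 2) * t) (at t)"
      using 2 p by (auto intro!: derivative_eq_intros simp: powr_diff field_simps power2_eq_square)
    then show ?thesis
      by (rule has_field_derivative_transform_within_open[where S = "{..<0}"]) (use 2 in auto)
  next
    case 3
    have "((\<lambda>h. \<bar>h\<bar> powr (p - 1)) \<longlongrightarrow> \<bar>0\<bar> powr (p - 1)) (at (0::real))"
      by (intro tendsto_powr' tendsto_intros) (use p in auto)
    then have "((\<lambda>h. \<bar>h\<bar> powr (p - 1)) \<longlongrightarrow> 0) (at (0::real))" using p by simp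
    then have "((\<lambda>h. \<bar>h\<bar> powr p / p / h) \<longlongrightarrow> 0) (at 0)"
    proof (rule Lim_null_comparison[OF always_eventually, rotated], intro allI)
      fix h :: real
      have "\<bar>h\<bar> powr p / (p * \<bar>h\<bar>) \<le> \<bar>h\<bar> powr p / (1 * \<bar>h\<bar>)"
        using p by (cases "h = 0") (auto intro!: divide_left_mono mult_right_mono)
      then show "norm (\<bar>h\<bar> powr p / p / h) \<le> \<bar>h\<bar> powr (p - 1)"
        using p by (cases "h = 0") (simp_all add: powr_diff abs_mult)
    qed
    then show ?thesis using 3 p by (simp add: DERIV_def)
  qed
qed

lemma continuous_abs_powr_mult:
  fixes p :: real
  assumes p: "2 < p"
  shows "continuous_on UNIV (\<lambda>t::real. \<bar>t\<bar> powr (p - 2) * t)"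
  by (intro continuous_intros continuous_on_powr') (use p in auto)

text \<open>The first-order condition at an interior minimizer \<open>u\<close>: the points \<open>u + v / (n + 1)\<close> lie in the ball for
large \<open>n\<close>, and the difference quotients of the energy along them are nonnegative. The opposite
inequality follows by replacing \<open>v\<close> with \<open>- v\<close>.\<close>

lemma minimizer_one_sided:
  fixes u v :: "real ^ 'n \<Rightarrow> real"
  assumes M: "finite_measure (restrict_space lborel \<Omega>)" and p: "1 \<le> p" and K: "0 \<le> K"
    and F: "\<And>t. (F has_real_derivative f t) (at t)" "F 0 = 0"
    and cont: "continuous_on UNIV f"
    and f: "\<And>t. \<bar>f t\<bar> \<le> K * (1 + \<bar>t\<bar> powr (p - 1))"
    and up: "integrable (restrict_space lborel \<Omega>) (\<lambda>x. \<bar>u x\<bar> powr p)"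
    and vp: "integrable (restrict_space lborel \<Omega>) (\<lambda>x. \<bar>v x\<bar> powr p)"
    and u: "u \<in> X0 \<Omega> s" "gagliardo_form s u u < R" and v: "v \<in> X0 \<Omega> s"
    and min: "\<And>w. w \<in> X0 \<Omega> s \<Longrightarrow> gagliardo_form s w w \<le> R \<Longrightarrow> energy \<Omega> s F u \<le> energy \<Omega> s F w"
  shows "(\<integral>x. f (u x) * v x \<partial>restrict_space lborel \<Omega>) \<le> gagliardo_form s u v"
proof -
  define M where "M = restrict_space lborel \<Omega>"
  have "u \<in> borel_measurable lborel" "v \<in> borel_measurable lborel"
    using u v by (auto simp: X0_def frac_sobolev_iff)
  then have mM: "u \<in> borel_measurable M" "v \<in> borel_measurable M"
    unfolding M_def by (auto intro: measurable_restrict_space1)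
  define a where "a n = 1 / real (Suc n)" for n
  have a: "a \<longlonglongrightarrow> 0" unfolding a_def using LIMSEQ_inverse_real_of_nat by (simp add: inverse_eq_divide)
  define w where "w n = (\<lambda>x. u x + a n * v x)" for n
  have w_eq: "w n = (\<lambda>x. u x + v x / Suc n)" for n by (simp add: w_def a_def)
  have wX: "w n \<in> X0 \<Omega> s" for n unfolding w_def by (rule X0_linear[OF u(1) v])
  have w_form: "gagliardo_form s (w n) (w n) =
      gagliardo_form s u u + 2 * a n * gagliardo_form s u v + (a n)\<^sup>2 * gagliardo_form s v v" for n
    unfolding w_def by (rule gagliardo_form_expand[OF u(1) v])
  have "(\<lambda>n. gagliardo_form s (w n) (w n)) \<longlonglongrightarrow>
      gagliardo_form s u u + 2 * 0 * gagliardo_form s u v + 0\<^sup>2 * gagliardo_form s v v"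
    unfolding w_form by (intro tendsto_intros a)
  then have "(\<lambda>n. gagliardo_form s (w n) (w n)) \<longlonglongrightarrow> gagliardo_form s u u" by simp
  then have "\<forall>\<^sub>F n in sequentially. gagliardo_form s (w n) (w n) < R"
    by (rule order_tendstoD(2)) (rule u(2))
  then obtain n0 where n0: "\<And>n. n \<ge> n0 \<Longrightarrow> gagliardo_form s (w n) (w n) < R"
    unfolding eventually_sequentially by blast
  have X: "(\<lambda>n. ((\<integral>x. F (w n x) \<partial>M) - (\<integral>x. F (u x) \<partial>M)) * Suc n) \<longlonglongrightarrow> (\<integral>x. f (u x) * v x \<partial>M)"
    unfolding w_eq
    using tendsto_difference_quotient[OF M p K F cont f mM[unfolded M_def] up vp] by (simp add: M_def)
  have "(\<lambda>n. gagliardo_form s u v + a n / 2 * gagliardo_form s v v) \<longlonglongrightarrow>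
      gagliardo_form s u v + 0 / 2 * gagliardo_form s v v"
    by (intro tendsto_intros a) auto
  then have Y: "(\<lambda>n. gagliardo_form s u v + a n / 2 * gagliardo_form s v v) \<longlonglongrightarrow> gagliardo_form s u v"
    by simp
  have "((\<integral>x. F (w n x) \<partial>M) - (\<integral>x. F (u x) \<partial>M)) * Suc n \<le> gagliardo_form s u v + a n / 2 * gagliardo_form s v v"
    if "n \<ge> n0" for n
  proof -
    have "energy \<Omega> s F u \<le> energy \<Omega> s F (w n)"
      using min[OF wX less_imp_le[OF n0[OF that]]] .
    then have "(\<integral>x. F (w n x) \<partial>M) - (\<integral>x. F (u x) \<partial>M) \<le>
        a n * gagliardo_form s u v + (a n)\<^sup>2 / 2 * gagliardo_form s v v"
      unfolding energy_def M_def[symmetric] w_form by (simp add: field_simps)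
    then have "((\<integral>x. F (w n x) \<partial>M) - (\<integral>x. F (u x) \<partial>M)) * Suc n \<le>
        (a n * gagliardo_form s u v + (a n)\<^sup>2 / 2 * gagliardo_form s v v) * Suc n"
      by (intro mult_right_mono) auto
    also have "\<dots> = (a n * Suc n) * (gagliardo_form s u v + a n / 2 * gagliardo_form s v v)"
      by (simp add: power2_eq_square algebra_simps)
    also have "a n * Suc n = 1" by (simp add: a_def)
    finally show ?thesis by simp
  qed
  then show ?thesis using LIMSEQ_le[OF X Y] unfolding M_def by blast
qed

lemma rpow_le_one_plus_powr: "0 \<le> t \<Longrightarrow> rpow t r \<le> 1 + t powr r"
  by (simp add: rpow_def)

text \<open>The numerator is positive on an interval \<open>(0, T)\<close> and nonpositive beyond \<open>T\<close>, so that the maximum over \<open>[0, T]\<close> is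
a global one. In the library \<open>0 powr 0 = 0\<close>; the case \<open>q = 1\<close> is continuous at \<open>0\<close> only thanks to
\<open>rpow\<close>.\<close>

lemma h_attains_positive_max:
  fixes A B C p q :: real
  assumes A: "0 < A" and B: "0 \<le> B" and C: "0 < C" and p: "2 < p" and q: "1 \<le> q"
    and h: "\<And>t. 0 \<le> t \<Longrightarrow> h t = (t - C * t powr (p - 1)) / (A + B * rpow t (q - 1))"
  shows "\<exists>m\<ge>0. (\<forall>t\<ge>0. h t \<le> h m) \<and> 0 < h m"
proof -
  \<comment> \<open>the positive zero of the numerator\<close>
  define T where "T = C powr (- 1 / (p - 2))"
  have T: "0 < T" using C by (simp add: T_def)
  have CT: "C * T powr (p - 2) = 1"
  proof -
    have "- 1 / (p - 2) * (p - 2) = - 1" using p by simp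
    then have "T powr (p - 2) = C powr (- 1)" unfolding T_def powr_powr by (simp only:)
    then show ?thesis using C by (simp add: powr_neg_one)
  qed
  have r0: "0 \<le> rpow t r" for t r by (simp add: rpow_def)
  have den: "0 < A + B * rpow t (q - 1)" for t using A B r0[of t "q - 1"] by (simp add: add_pos_nonneg)
  have num: "t - C * t powr (p - 1) = t * (1 - C * t powr (p - 2))" if "0 < t" for t
    using that by (simp add: algebra_simps powr_diff power2_eq_square)
  have beyond: "h t \<le> 0" if "T \<le> t" for t
  proof -
    have t: "0 < t" using T that by simp
    have "T powr (p - 2) \<le> t powr (p - 2)" using T that p by (intro powr_mono2) auto
    then have "1 \<le> C * t powr (p - 2)" using CT C by (metis mult_le_cancel_left_pos)
    then have "t - C * t powr (p - 1) \<le> 0" unfolding num[OF t] using t by (simp add: mult_le_0_iff)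
    then show ?thesis using h[of t] t den[of t] by (simp add: divide_nonpos_pos)
  qed
  have "continuous_on {0..T} (\<lambda>t. rpow t (q - 1))"
  proof (cases "q = 1")
    case False
    then show ?thesis using q unfolding rpow_def
      by (simp, intro continuous_on_powr') (auto intro: continuous_intros)
  qed (simp add: rpow_def)
  moreover have "continuous_on {0..T} (\<lambda>t. t powr (p - 1))"
    using p by (intro continuous_on_powr') (auto intro: continuous_intros)
  ultimately have "continuous_on {0..T} (\<lambda>t. (t - C * t powr (p - 1)) / (A + B * rpow t (q - 1)))"
    using den[THEN less_imp_neq]
    by (intro continuous_on_divide continuous_on_diff continuous_on_add continuous_on_mult
        continuous_on_id continuous_on_const) auto
  then have "continuous_on {0..T} h" by (rule continuous_on_eq) (auto simp: h)
  then obtain m where m: "m \<in> {0..T}" "\<And>t. t \<in> {0..T} \<Longrightarrow> h t \<le> h m"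
    using continuous_attains_sup[of "{0..T}" h] T by auto
  have "0 < h (T / 2)"
  proof -
    have "(T / 2) powr (p - 2) < T powr (p - 2)" using T p by (intro powr_less_mono2) auto
    then have "C * (T / 2) powr (p - 2) < 1" using CT C by (metis mult_less_cancel_left_pos)
    then have "0 < T / 2 * (1 - C * (T / 2) powr (p - 2))" using T by simp
    moreover have "0 < T / 2" using T by simp
    ultimately have "0 < T / 2 - C * (T / 2) powr (p - 1)" by (simp only: num)
    then show ?thesis using h[of "T / 2"] T den[of "T / 2"] by (simp add: zero_less_divide_iff)
  qed
  then have hm: "0 < h m" using m(2)[of "T / 2"] T by simp
  moreover have "h t \<le> h m" if "0 \<le> t" for t
    using m(2)[of t] beyond[of t] that hm by (cases "t \<le> T") auto
  ultimately show ?thesis using m(1) by auto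
qed

text \<open>The supremum is bounded above by the Sobolev inequality, hence it is at least the quotient of any nonzero element,
which is positive.\<close>

lemma embedding_const_pos:
  fixes \<Omega> :: "(real ^ 'n) set"
  assumes p: "p = crit_exp CARD('n) s" "2 < p" and S: "0 < S"
    and sob_int: "\<And>u :: real ^ 'n \<Rightarrow> real. u \<in> X0 \<Omega> s \<Longrightarrow> integrable lborel (\<lambda>x. \<bar>u x\<bar> powr p)"
    and sob: "\<And>u :: real ^ 'n \<Rightarrow> real. u \<in> X0 \<Omega> s \<Longrightarrow>
       (\<integral>x. \<bar>u x\<bar> powr p \<partial>lborel) \<le> S * gagliardo_form s u u powr (p / 2)"
    and \<phi>: "\<phi> \<in> X0 \<Omega> s" "\<not> (AE x in lborel. \<phi> x = 0)"
  shows "0 < embedding_const \<Omega> s"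
proof -
  define U where "U = {u \<in> X0 \<Omega> s. \<not> (AE x in lborel. u x = 0)}"
  have W0: "0 \<le> (\<integral>x. \<bar>u x\<bar> powr p \<partial>lborel)" for u :: "real ^ 'n \<Rightarrow> real" by simp
  have le: "Lp_norm p u \<le> S powr (1 / p) * X0_norm s u" if "u \<in> X0 \<Omega> s" for u
  proof -
    have "Lp_norm p u \<le> (S * gagliardo_form s u u powr (p / 2)) powr (1 / p)"
      unfolding Lp_norm_def using sob[OF that] W0 p by (intro powr_mono2) auto
    also have "\<dots> = S powr (1 / p) * gagliardo_form s u u powr (1 / 2)"
      using S p by (simp add: powr_mult powr_powr)
    also have "gagliardo_form s u u powr (1 / 2) = X0_norm s u"
      unfolding X0_norm_def by (simp add: powr_half_sqrt gagliardo_form_nonneg)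
    finally show ?thesis .
  qed
  have n0: "0 \<le> X0_norm s u" for u :: "real ^ 'n \<Rightarrow> real" by (simp add: X0_norm_def gagliardo_form_nonneg)
  have bdd: "bdd_above ((\<lambda>u. Lp_norm p u / X0_norm s u) ` U)"
  proof -
    have "Lp_norm p u / X0_norm s u \<le> S powr (1 / p)" if "u \<in> X0 \<Omega> s" for u
      using le[OF that] n0[of u] by (cases "X0_norm s u = 0") (auto simp: divide_le_eq)
    then show ?thesis by (auto simp: bdd_above_def U_def)
  qed
  have "0 < Lp_norm p \<phi>"
  proof -
    have "(\<integral>x. \<bar>\<phi> x\<bar> powr p \<partial>lborel) \<noteq> 0"
    proof
      assume "(\<integral>x. \<bar>\<phi> x\<bar> powr p \<partial>lborel) = 0"
      then have "AE x in lborel. \<bar>\<phi> x\<bar> powr p = 0"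
        using sob_int[OF \<phi>(1)] by (subst (asm) integral_nonneg_eq_0_iff_AE) auto
      then have "AE x in lborel. \<phi> x = 0" by eventually_elim simp
      then show False using \<phi>(2) by simp
    qed
    then show ?thesis by (simp add: Lp_norm_def)
  qed
  moreover from this have "0 < X0_norm s \<phi>" using le[OF \<phi>(1)] n0[of \<phi>] by (cases "X0_norm s \<phi> = 0") auto
  ultimately have "0 < Lp_norm p \<phi> / X0_norm s \<phi>" by simp
  also have "\<dots> \<le> (SUP u\<in>U. Lp_norm p u / X0_norm s u)"
    using bdd \<phi> by (intro cSUP_upper) (auto simp: U_def)
  finally show ?thesis by (simp add: embedding_const_def U_def p)
qed

text \<open>An interval integral is used because it is a primitive on both sides of \<open>0\<close>.\<close>

lemma primitive_exists:
  fixes g :: "real \<Rightarrow> real"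
  assumes g: "continuous_on UNIV g"
  obtains G where "\<And>t. (G has_real_derivative g t) (at t)" "G 0 = 0"
    "\<And>t. 0 \<le> t \<Longrightarrow> G t = (LINT \<tau>:{0..t}|lborel. g \<tau>)"
proof
  define G where "G t = (LBINT \<tau>=ereal 0..ereal t. g \<tau>)" for t
  show "(G has_real_derivative g t) (at t)" for t
  proof -
    have "(G has_vector_derivative g t) (at t within {- \<bar>t\<bar> - 1..\<bar>t\<bar> + 1})"
      unfolding G_def by (rule interval_integral_FTC2) (auto intro: continuous_on_subset[OF g])
    then have "(G has_vector_derivative g t) (at t)"
      by (subst (asm) at_within_Icc_at) auto
    then show ?thesis by (simp add: has_real_derivative_iff_has_vector_derivative)
  qed
  show "G 0 = 0" by (simp add: G_def)
  show "G t = (LINT \<tau>:{0..t}|lborel. g \<tau>)" if "0 \<le> t" for t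
    unfolding G_def using that by (intro interval_integral_Icc) auto
qed

text \<open>With \<open>A = [\<phi>]\<^sup>2\<close> and \<open>P = \<integral> \<phi>\<^sup>2\<close>, superquadratic growth of \<open>G\<close> at \<open>0+\<close> with the factor
\<open>(A + 1) / (\<mu> P)\<close> gives \<open>E(t \<phi>) \<le> t\<^sup>2 A / 2 - t\<^sup>2 (A + 1) < 0\<close> for small \<open>t > 0\<close>; the bump takes values in
\<open>[0, 1]\<close>, so that all the arguments \<open>t \<phi>(x)\<close> are small at once.\<close>

lemma energy_negative_somewhere:
  fixes \<Omega> :: "(real ^ 'n) set"
  assumes \<Omega>: "\<Omega> \<in> sets borel" "emeasure lborel \<Omega> < \<infinity>" and p: "0 < p"
    and \<phi>: "\<phi> \<in> X0 \<Omega> s" "\<And>x. 0 \<le> \<phi> x" "\<And>x. \<phi> x \<le> 1" "0 < (\<integral>x. (\<phi> x)\<^sup>2 \<partial>lborel)"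
    and F: "F = (\<lambda>t. \<bar>t\<bar> powr p / p + \<mu> * G t)" and \<mu>: "0 < \<mu>" and \<rho>: "0 < \<rho>"
    and F_int: "\<And>u. u \<in> X0 \<Omega> s \<Longrightarrow> integrable (restrict_space lborel \<Omega>) (\<lambda>x. F (u x))"
    and G0: "G 0 = 0"
    and superquadratic: "\<And>m. \<exists>d>0. \<forall>t. 0 < t \<longrightarrow> t < d \<longrightarrow> m * t\<^sup>2 \<le> G t"
  obtains v where "v \<in> X0 \<Omega> s" "gagliardo_form s v v \<le> \<rho>\<^sup>2" "energy \<Omega> s F v < 0"
proof -
  define M where "M = restrict_space lborel \<Omega>"
  define A where "A = gagliardo_form s \<phi> \<phi>"
  define P where "P = (\<integral>x. (\<phi> x)\<^sup>2 \<partial>M)"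
  have A0: "0 \<le> A" by (simp add: A_def gagliardo_form_nonneg)
  have \<phi>2: "integrable lborel (\<lambda>x. (\<phi> x)\<^sup>2)" and \<phi>0: "AE x in lborel. x \<notin> \<Omega> \<longrightarrow> \<phi> x = 0"
    and [measurable]: "\<phi> \<in> borel_measurable lborel"
    using \<phi>(1) by (auto simp: X0_def frac_sobolev_iff)
  have \<phi>2M: "integrable M (\<lambda>x. (\<phi> x)\<^sup>2)"
    unfolding M_def using \<Omega>(1) integrable_mult_indicator[OF _ \<phi>2, of \<Omega>]
    by (subst integrable_restrict_space) auto
  have "P = (\<integral>x. indicator \<Omega> x *\<^sub>R (\<phi> x)\<^sup>2 \<partial>lborel)"
    unfolding P_def M_def using \<Omega>(1) by (subst integral_restrict_space) auto
  also have "\<dots> = (\<integral>x. (\<phi> x)\<^sup>2 \<partial>lborel)"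
  proof (rule integral_cong_AE)
    show "AE x in lborel. indicator \<Omega> x *\<^sub>R (\<phi> x)\<^sup>2 = (\<phi> x)\<^sup>2"
      using \<phi>0 by eventually_elim (auto simp: indicator_def)
  qed (use \<Omega> in auto)
  finally have P: "0 < P" using \<phi>(4) by simp
  define m where "m = (A + 1) / (\<mu> * P)"
  obtain d where d: "0 < d" "\<And>t. 0 < t \<Longrightarrow> t < d \<Longrightarrow> m * t\<^sup>2 \<le> G t" using superquadratic by blast
  define t where "t = min (d / 2) (\<rho> / (A + 1))"
  have "t \<le> d / 2" unfolding t_def by (rule min.cobounded1)
  then have t: "0 < t" "t < d" "t \<le> \<rho> / (A + 1)" using d(1) \<rho> A0 by (auto simp: t_def)
  \<comment> \<open>\<open>v = t \<phi>\<close>, in the form required by \<open>X0_linear\<close>\<close>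
  define v where "v = (\<lambda>x. \<phi> x + (t - 1) * \<phi> x)"
  have v_eq: "v x = t * \<phi> x" for x by (simp add: v_def algebra_simps)
  have vX: "v \<in> X0 \<Omega> s" unfolding v_def by (rule X0_linear[OF \<phi>(1) \<phi>(1)])
  have v_form: "gagliardo_form s v v = t\<^sup>2 * A"
    unfolding v_def gagliardo_form_expand[OF \<phi>(1) \<phi>(1)]
    by (simp add: A_def power2_eq_square algebra_simps)
  have "t\<^sup>2 * A \<le> \<rho>\<^sup>2"
  proof -
    have "t * (A + 1) \<le> \<rho>" using t(3) A0 by (simp add: field_simps)
    then have "(t * (A + 1))\<^sup>2 \<le> \<rho>\<^sup>2" using t A0 by (intro power_mono) auto
    moreover have "A \<le> (A + 1)\<^sup>2" using A0 by (simp add: power2_eq_square algebra_simps)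
    then have "t\<^sup>2 * A \<le> t\<^sup>2 * (A + 1)\<^sup>2" by (intro mult_left_mono) auto
    ultimately show ?thesis by (simp add: power_mult_distrib)
  qed
  moreover have "energy \<Omega> s F v < 0"
  proof -
    have "\<mu> * m * t\<^sup>2 * P = (\<integral>x. \<mu> * m * t\<^sup>2 * (\<phi> x)\<^sup>2 \<partial>M)" by (simp add: P_def)
    also have "\<dots> \<le> (\<integral>x. F (v x) \<partial>M)"
    proof (rule integral_mono)
      show "integrable M (\<lambda>x. F (v x))" unfolding M_def by (rule F_int[OF vX])
      show "integrable M (\<lambda>x. \<mu> * m * t\<^sup>2 * (\<phi> x)\<^sup>2)" using \<phi>2M by simp
      show "\<mu> * m * t\<^sup>2 * (\<phi> x)\<^sup>2 \<le> F (v x)" for x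
      proof -
        have "m * (t * \<phi> x)\<^sup>2 \<le> G (t * \<phi> x)"
        proof (cases "\<phi> x = 0")
          case False
          then have "0 < \<phi> x" using \<phi>(2)[of x] by simp
          then have "0 < t * \<phi> x" using t by simp
          moreover have "t * \<phi> x \<le> t" using mult_left_mono[of "\<phi> x" 1 t] t \<phi>(3)[of x] by simp
          then have "t * \<phi> x < d" using t by linarith
          ultimately show ?thesis by (rule d(2))
        qed (simp add: G0)
        then have "\<mu> * (m * (t * \<phi> x)\<^sup>2) \<le> \<mu> * G (t * \<phi> x)" using \<mu> by (intro mult_left_mono) auto
        moreover have "0 \<le> \<bar>v x\<bar> powr p / p" using p by simp
        ultimately show ?thesis by (simp add: F v_eq power_mult_distrib mult_ac)
      qed
    qed
    finally have "\<mu> * m * t\<^sup>2 * P \<le> (\<integral>x. F (v x) \<partial>M)" .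
    moreover have "\<mu> * m * t\<^sup>2 * P = t\<^sup>2 * (A + 1)" using \<mu> P by (simp add: m_def)
    ultimately have "energy \<Omega> s F v \<le> t\<^sup>2 * A / 2 - t\<^sup>2 * (A + 1)"
      unfolding energy_def M_def v_form by linarith
    also have "\<dots> = - (t\<^sup>2 * (A / 2 + 1))" by (simp add: algebra_simps)
    also have "\<dots> < 0" using t A0 by simp
    finally show ?thesis .
  qed
  ultimately show ?thesis using that vX v_form by simp
qed

section \<open>Existence of a nontrivial weak solution\<close>

theorem theorem1:
  fixes \<Omega> :: "(real ^ 'n) set"
    and s a1 a2 q c p :: real
    and g h :: "real \<Rightarrow> real"
  assumes s: "0 < s" "s < 1"
    and n: "real CARD('n) > 2 * s"
    and \<Omega>: "\<Omega> \<noteq> {}" "open \<Omega>" "bounded \<Omega>" "lipschitz_boundary \<Omega>"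
    and p: "p = crit_exp CARD('n) s"
    and c: "c = embedding_const \<Omega> s"
    and g: "continuous_on UNIV g"
    and a: "a1 > 0" "a2 > 0"
    and q: "1 \<le> q" "q < p"
    and growth: "\<And>t. \<bar>g t\<bar> \<le> a1 + a2 * rpow \<bar>t\<bar> (q - 1)"
    and liminf: "Liminf (at_right 0) (\<lambda>t. ereal ((LINT \<tau>:{0..t}|lborel. g \<tau>) / t\<^sup>2)) = \<infinity>"
    and h: "\<And>t. t \<ge> 0 \<Longrightarrow>
      h t = (t - c powr p * t powr (p - 1)) /
            (a1 * c * measure lborel \<Omega> powr ((p - 1) / p)
             + a2 * c powr q * measure lborel \<Omega> powr ((p - q) / p) * rpow t (q - 1))"
  shows "\<exists>m \<ge> 0. (\<forall>t \<ge> 0. h t \<le> h m) \<and>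
    (\<exists>\<alpha> \<beta>. \<alpha> < \<beta> \<and> {\<alpha><..<\<beta>} \<subseteq> {0<..<h m} \<and>
      (\<forall>\<mu> \<in> {\<alpha><..<\<beta>}. \<exists>u. weak_solution \<Omega> s g \<mu> u \<and> \<not> (AE x in lborel. u x = 0)))"
proof -
  define M where "M = restrict_space lborel \<Omega>"
  have \<Omega>b: "\<Omega> \<in> sets borel" using \<Omega> by simp
  have fin: "emeasure lborel \<Omega> < \<infinity>" using \<Omega> by (intro emeasure_bounded_finite)
  have finM: "finite_measure M" unfolding M_def using \<Omega>b fin by (rule finite_measure_restrict_lborel)
  interpret M: finite_measure M by (rule finM)
  have p2: "2 < p" unfolding p using s n by (intro crit_exp_gt_2) auto
  have p1: "1 \<le> p" using p2 by simp
  obtain S where S: "0 < S"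
    "\<And>u :: real ^ 'n \<Rightarrow> real. u \<in> frac_sobolev s \<Longrightarrow> integrable lborel (\<lambda>x. \<bar>u x\<bar> powr p)"
    "\<And>u :: real ^ 'n \<Rightarrow> real. u \<in> frac_sobolev s \<Longrightarrow>
       (\<integral>x. \<bar>u x\<bar> powr p \<partial>lborel) \<le> S * gagliardo_form s u u powr (p / 2)"
    by (rule fractional_sobolev[OF s(1) n p], rule that) blast+
  have sob_int: "integrable lborel (\<lambda>x. \<bar>u x\<bar> powr p)"
    and sob: "(\<integral>x. \<bar>u x\<bar> powr p \<partial>lborel) \<le> S * gagliardo_form s u u powr (p / 2)"
    if "u \<in> X0 \<Omega> s" for u using S that by (auto simp: X0_def)
  have pM: "integrable M (\<lambda>x. \<bar>u x\<bar> powr p)"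
    and pMle: "(\<integral>x. \<bar>u x\<bar> powr p \<partial>M) \<le> S * gagliardo_form s u u powr (p / 2)" if "u \<in> X0 \<Omega> s" for u
    using restrict_space_powr[OF \<Omega>b sob_int[OF that]] sob[OF that] by (auto simp: M_def)
  have meas: "u \<in> borel_measurable M" if "u \<in> X0 \<Omega> s" for u
    unfolding M_def by (rule measurable_restrict_space1) (use that in \<open>auto simp: X0_def frac_sobolev_iff\<close>)
  obtain \<phi> where \<phi>: "\<phi> \<in> X0 \<Omega> s" "\<And>x. 0 \<le> \<phi> x" "\<And>x. \<phi> x \<le> 1" "0 < (\<integral>x. (\<phi> x)\<^sup>2 \<partial>lborel)"
    by (rule bump_in_X0[OF s \<Omega>(2,1)], rule that) blast+
  have \<phi>_nz: "\<not> (AE x in lborel. \<phi> x = 0)"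
  proof
    assume "AE x in lborel. \<phi> x = 0"
    then have "AE x in lborel. (\<phi> x)\<^sup>2 = 0" by eventually_elim simp
    then have "(\<integral>x. (\<phi> x)\<^sup>2 \<partial>lborel) = 0" by (rule integral_eq_zero_AE)
    then show False using \<phi>(4) by simp
  qed

  have "\<exists>m\<ge>0. (\<forall>t\<ge>0. h t \<le> h m) \<and> 0 < h m"
  proof (rule h_attains_positive_max[OF _ _ _ p2 q(1) h])
    have "0 < c" unfolding c by (rule embedding_const_pos[OF p p2 S(1) sob_int sob \<phi>(1) \<phi>_nz])
    moreover have "0 < measure lborel \<Omega>"
    proof -
      obtain x0 r where "0 < r" "ball x0 r \<subseteq> \<Omega>" using \<Omega>(1,2) by (meson ex_in_conv openE)
      then have "0 < measure lborel (ball x0 r)" "measure lborel (ball x0 r) \<le> measure lborel \<Omega>"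
        using content_ball_pos[of r x0] fin \<Omega>b by (auto intro!: measure_mono_fmeasurable fmeasurableI)
      then show ?thesis by linarith
    qed
    ultimately show "0 < a1 * c * measure lborel \<Omega> powr ((p - 1) / p)"
      "0 \<le> a2 * c powr q * measure lborel \<Omega> powr ((p - q) / p)" "0 < c powr p"
      using a by auto
  qed
  then obtain m where m: "0 \<le> m" "\<And>t. 0 \<le> t \<Longrightarrow> h t \<le> h m" "0 < h m" by blast

  obtain G where G: "\<And>t. (G has_real_derivative g t) (at t)" "G 0 = 0"
    "\<And>t. 0 \<le> t \<Longrightarrow> G t = (LINT \<tau>:{0..t}|lborel. g \<tau>)"
    by (rule primitive_exists[OF g], rule that) blast+
  have G_cont: "continuous_on UNIV G"
    using G(1) by (meson DERIV_continuous_on has_field_derivative_at_within)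
  define Kq where "Kq = a1 + a2"
  have Kq: "0 \<le> Kq" using a by (simp add: Kq_def)
  have gq: "\<bar>g t\<bar> \<le> Kq * (1 + \<bar>t\<bar> powr (q - 1))" for t
  proof -
    have "a2 * rpow \<bar>t\<bar> (q - 1) \<le> a2 * (1 + \<bar>t\<bar> powr (q - 1))"
      using a by (intro mult_left_mono rpow_le_one_plus_powr) auto
    moreover have "0 \<le> a1 * \<bar>t\<bar> powr (q - 1)" using a by simp
    ultimately show ?thesis using growth[of t] unfolding Kq_def distrib_left distrib_right by linarith
  qed
  have gp: "\<bar>g t\<bar> \<le> (2 * Kq) * (1 + \<bar>t\<bar> powr (p - 1))" for t
  proof -
    have double: "1 + y \<le> 2 * (1 + x)" if "y \<le> 1 + x" "0 \<le> x" for x y :: real using that by simp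
    have "1 + \<bar>t\<bar> powr (q - 1) \<le> 2 * (1 + \<bar>t\<bar> powr (p - 1))"
      using q by (intro double le_one_plus_powr) auto
    then have "Kq * (1 + \<bar>t\<bar> powr (q - 1)) \<le> Kq * (2 * (1 + \<bar>t\<bar> powr (p - 1)))"
      using Kq by (intro mult_left_mono) auto
    then have "\<bar>g t\<bar> \<le> Kq * (2 * (1 + \<bar>t\<bar> powr (p - 1)))" using gq[of t] by (rule order_trans[rotated])
    then show ?thesis by (simp only: mult_ac)
  qed
  have Gq: "\<bar>G t\<bar> \<le> Kq * (\<bar>t\<bar> + \<bar>t\<bar> powr q)" for t
  proof -
    have "\<bar>G t\<bar> \<le> Kq * (\<bar>t\<bar> + \<bar>t\<bar> powr (q - 1) * \<bar>t\<bar>)"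
      using primitive_increment_le[OF q(1) Kq G(1) gq, of 0 t] G(2) by simp
    also have "\<bar>t\<bar> powr (q - 1) * \<bar>t\<bar> = \<bar>t\<bar> powr q" by (cases "t = 0") (auto simp: powr_diff)
    finally show ?thesis .
  qed
  note small = subcritical_imp_small[OF Kq q Gq]
  have superquadratic: "\<exists>d>0. \<forall>t. 0 < t \<longrightarrow> t < d \<longrightarrow> b * t\<^sup>2 \<le> G t" for b
  proof -
    have "\<forall>\<^sub>F t in at_right 0. ereal b < ereal ((LINT \<tau>:{0..t}|lborel. g \<tau>) / t\<^sup>2)"
      by (rule less_LiminfD) (simp add: liminf)
    then obtain d where d: "0 < d" "\<And>t. 0 < t \<Longrightarrow> t < d \<Longrightarrow> b < (LINT \<tau>:{0..t}|lborel. g \<tau>) / t\<^sup>2"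
      by (auto simp: eventually_at_right_field)
    have "b * t\<^sup>2 \<le> G t" if "0 < t" "t < d" for t
    proof -
      have "b < G t / t\<^sup>2" using d(2)[OF that] that G(3)[of t] by simp
      then have "b * t\<^sup>2 < G t" using that by (simp add: pos_less_divide_eq)
      then show ?thesis by simp
    qed
    then show ?thesis using d(1) by blast
  qed

  \<comment> \<open>the radius for which \<open>S (2 \<rho>)^(p - 2) = 1\<close>\<close>
  define \<rho> where "\<rho> = (1 / S) powr (1 / (p - 2)) / 2"
  have \<rho>: "0 < \<rho>" using S by (simp add: \<rho>_def)
  have S\<rho>: "S * (2 * \<rho>) powr (p - 2) \<le> 1"
    using S p2 by (simp add: \<rho>_def powr_powr)
  obtain C where C: "\<And>t. \<bar>G t\<bar> \<le> 1 * \<bar>t\<bar> powr p + C" using small[of 1] by auto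
  define D where "D = \<rho>\<^sup>2 + \<bar>C\<bar> * measure M (space M)"
  have D: "0 < D" using \<rho> by (simp add: D_def add_pos_nonneg)
  \<comment> \<open>lower bound for \<open>E\<^sub>0\<close> on the sphere, to be compared with \<open>\<mu> D\<close>, where \<open>D\<close> bounds \<open>\<integral> G(u)\<close> on the ball\<close>
  define \<kappa> where "\<kappa> = (1 / 2 - 1 / p) * \<rho>\<^sup>2"
  have \<kappa>: "0 < \<kappa>" using \<rho> p2 by (simp add: \<kappa>_def field_simps)
  \<comment> \<open>the second bound keeps the energy positive on the sphere\<close>
  define \<beta> where "\<beta> = min (h m) (\<kappa> / D)"
  have \<beta>: "0 < \<beta>" using m D \<kappa> by (simp add: \<beta>_def)

  have "\<exists>u. weak_solution \<Omega> s g \<mu> u \<and> \<not> (AE x in lborel. u x = 0)" if \<mu>: "\<mu> \<in> {0<..<\<beta>}" for \<mu>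
  proof -
    have \<mu>0: "0 < \<mu>" and \<mu>D: "\<mu> * D < \<kappa>"
      using \<mu> D by (auto simp: \<beta>_def field_simps)
    define f where "f t = \<bar>t\<bar> powr (p - 2) * t + \<mu> * g t" for t
    define F where "F = (\<lambda>t. \<bar>t\<bar> powr p / p + \<mu> * G t)"
    define K where "K = 1 + \<mu> * (2 * Kq)"
    have K: "0 \<le> K" using \<mu>0 Kq by (simp add: K_def)
    have dF: "(F has_real_derivative f t) (at t)" for t
      unfolding F_def f_def using p2
      by (intro DERIV_add DERIV_cmult has_real_derivative_abs_powr G(1)) auto
    have F0: "F 0 = 0" using p2 by (simp add: F_def G(2))
    have f_cont: "continuous_on UNIV f"
      unfolding f_def
      by (intro continuous_on_add continuous_abs_powr_mult[OF p2] continuous_on_mult continuous_on_const g)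
    have crit_le: "\<bar>\<bar>t\<bar> powr (p - 2) * t\<bar> \<le> 1 * (1 + \<bar>t\<bar> powr (p - 1))" for t
      by (cases "t = 0") (auto simp: abs_mult powr_diff power2_eq_square)
    have f_le: "\<bar>f t\<bar> \<le> K * (1 + \<bar>t\<bar> powr (p - 1))" for t
    proof -
      have "\<bar>f t\<bar> \<le> \<bar>\<bar>t\<bar> powr (p - 2) * t\<bar> + \<mu> * \<bar>g t\<bar>"
        unfolding f_def using \<mu>0 by (metis abs_mult abs_of_pos abs_triangle_ineq)
      also have "\<dots> \<le> 1 * (1 + \<bar>t\<bar> powr (p - 1)) + \<mu> * ((2 * Kq) * (1 + \<bar>t\<bar> powr (p - 1)))"
        using \<mu>0 by (intro add_mono crit_le mult_left_mono gp) auto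
      also have "\<dots> = K * (1 + \<bar>t\<bar> powr (p - 1))" by (simp add: K_def algebra_simps)
      finally show ?thesis .
    qed
    have F_int: "integrable M (\<lambda>x. F (u x))" if "u \<in> X0 \<Omega> s" for u
      by (rule integrable_primitive[OF finM p1 K dF F0 f_cont f_le meas[OF that] meas[OF that] pM[OF that] pM[OF that]])

    obtain u where u: "u \<in> X0 \<Omega> s" "gagliardo_form s u u \<le> \<rho>\<^sup>2"
      and min: "\<And>v. v \<in> X0 \<Omega> s \<Longrightarrow> gagliardo_form s v v \<le> \<rho>\<^sup>2 \<Longrightarrow> energy \<Omega> s F u \<le> energy \<Omega> s F v"
      by (rule energy_minimizer_exists[OF s(1) \<Omega>(2,3) p2 S(1) sob_int sob \<rho> S\<rho> G_cont small F_def]) auto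
    obtain v where v: "v \<in> X0 \<Omega> s" "gagliardo_form s v v \<le> \<rho>\<^sup>2" "energy \<Omega> s F v < 0"
      by (rule energy_negative_somewhere[OF \<Omega>b fin _ \<phi> F_def \<mu>0 \<rho> F_int[unfolded M_def] G(2) superquadratic])
        (use p2 in auto)
    have E_neg: "energy \<Omega> s F u < 0" using min[OF v(1,2)] v(3) by linarith

    have nz: "\<not> (AE x in lborel. u x = 0)"
    proof
      assume u0: "AE x in lborel. u x = 0"
      then have "AE x in lborel. x \<in> \<Omega> \<longrightarrow> u x = 0" by eventually_elim simp
      then have "AE x in M. u x = 0" unfolding M_def using \<Omega>b by (subst AE_restrict_space_iff) auto
      then have "AE x in M. F (u x) = 0" by eventually_elim (simp add: F0)
      then have "(\<integral>x. F (u x) \<partial>M) = 0" by (rule integral_eq_zero_AE)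
      then show False using E_neg gagliardo_form_nonneg[of s u] by (simp add: energy_def M_def)
    qed

    \<comment> \<open>on the sphere the energy would be at least \<open>\<kappa> - \<mu> D > 0\<close>\<close>
    have u_int: "gagliardo_form s u u < \<rho>\<^sup>2"
    proof (rule ccontr)
      assume "\<not> gagliardo_form s u u < \<rho>\<^sup>2"
      then have eq: "gagliardo_form s u u = \<rho>\<^sup>2" using u(2) by simp
      have "\<rho>\<^sup>2 \<le> (2 * \<rho>)\<^sup>2" using \<rho> by (intro power_mono) auto
      then have "S * gagliardo_form s u u powr (p / 2) \<le> gagliardo_form s u u"
        using \<rho> p2 S S\<rho> by (intro sobolev_bound_absorbed_on_small_ball[of _ "2 * \<rho>"]) (auto simp: eq)
      then have up: "(\<integral>x. \<bar>u x\<bar> powr p \<partial>M) \<le> \<rho>\<^sup>2" using pMle[OF u(1)] eq by linarith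
      have "(\<integral>x. F (u x) \<partial>M) \<le> (\<integral>x. \<bar>u x\<bar> powr p / p + \<mu> * (\<bar>u x\<bar> powr p + \<bar>C\<bar>) \<partial>M)"
      proof (rule integral_mono[OF F_int[OF u(1)]])
        show "integrable M (\<lambda>x. \<bar>u x\<bar> powr p / p + \<mu> * (\<bar>u x\<bar> powr p + \<bar>C\<bar>))" using pM[OF u(1)] by simp
        fix x
        have "G (u x) \<le> \<bar>u x\<bar> powr p + \<bar>C\<bar>" using C[of "u x"] by linarith
        then have "\<mu> * G (u x) \<le> \<mu> * (\<bar>u x\<bar> powr p + \<bar>C\<bar>)" using \<mu>0 by (intro mult_left_mono) auto
        then show "F (u x) \<le> \<bar>u x\<bar> powr p / p + \<mu> * (\<bar>u x\<bar> powr p + \<bar>C\<bar>)" by (simp add: F_def)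
      qed
      also have "\<dots> = (\<integral>x. \<bar>u x\<bar> powr p \<partial>M) / p + \<mu> * ((\<integral>x. \<bar>u x\<bar> powr p \<partial>M) + \<bar>C\<bar> * measure M (space M))"
        using pM[OF u(1)] by simp
      also have "\<dots> \<le> \<rho>\<^sup>2 / p + \<mu> * D" unfolding D_def
        using up \<mu>0 p2 by (intro add_mono mult_left_mono divide_right_mono) auto
      finally have "energy \<Omega> s F u \<ge> \<rho>\<^sup>2 / 2 - (\<rho>\<^sup>2 / p + \<mu> * D)"
        unfolding energy_def M_def[symmetric] eq by linarith
      moreover have "\<rho>\<^sup>2 / 2 - \<rho>\<^sup>2 / p = \<kappa>" by (simp add: \<kappa>_def algebra_simps)
      ultimately show False using E_neg \<mu>D by linarith
    qed

    have ge: "(\<integral>x. f (u x) * w x \<partial>M) \<le> gagliardo_form s u w" if w: "w \<in> X0 \<Omega> s" for w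
      unfolding M_def
      by (rule minimizer_one_sided[OF finM[unfolded M_def] p1 K dF F0 f_cont f_le pM[OF u(1), unfolded M_def]
            pM[OF w, unfolded M_def] u(1) u_int w min])
    have euler_lagrange: "gagliardo_form s u w = (\<integral>x. f (u x) * w x \<partial>M)" if w: "w \<in> X0 \<Omega> s" for w
    proof -
      \<comment> \<open>this is \<open>- w\<close>\<close>
      have "(\<lambda>x. w x + (- 2) * w x) \<in> X0 \<Omega> s" using w w by (rule X0_linear)
      then have "(\<lambda>x. - w x) \<in> X0 \<Omega> s" by simp
      from ge[OF this] have "- (\<integral>x. f (u x) * w x \<partial>M) \<le> gagliardo_form s u (\<lambda>x. - w x)" by simp
      also have "\<dots> = - gagliardo_form s u w"
      proof -
        have "diff_quot s (\<lambda>x. - w x) z = - diff_quot s w z" for z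
          by (simp add: diff_quot_def case_prod_beta minus_divide_left)
        then show ?thesis by (simp add: gagliardo_form_eq)
      qed
      finally show ?thesis using ge[OF w] by simp
    qed

    have "weak_solution \<Omega> s g \<mu> u"
      unfolding weak_solution_def
    proof (intro conjI ballI)
      show "u \<in> X0 \<Omega> s" by (rule u(1))
      fix w :: "real ^ 'n \<Rightarrow> real" assume w: "w \<in> X0 \<Omega> s"
      have i1: "integrable M (\<lambda>x. \<bar>u x\<bar> powr (p - 2) * u x * w x)"
        by (rule integrable_growth_mult[OF finM p1 _ has_real_derivative_abs_powr _ continuous_abs_powr_mult[OF p2] crit_le
              meas[OF u(1)] meas[OF w] pM[OF u(1)] pM[OF w]]) (use p2 in auto)
      have i2: "integrable M (\<lambda>x. g (u x) * w x)"
        by (rule integrable_growth_mult[OF finM p1 _ G(1,2) g gp meas[OF u(1)] meas[OF w] pM[OF u(1)] pM[OF w]])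
          (use Kq in auto)
      show "set_integrable lborel \<Omega> (\<lambda>x. \<bar>u x\<bar> powr (crit_exp CARD('n) s - 2) * u x * w x)"
        "set_integrable lborel \<Omega> (\<lambda>x. g (u x) * w x)"
        using i1 i2 \<Omega>b unfolding set_integrable_def p[symmetric] M_def
        by (simp_all add: integrable_restrict_space)
      have "gagliardo_form s u w = (\<integral>x. \<bar>u x\<bar> powr (p - 2) * u x * w x + \<mu> * (g (u x) * w x) \<partial>M)"
        unfolding euler_lagrange[OF w] f_def by (simp add: algebra_simps)
      also have "\<dots> = (\<integral>x. \<bar>u x\<bar> powr (p - 2) * u x * w x \<partial>M) + \<mu> * (\<integral>x. g (u x) * w x \<partial>M)"
        using i1 i2 by simp
      finally show "gagliardo_form s u w =
          (LINT x:\<Omega>|lborel. \<bar>u x\<bar> powr (crit_exp CARD('n) s - 2) * u x * w x)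
          + \<mu> * (LINT x:\<Omega>|lborel. g (u x) * w x)"
        using \<Omega>b unfolding set_lebesgue_integral_def p[symmetric] M_def
        by (simp add: integral_restrict_space)
    qed
    with nz show ?thesis by blast
  qed
  moreover have "{0<..<\<beta>} \<subseteq> {0<..<h m}" by (auto simp: \<beta>_def)
  ultimately show ?thesis using m(1,2) \<beta> by blast
qed

end
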